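(* Let $n\in\mathbb{N}$ and let $T$ be a form in $3$ variables over $\mathbb{C}$ of degree $d=8+2n$. Let $A=\{P_1,\dots,P_r\}\subset\mathbb{P}^2$ be a non-redundant decomposition of $T$ with $r=\ell(A)\leq 11+3n$, and suppose that $T$ has rank $r$. Then either $A$ is the unique decomposition of $T$ of length $r$, or there is an infinite (positive dimensional) family $\{A_t\}$ of decompositions of $T$ of length $r$ such that $A_0=A$.
   Context: We work over $\mathbb{C}$, and $\mathbb{N}$ includes $0$. A form $T$ of degree $d$ in $m+1$ variables is regarded as a point of $\mathbb{P}(\mathrm{Sym}^d(\mathbb{C}^{m+1}))$ (so $T\neq 0$, up to scaling). A point $P\in\mathbb{P}^m=\mathbb{P}(\mathbb{C}^{m+1})$ is identified with a linear form $L$ up to scaling, and the Veronese map $v_d:\mathbb{P}^m\to\mathbb{P}(\mathrm{Sym}^d(\mathbb{C}^{m+1}))$ sends $L$ to $L^d$. For a finite set $Z\subset\mathbb{P}^m$, $\ell(Z)$ is its cardinality and $v_d(Z)$ its image. A finite set $A=\{P_1,\dots,P_r\}$ of $r$ distinct points of $\mathbb{P}^m$ is a decomposition of $T$, of length $\ell(A)=r$, if $T$ lies in the linear span $\langle v_d(A)\rangle$. It is non-redundant if $T\notin\langle v_d(A')\rangle$ for every proper subset $A'\subset A$. The rank of $T$ is the smallest length of a decomposition of $T$. A positive dimensional family $\{A_t\}$ of decompositions of $T$ of length $r$ with $A_0=A$ means a positive dimensional irreducible locally closed subvariety of the symmetric product $(\mathbb{P}^m)^{(r)}$, containing the point corresponding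 to $A$, all of whose points $A_t$ are decompositions of $T$ of length $r$. *)

theory Defs
  imports "HOL-Analysis.Analysis" "HOL-Library.Poly_Mapping" "HOL-Library.Multiset"
begin

section \<open>Polynomials and forms\<close>

text \<open>Polynomials over the complex numbers with variables indexed by \<open>'v\<close>: finitely supported maps
  from monomials to coefficients.  The ring structure is the convolution product of
  \<^theory>\<open>HOL-Library.Poly_Mapping\<close>.\<close>

type_synonym 'v cpoly = "('v \<Rightarrow>\<^sub>0 nat) \<Rightarrow>\<^sub>0 complex"

definition cscale :: "complex \<Rightarrow> 'v cpoly \<Rightarrow> 'v cpoly" where
  "cscale c F = Poly_Mapping.map ((*) c) F"

lemma lookup_cscale [simp]: "Poly_Mapping.lookup (cscale c F) u = c * Poly_Mapping.lookup F u"
  by (auto simp: cscale_def Poly_Mapping.map.rep_eq when_def)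

global_interpretation cpoly: vector_space "cscale :: complex \<Rightarrow> 'v cpoly \<Rightarrow> 'v cpoly"
  by unfold_locales (auto intro!: poly_mapping_eqI simp: lookup_add algebra_simps)

definition monom_eval :: "('v \<Rightarrow> complex) \<Rightarrow> ('v \<Rightarrow>\<^sub>0 nat) \<Rightarrow> complex" where
  "monom_eval x u = (\<Prod>i\<in>Poly_Mapping.keys u. x i ^ Poly_Mapping.lookup u i)"

definition cpoly_eval :: "('v \<Rightarrow> complex) \<Rightarrow> 'v cpoly \<Rightarrow> complex" where
  "cpoly_eval x F = (\<Sum>u\<in>Poly_Mapping.keys F. Poly_Mapping.lookup F u * monom_eval x u)"

text \<open>Like every homogeneity predicate, this one holds for the zero polynomial.\<close>

definition is_form :: "nat \<Rightarrow> 'n::finite cpoly \<Rightarrow> bool" where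
  "is_form d F \<longleftrightarrow> (\<forall>u\<in>Poly_Mapping.keys F. (\<Sum>i\<in>UNIV. Poly_Mapping.lookup u i) = d)"

definition linear_form :: "complex ^ 'n \<Rightarrow> 'n::finite cpoly" where
  "linear_form v = (\<Sum>i\<in>UNIV. Poly_Mapping.single (Poly_Mapping.single i 1) (v $ i))"

section \<open>Projective space, the Veronese map, decompositions and rank\<close>

text \<open>The space of dimension \<open>CARD('n) - 1\<close>, as the set of lines of the coordinate space.  A point is
  identified with the linear forms, unique up to scaling, whose coefficient vectors are its nonzero
  elements.\<close>

typedef 'n::finite proj_space = "{V :: (complex ^ 'n) set. vec.subspace V \<and> vec.dim V = 1}"
proof -
  have "vec.dim (vec.span {axis undefined 1 :: complex ^ 'n}) = 1"
    by (simp add: vec.dim_span axis_eq_0_iff)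
  then show ?thesis
    using vec.subspace_span by blast
qed

definition reps :: "'n::finite proj_space \<Rightarrow> (complex ^ 'n) set" where
  "reps P = Rep_proj_space P - {0}"

text \<open>A point of the projectivisation of the space of forms of degree \<open>d\<close> is again encoded by
  the corresponding line.\<close>

definition veronese :: "nat \<Rightarrow> 'n::finite proj_space \<Rightarrow> 'n cpoly set" where
  "veronese d P = cpoly.span ((\<lambda>v. linear_form v ^ d) ` reps P)"

definition veronese_span :: "nat \<Rightarrow> 'n::finite proj_space set \<Rightarrow> 'n cpoly set" where
  "veronese_span d A = cpoly.span (\<Union>P\<in>A. veronese d P)"

definition decomposition :: "nat \<Rightarrow> 'n::finite cpoly \<Rightarrow> 'n proj_space set \<Rightarrow> bool" where
  "decomposition d T A \<longleftrightarrow> finite A \<and> T \<in> veronese_span d A"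

definition nonredundant :: "nat \<Rightarrow> 'n::finite cpoly \<Rightarrow> 'n proj_space set \<Rightarrow> bool" where
  "nonredundant d T A \<longleftrightarrow> (\<forall>A'. A' \<subset> A \<longrightarrow> T \<notin> veronese_span d A')"

definition form_rank :: "nat \<Rightarrow> 'n::finite cpoly \<Rightarrow> nat" where
  "form_rank d T = (LEAST r. \<exists>A. decomposition d T A \<and> card A = r)"

section \<open>The Zariski topology on products and symmetric products of projective spaces\<close>

text \<open>Variable \<open>(i, j)\<close> is the \<open>j\<close>-th homogeneous coordinate on the \<open>i\<close>-th factor, \<open>i < r\<close>.\<close>

definition multihomogeneous :: "nat \<Rightarrow> (nat \<times> 'n::finite) cpoly \<Rightarrow> bool" where
  "multihomogeneous r F \<longleftrightarrow>
     (\<exists>e :: nat \<Rightarrow> nat. \<forall>u\<in>Poly_Mapping.keys F.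
        fst ` Poly_Mapping.keys u \<subseteq> {..<r} \<and> (\<forall>i<r. (\<Sum>j\<in>UNIV. Poly_Mapping.lookup u (i, j)) = e i))"

definition vanishes_at :: "nat \<Rightarrow> (nat \<times> 'n::finite) cpoly \<Rightarrow> 'n proj_space list \<Rightarrow> bool" where
  "vanishes_at r F ps \<longleftrightarrow>
     (\<forall>v :: nat \<Rightarrow> complex ^ 'n. (\<forall>i<r. v i \<in> reps (ps ! i)) \<longrightarrow> cpoly_eval (\<lambda>(i, j). v i $ j) F = 0)"

definition zero_locus :: "nat \<Rightarrow> (nat \<times> 'n::finite) cpoly set \<Rightarrow> 'n proj_space list set" where
  "zero_locus r S = {ps. length ps = r \<and> (\<forall>F\<in>S. vanishes_at r F ps)}"

text \<open>Points of the \<open>r\<close>-fold product are lists of length \<open>r\<close>.\<close>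

definition zariski_prod :: "nat \<Rightarrow> 'n::finite proj_space list topology" where
  "zariski_prod r = topology (\<lambda>U. \<exists>S. (\<forall>F\<in>S. multihomogeneous r F) \<and>
     U = {ps. length ps = r} - zero_locus r S)"

text \<open>Points of the \<open>r\<close>-fold symmetric product are multisets of size \<open>r\<close>.  The symmetric product is
  the quotient of the \<open>r\<close>-fold product by a finite group, so its Zariski topology is the quotient
  topology.\<close>

definition zariski_sym :: "nat \<Rightarrow> 'n::finite proj_space multiset topology" where
  "zariski_sym r = topology (\<lambda>U. U \<subseteq> {M. size M = r} \<and>
     openin (zariski_prod r) {ps. length ps = r \<and> mset ps \<in> U})"

subsection \<open>These are topologies\<close>

lemma monom_eval_superset:
  assumes "finite K" "Poly_Mapping.keys u \<subseteq> K"
  shows "monom_eval x u = (\<Prod>i\<in>K. x i ^ Poly_Mapping.lookup u i)"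
  unfolding monom_eval_def
  by (rule prod.mono_neutral_left) (use assms in \<open>auto simp: in_keys_iff\<close>)

lemma monom_eval_add: "monom_eval x (u + w) = monom_eval x u * monom_eval x w"
proof -
  let ?K = "Poly_Mapping.keys u \<union> Poly_Mapping.keys w"
  have "monom_eval x z = (\<Prod>i\<in>?K. x i ^ Poly_Mapping.lookup z i)" if "z \<in> {u, w, u + w}" for z
    using that Poly_Mapping.keys_add[of u w] by (intro monom_eval_superset) auto
  then show ?thesis
    by (simp add: lookup_add power_add prod.distrib)
qed

lemma cpoly_eval_superset:
  assumes "finite K" "Poly_Mapping.keys F \<subseteq> K"
  shows "cpoly_eval x F = (\<Sum>u\<in>K. Poly_Mapping.lookup F u * monom_eval x u)"
  unfolding cpoly_eval_def
  by (rule sum.mono_neutral_left) (use assms in \<open>auto simp: in_keys_iff\<close>)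

lemma cpoly_eval_0 [simp]: "cpoly_eval x 0 = 0"
  by (simp add: cpoly_eval_def)

lemma cpoly_eval_single [simp]: "cpoly_eval x (Poly_Mapping.single u a) = a * monom_eval x u"
  by (simp add: cpoly_eval_def)

lemma cpoly_eval_add: "cpoly_eval x (F + G) = cpoly_eval x F + cpoly_eval x G"
proof -
  let ?K = "Poly_Mapping.keys F \<union> Poly_Mapping.keys G"
  have "cpoly_eval x H = (\<Sum>u\<in>?K. Poly_Mapping.lookup H u * monom_eval x u)" if "H \<in> {F, G, F + G}" for H
    using that Poly_Mapping.keys_add[of F G] by (intro cpoly_eval_superset) auto
  then show ?thesis
    by (simp add: lookup_add distrib_right sum.distrib)
qed

lemma cpoly_eval_sum: "cpoly_eval x (sum f I) = (\<Sum>i\<in>I. cpoly_eval x (f i))"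
  by (induction I rule: infinite_finite_induct) (simp_all add: cpoly_eval_add)

lemma cpoly_sum_monomials:
  "(\<Sum>u\<in>Poly_Mapping.keys F. Poly_Mapping.single u (Poly_Mapping.lookup F u)) = (F :: 'v cpoly)"
  by (rule poly_mapping_eqI)
    (auto simp: lookup_sum lookup_single when_def in_keys_iff sum.delta')

lemma cpoly_eval_mult: "cpoly_eval x (F * G) = cpoly_eval x F * cpoly_eval x G"
proof -
  let ?m = "\<lambda>H. \<lambda>u. Poly_Mapping.single u (Poly_Mapping.lookup H u)"
  have "cpoly_eval x (F * G) =
      cpoly_eval x ((\<Sum>u\<in>Poly_Mapping.keys F. ?m F u) * (\<Sum>u\<in>Poly_Mapping.keys G. ?m G u))"
    by (simp only: cpoly_sum_monomials)
  also have "\<dots> = cpoly_eval x F * cpoly_eval x G"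
    unfolding sum_product cpoly_eval_sum mult_single cpoly_eval_single monom_eval_add
    by (simp add: cpoly_eval_def sum_product mult_ac)
  finally show ?thesis .
qed

lemma reps_nonempty: "reps P \<noteq> {}"
proof
  assume "reps P = {}"
  then have "Rep_proj_space P \<subseteq> {0}"
    by (auto simp: reps_def)
  then have "vec.dim (Rep_proj_space P) = 0"
    by simp
  moreover have "vec.dim (Rep_proj_space P) = 1"
    using Rep_proj_space[of P] by blast
  ultimately show False
    by (metis zero_neq_one)
qed

lemma obtain_reps:
  obtains v where "\<And>i. v i \<in> reps (ps ! i)"
proof -
  have "\<forall>i. \<exists>w. w \<in> reps (ps ! i)"
    using reps_nonempty by blast
  then show thesis
    using that by metis
qed

lemma reps_scaling:
  assumes "v \<in> reps P" "w \<in> reps P"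
  obtains c where "w = c *s v"
proof -
  have "vec.independent {v}"
    using assms by (simp add: reps_def)
  moreover have "{v} \<subseteq> Rep_proj_space P" "vec.dim (Rep_proj_space P) \<le> card {v}"
    using assms Rep_proj_space[of P] by (auto simp: reps_def)
  ultimately have "Rep_proj_space P \<subseteq> vec.span {v}"
    using vec.card_ge_dim_independent by blast
  then show thesis
    using assms that by (auto simp: reps_def vec.span_singleton)
qed

lemma multihomogeneous_eval_scale:
  fixes F :: "(nat \<times> 'n::finite) cpoly" and v :: "nat \<Rightarrow> complex ^ 'n"
  assumes "multihomogeneous r F"
  obtains e :: "nat \<Rightarrow> nat" where
    "\<And>c v. cpoly_eval (\<lambda>(i, j). (c i *s v i) $ j) F =
       (\<Prod>i<r. c i ^ e i) * cpoly_eval (\<lambda>(i, j). (v i :: complex ^ 'n) $ j) F"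
proof -
  from assms obtain e where e: "\<And>u. u \<in> Poly_Mapping.keys F \<Longrightarrow> fst ` Poly_Mapping.keys u \<subseteq> {..<r}"
    "\<And>u i. u \<in> Poly_Mapping.keys F \<Longrightarrow> i < r \<Longrightarrow> (\<Sum>j\<in>UNIV. Poly_Mapping.lookup u (i, j)) = e i"
    unfolding multihomogeneous_def by blast
  have "cpoly_eval (\<lambda>(i, j). (c i *s v i) $ j) F =
      (\<Prod>i<r. c i ^ e i) * cpoly_eval (\<lambda>(i, j). v i $ j) F"
    for c and v :: "nat \<Rightarrow> complex ^ 'n"
  proof -
    have "monom_eval (\<lambda>(i, j). (c i *s v i) $ j) u = (\<Prod>i<r. c i ^ e i) * monom_eval (\<lambda>(i, j). v i $ j) u"
      if u: "u \<in> Poly_Mapping.keys F" for u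
    proof -
      let ?K = "{..<r} \<times> (UNIV :: 'n set)"
      have K: "finite ?K" "Poly_Mapping.keys u \<subseteq> ?K"
        using e(1)[OF u] by auto
      have "(\<Prod>p\<in>?K. c (fst p) ^ Poly_Mapping.lookup u p) =
          (\<Prod>i<r. \<Prod>j\<in>UNIV. c i ^ Poly_Mapping.lookup u (i, j))"
        by (simp add: prod.cartesian_product split_def)
      also have "\<dots> = (\<Prod>i<r. c i ^ e i)"
        by (simp add: e(2)[OF u] flip: power_sum)
      finally show ?thesis
        unfolding monom_eval_superset[OF K]
        by (simp add: split_def power_mult_distrib prod.distrib)
    qed
    then show ?thesis
      by (simp add: cpoly_eval_def sum_distrib_left mult_ac)
  qed
  then show thesis
    using that by blast
qed

lemma vanishes_at_iff:
  assumes F: "multihomogeneous r F" and v: "\<And>i. i < r \<Longrightarrow> v i \<in> reps (ps ! i)"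
  shows "vanishes_at r F ps \<longleftrightarrow> cpoly_eval (\<lambda>(i, j). v i $ j) F = 0"
proof
  assume 0: "cpoly_eval (\<lambda>(i, j). v i $ j) F = 0"
  show "vanishes_at r F ps"
    unfolding vanishes_at_def
  proof (intro allI impI)
    fix w assume w: "\<forall>i<r. w i \<in> reps (ps ! i)"
    then have "\<forall>i. \<exists>c. i < r \<longrightarrow> w i = c *s v i"
      using v reps_scaling by metis
    then obtain c where c: "\<And>i. i < r \<Longrightarrow> w i = c i *s v i"
      by metis
    obtain e :: "nat \<Rightarrow> nat" where e: "\<And>c v. cpoly_eval (\<lambda>(i, j). (c i *s v i) $ j) F =
       (\<Prod>i<r. c i ^ e i) * cpoly_eval (\<lambda>(i, j). v i $ j) F"
      using multihomogeneous_eval_scale[OF F] by blast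
    have keys: "fst p < r" if "u \<in> Poly_Mapping.keys F" "p \<in> Poly_Mapping.keys u" for u p
      using F that unfolding multihomogeneous_def by blast
    have "cpoly_eval (\<lambda>(i, j). w i $ j) F = cpoly_eval (\<lambda>(i, j). (c i *s v i) $ j) F"
      unfolding cpoly_eval_def monom_eval_def split_def
      by (intro sum.cong prod.cong arg_cong2[where f = "(*)"] refl) (simp add: keys c)
    then show "cpoly_eval (\<lambda>(i, j). w i $ j) F = 0"
      by (simp only: e 0 mult_zero_right)
  qed
qed (use v in \<open>auto simp: vanishes_at_def\<close>)

lemma multihomogeneous_mult:
  assumes "multihomogeneous r F" "multihomogeneous r G"
  shows "multihomogeneous r (F * G)"
proof -
  from assms obtain e f where
    e: "\<And>u. u \<in> Poly_Mapping.keys F \<Longrightarrow> fst ` Poly_Mapping.keys u \<subseteq> {..<r}"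
      "\<And>u i. u \<in> Poly_Mapping.keys F \<Longrightarrow> i < r \<Longrightarrow> (\<Sum>j\<in>UNIV. Poly_Mapping.lookup u (i, j)) = e i"
    and f: "\<And>u. u \<in> Poly_Mapping.keys G \<Longrightarrow> fst ` Poly_Mapping.keys u \<subseteq> {..<r}"
      "\<And>u i. u \<in> Poly_Mapping.keys G \<Longrightarrow> i < r \<Longrightarrow> (\<Sum>j\<in>UNIV. Poly_Mapping.lookup u (i, j)) = f i"
    unfolding multihomogeneous_def by metis
  show ?thesis
    unfolding multihomogeneous_def
  proof (intro exI[of _ "\<lambda>i. e i + f i"] ballI)
    fix u assume "u \<in> Poly_Mapping.keys (F * G)"
    then obtain a b where ab: "u = a + b" "a \<in> Poly_Mapping.keys F" "b \<in> Poly_Mapping.keys G"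
      using keys_mult[of F G] by blast
    then have "fst ` Poly_Mapping.keys u \<subseteq> {..<r}"
      using e(1) f(1) Poly_Mapping.keys_add[of a b] by blast
    then show "fst ` Poly_Mapping.keys u \<subseteq> {..<r} \<and>
        (\<forall>i<r. (\<Sum>j\<in>UNIV. Poly_Mapping.lookup u (i, j)) = e i + f i)"
      using ab e(2) f(2) by (simp add: lookup_add sum.distrib)
  qed
qed

lemma vanishes_at_mult:
  assumes "multihomogeneous r F" "multihomogeneous r G"
  shows "vanishes_at r (F * G) ps \<longleftrightarrow> vanishes_at r F ps \<or> vanishes_at r G ps"
proof -
  obtain v where "\<And>i. v i \<in> reps (ps ! i)"
    using obtain_reps by blast
  then show ?thesis
    by (simp add: vanishes_at_iff[of _ _ v] assms multihomogeneous_mult cpoly_eval_mult)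
qed

lemma istopology_zariski_prod:
  "istopology (\<lambda>U. \<exists>S. (\<forall>F\<in>S. multihomogeneous r F) \<and>
     U = {ps :: 'n::finite proj_space list. length ps = r} - zero_locus r S)"
  (is "istopology ?P")
  unfolding istopology_def
proof safe
  fix S S' :: "(nat \<times> 'n) cpoly set"
  assume S: "\<forall>F\<in>S. multihomogeneous r F" "\<forall>F\<in>S'. multihomogeneous r F"
  let ?Q = "(\<lambda>(F, G). F * G) ` (S \<times> S')"
  have "\<forall>F\<in>?Q. multihomogeneous r F"
    using S by (auto intro: multihomogeneous_mult)
  moreover have "vanishes_at r (F * G) ps \<longleftrightarrow> vanishes_at r F ps \<or> vanishes_at r G ps"
    if "F \<in> S" "G \<in> S'" for F G ps
    using S that by (intro vanishes_at_mult) auto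
  then have "zero_locus r ?Q = zero_locus r S \<union> zero_locus r S'"
    unfolding zero_locus_def by fastforce
  ultimately show "\<exists>Q. (\<forall>F\<in>Q. multihomogeneous r F) \<and>
      ({ps. length ps = r} - zero_locus r S) \<inter> ({ps. length ps = r} - zero_locus r S') =
      {ps. length ps = r} - zero_locus r Q"
    by blast
next
  fix \<K> assume "\<forall>K\<in>\<K>. ?P K"
  then obtain S where S: "\<And>K. K \<in> \<K> \<Longrightarrow> \<forall>F\<in>S K. multihomogeneous r F"
    "\<And>K. K \<in> \<K> \<Longrightarrow> K = {ps. length ps = r} - zero_locus r (S K)"
    by metis
  have "\<Union>\<K> = (\<Union>K\<in>\<K>. {ps. length ps = r} - zero_locus r (S K))"
    using S(2) by blast
  also have "\<dots> = {ps. length ps = r} - zero_locus r (\<Union>K\<in>\<K>. S K)"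
    by (auto simp: zero_locus_def)
  finally show "?P (\<Union>\<K>)"
    using S(1) by (intro exI[of _ "\<Union>K\<in>\<K>. S K"]) auto
qed

lemma openin_zariski_prod:
  "openin (zariski_prod r) U \<longleftrightarrow>
     (\<exists>S. (\<forall>F\<in>S. multihomogeneous r F) \<and> U = {ps. length ps = r} - zero_locus r S)"
  unfolding zariski_prod_def by (subst topology_inverse'[OF istopology_zariski_prod]) (rule refl)

lemma topspace_zariski_prod [simp]:
  "topspace (zariski_prod r) = {ps :: 'n::finite proj_space list. length ps = r}"
proof -
  have "openin (zariski_prod r) {ps :: 'n proj_space list. length ps = r}"
    unfolding openin_zariski_prod
  proof (intro exI[of _ "{1}"] conjI)
    have "\<not> vanishes_at r 1 ps" for ps :: "'n proj_space list"
    proof -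
      obtain v where "\<And>i. v i \<in> reps (ps ! i)"
        using obtain_reps by blast
      then show ?thesis
        unfolding vanishes_at_def by (auto simp: cpoly_eval_def monom_eval_def)
    qed
    then show "{ps :: 'n proj_space list. length ps = r} = {ps. length ps = r} - zero_locus r {1}"
      by (auto simp: zero_locus_def)
  qed (auto simp: multihomogeneous_def)
  then show ?thesis
    by (auto simp: topspace_def openin_zariski_prod)
qed

lemma closedin_zariski_prod:
  "closedin (zariski_prod r) C \<longleftrightarrow> (\<exists>S. (\<forall>F\<in>S. multihomogeneous r F) \<and> C = zero_locus r S)"
proof -
  have "zero_locus r S \<subseteq> {ps. length ps = r}" for S :: "(nat \<times> 'a) cpoly set"
    by (auto simp: zero_locus_def)
  then show ?thesis
    unfolding closedin_def openin_zariski_prod topspace_zariski_prod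
    by (metis double_diff order_refl Diff_Diff_Int inf.absorb_iff2 Diff_subset)
qed

lemma openin_zariski_sym:
  "openin (zariski_sym r) U \<longleftrightarrow>
     U \<subseteq> {M. size M = r} \<and> openin (zariski_prod r) {ps. length ps = r \<and> mset ps \<in> U}"
proof -
  have "istopology (\<lambda>U. U \<subseteq> {M :: 'a proj_space multiset. size M = r} \<and>
      openin (zariski_prod r) {ps. length ps = r \<and> mset ps \<in> U})"
    unfolding istopology_def
  proof (rule conjI; safe)
    fix S T :: "'a proj_space multiset set"
    assume "openin (zariski_prod r) {ps. length ps = r \<and> mset ps \<in> S}"
      "openin (zariski_prod r) {ps. length ps = r \<and> mset ps \<in> T}"
    then have "openin (zariski_prod r) ({ps. length ps = r \<and> mset ps \<in> S} \<inter> {ps. length ps = r \<and> mset ps \<in> T})"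
      by (rule openin_Int)
    also have "{ps. length ps = r \<and> mset ps \<in> S} \<inter> {ps. length ps = r \<and> mset ps \<in> T} =
        {ps. length ps = r \<and> mset ps \<in> S \<inter> T}"
      by auto
    finally show "openin (zariski_prod r) {ps. length ps = r \<and> mset ps \<in> S \<inter> T}" .
  next
    fix \<K> :: "'a proj_space multiset set set"
    assume "\<forall>K\<in>\<K>. K \<subseteq> {M. size M = r} \<and> openin (zariski_prod r) {ps. length ps = r \<and> mset ps \<in> K}"
    then have "openin (zariski_prod r) (\<Union>K\<in>\<K>. {ps. length ps = r \<and> mset ps \<in> K})"
      by blast
    also have "(\<Union>K\<in>\<K>. {ps. length ps = r \<and> mset ps \<in> K}) = {ps. length ps = r \<and> mset ps \<in> \<Union>\<K>}"
      by auto
    finally show "openin (zariski_prod r) {ps. length ps = r \<and> mset ps \<in> \<Union>\<K>}" .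
  qed auto
  then show ?thesis
    unfolding zariski_sym_def by (subst topology_inverse') (auto)
qed

lemma topspace_zariski_sym [simp]: "topspace (zariski_sym r) = {M. size M = r}"
proof -
  have "openin (zariski_sym r) {M :: 'a proj_space multiset. size M = r}"
    using openin_topspace[of "zariski_prod r"] by (simp add: openin_zariski_sym cong: conj_cong)
  then show ?thesis
    by (auto simp: topspace_def openin_zariski_sym)
qed

lemma quotient_map_mset: "quotient_map (zariski_prod r) (zariski_sym r) mset"
  unfolding quotient_map_def
proof (intro conjI allI impI)
  show "mset ` topspace (zariski_prod r) = topspace (zariski_sym r)"
    by (auto simp: image_iff) (metis ex_mset size_mset)
qed (auto simp: openin_zariski_sym)

section \<open>Positive dimensional families\<close>

definition irreducible_space :: "'a topology \<Rightarrow> bool" where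
  "irreducible_space X \<longleftrightarrow> topspace X \<noteq> {} \<and>
     (\<forall>C D. closedin X C \<and> closedin X D \<and> C \<union> D = topspace X \<longrightarrow> C = topspace X \<or> D = topspace X)"

definition locally_closedin :: "'a topology \<Rightarrow> 'a set \<Rightarrow> bool" where
  "locally_closedin X W \<longleftrightarrow> (\<exists>U C. openin X U \<and> closedin X C \<and> W = U \<inter> C)"

text \<open>Krull dimension: the supremum of the lengths of strict chains of irreducible closed subsets.\<close>

definition krull_dim :: "'a topology \<Rightarrow> enat" where
  "krull_dim X = Sup {enat k | k. \<exists>Z :: nat \<Rightarrow> 'a set.
     (\<forall>i\<le>k. closedin X (Z i) \<and> irreducible_space (subtopology X (Z i))) \<and> (\<forall>i<k. Z i \<subset> Z (Suc i))}"

text \<open>A reduced set \<open>B\<close> of \<open>r\<close> points is the point \<open>mset_set B\<close> of the symmetric product.\<close>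

definition positive_dim_family ::
    "nat \<Rightarrow> 'n::finite cpoly \<Rightarrow> nat \<Rightarrow> 'n proj_space set \<Rightarrow> 'n proj_space multiset set \<Rightarrow> bool" where
  "positive_dim_family d T r A W \<longleftrightarrow>
     locally_closedin (zariski_sym r) W \<and>
     irreducible_space (subtopology (zariski_sym r) W) \<and>
     krull_dim (subtopology (zariski_sym r) W) > 0 \<and>
     mset_set A \<in> W \<and>
     (\<forall>M\<in>W. \<exists>B. M = mset_set B \<and> decomposition d T B \<and> card B = r)"

end

theory Submission
  imports Defs "HOL-Library.Function_Algebras" "HOL-Complex_Analysis.Complex_Analysis"
    "Jordan_Normal_Form.Determinant"
begin

text \<open>Write \<open>d = 2 m\<close>, so that \<open>r \<le> 3 m - 1\<close>. Two different decompositions \<open>A\<close> and \<open>B\<close> of minimal length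
  give a linear relation between the evaluations of forms of degree \<open>d\<close> at a set \<open>S\<close> of at most
  \<open>3 d - 2\<close> points of \<open>A \<union> B\<close>, all of whose coefficients are nonzero, and \<open>S\<close> contains every point
  where \<open>A\<close> and \<open>B\<close> differ. Multiplying the relation by equations of lines and conics removes points
  from it, and an induction on \<open>d\<close> together with the Hilbert function of \<open>S\<close> shows that \<open>S\<close> lies on
  a line and has at least \<open>d + 2\<close> points, or lies on a conic and has at least \<open>2 d + 2\<close> points. Half of
  these belong to \<open>A\<close>, so \<open>m + 1\<close> points of \<open>A\<close> lie on a line or \<open>2 m + 1\<close> of them on a smooth conic.
  The corresponding part of \<open>T\<close> is a binary form of degree \<open>d\<close> or \<open>2 d\<close>, whose apolar forms of degree
  \<open>m + 1\<close> or \<open>2 m + 1\<close> contain a pencil through the one that vanishes on these points. The roots of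
  the nearby members of the pencil move holomorphically and replace these points of \<open>A\<close>; the Zariski
  closure of this arc of decompositions is irreducible by the identity theorem.\<close>

text \<open>The bound on \<open>r\<close> keeps \<open>S\<close> below 3 d points. The 3 d common
  points of a cubic and a curve of degree \<open>d\<close> carry, by residues, a full relation in
  degree \<open>d\<close> and need not lie on a conic, so the reduction to rational curves stops
  there. Below the bound both kinds of curves lead to one binary problem: M + 1 points and a
  functional in degree 2 M, with M = m on a line and M = 2 m on a smooth conic. Apolar forms of
  degree M + 1 obey M linear conditions on M + 2 coefficients, hence the pencil. On a conic that
  contains a line, one of two lines receives m + 1 of the 2 m + 1 points. A family is asked to be
  algebraic (locally closed, irreducible, of positive Krull dimension), whereas the roots of the
  pencil are followed one by one only as analytic functions. The Zariski closure mediates but may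
  pick up degenerate tuples. Minimality of \<open>r\<close> controls these: where the d-th powers
  stay independent, being dependent together with \<open>T\<close> is a closed condition, and a
  tuple with both properties has \<open>r\<close> distinct points because no shorter decomposition
  exists.\<close>

no_notation Matrix.vec_index (infixl "$" 100)
no_notation fps_nth (infixl "$" 75)

lemmas cart_eq_iff = Finite_Cartesian_Product.vec_eq_iff

section \<open>Linear algebra in spaces of complex-valued functions\<close>

definition fscale :: "complex \<Rightarrow> ('a \<Rightarrow> complex) \<Rightarrow> 'a \<Rightarrow> complex" where
  "fscale c f = (\<lambda>x. c * f x)"

interpretation fs: vector_space "fscale :: complex \<Rightarrow> ('a \<Rightarrow> complex) \<Rightarrow> 'a \<Rightarrow> complex"
  by unfold_locales (auto simp: fscale_def fun_eq_iff algebra_simps)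

lemma sum_fun_apply: "(\<Sum>i\<in>K. F i) x = (\<Sum>i\<in>K. F i x :: complex)"
  by (induction K rule: infinite_finite_induct) auto

text \<open>Gaussian elimination: a nonzero \<open>f i0 p\<close> serves as pivot for the equation
  at \<open>p\<close>, and \<open>e i0\<close> is solved back from the system with one unknown and
  one equation fewer.\<close>

lemma underdetermined_system:
  fixes f :: "'i \<Rightarrow> 'p \<Rightarrow> complex"
  assumes "finite T" "finite I" "card T < card I"
  shows "\<exists>c. (\<exists>i\<in>I. c i \<noteq> 0) \<and> (\<forall>p\<in>T. (\<Sum>i\<in>I. c i * f i p) = 0)"
  using assms
proof (induction T arbitrary: I f rule: finite_induct)
  case empty
  then obtain i where "i \<in> I" by fastforce
  then show ?case by (intro exI[of _ "\<lambda>_. 1"]) auto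
next
  case (insert p T)
  show ?case
  proof (cases "\<forall>i\<in>I. f i p = 0")
    case True
    then show ?thesis using insert.IH[of I f] insert.prems insert.hyps by auto
  next
    case False
    then obtain i0 where i0: "i0 \<in> I" "f i0 p \<noteq> 0" by blast
    define k where "k i = f i p / f i0 p" for i
    have "card T < card (I - {i0})" using insert.prems insert.hyps i0 by simp
    then obtain c where c: "\<exists>i\<in>I - {i0}. c i \<noteq> 0"
        "\<And>q. q \<in> T \<Longrightarrow> (\<Sum>i\<in>I - {i0}. c i * (f i q - k i * f i0 q)) = 0"
      using insert.IH[of "I - {i0}" "\<lambda>i q. f i q - k i * f i0 q"] insert.prems by auto
    define e where "e i = (if i = i0 then - (\<Sum>i\<in>I - {i0}. c i * k i) else c i)" for i
    have e: "(\<Sum>i\<in>I. e i * f i q) = (\<Sum>i\<in>I - {i0}. c i * (f i q - k i * f i0 q))" for q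
    proof -
      have "(\<Sum>i\<in>I. e i * f i q) = e i0 * f i0 q + (\<Sum>i\<in>I - {i0}. e i * f i q)"
        using i0 insert.prems by (simp add: sum.remove)
      also have "(\<Sum>i\<in>I - {i0}. e i * f i q) = (\<Sum>i\<in>I - {i0}. c i * f i q)"
        by (rule sum.cong) (auto simp: e_def)
      also have "e i0 * f i0 q = - (\<Sum>i\<in>I - {i0}. c i * k i * f i0 q)"
        by (simp add: e_def sum_distrib_right)
      finally show ?thesis by (simp add: algebra_simps sum_subtractf)
    qed
    have "(\<Sum>i\<in>I. e i * f i p) = 0"
      unfolding e using i0 by (simp add: k_def)
    moreover have "\<exists>i\<in>I. e i \<noteq> 0" using c(1) by (auto simp: e_def)
    ultimately show ?thesis using c(2) e by (intro exI[of _ e]) auto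
  qed
qed

lemma span_mult_closed:
  assumes "f \<in> fs.span X" "\<And>x. x \<in> X \<Longrightarrow> (\<lambda>p. g p * x p) \<in> fs.span Y"
  shows "(\<lambda>p. g p * f p) \<in> fs.span Y"
  using assms(1)
proof (induction rule: fs.span_induct_alt)
  case base
  have "(\<lambda>p. g p * (0 :: 'a \<Rightarrow> complex) p) = 0" by auto
  then show ?case using fs.span_zero by metis
next
  case (step c x y)
  have "(\<lambda>p. g p * (fscale c x + y) p) = fscale c (\<lambda>p. g p * x p) + (\<lambda>p. g p * y p)"
    by (auto simp: fscale_def algebra_simps)
  then show ?case using step assms(2) by (auto intro: fs.span_add fs.span_scale)
qed

lemma span_vanish:
  assumes "f \<in> fs.span X" "\<And>x. x \<in> X \<Longrightarrow> x p = 0"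
  shows "f p = 0"
  using assms(1) by (induction rule: fs.span_induct_alt) (auto simp: fscale_def assms(2))

lemma span_weighted_sum_zero:
  assumes "f \<in> fs.span X" "\<And>x. x \<in> X \<Longrightarrow> (\<Sum>p\<in>S. c p * x p) = 0"
  shows "(\<Sum>p\<in>S. c p * f p) = 0"
  using assms(1)
proof (induction rule: fs.span_induct_alt)
  case (step k x y)
  have "(\<Sum>p\<in>S. c p * (fscale k x + y) p) = k * (\<Sum>p\<in>S. c p * x p) + (\<Sum>p\<in>S. c p * y p)"
    by (simp add: fscale_def algebra_simps sum.distrib sum_distrib_left)
  then show ?case using step assms(2) by simp
qed auto

lemma fs_dim_insert:
  assumes "finite X"
  shows "fs.dim (insert x X) = (if x \<in> fs.span X then fs.dim X else Suc (fs.dim X))"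
proof -
  obtain B where B: "B \<subseteq> X" "fs.independent B" "X \<subseteq> fs.span B" "card B = fs.dim X"
    using fs.basis_exists by metis
  have sp: "fs.span B = fs.span X"
    using B by (metis fs.span_mono fs.span_span subset_antisym)
  have fin: "finite B" using B assms finite_subset by blast
  show ?thesis
  proof (cases "x \<in> fs.span X")
    case True
    then show ?thesis
      using fs.span_redundant by (metis fs.dim_span)
  next
    case False
    then have "fs.independent (insert x B)" using B sp by (simp add: fs.independent_insertI)
    moreover have "fs.span (insert x B) = fs.span (insert x X)"
      using sp by (simp add: fs.span_insert)
    ultimately have "fs.dim (insert x X) = card (insert x B)"
      by (metis fs.dim_span_eq_card_independent fs.dim_span)
    moreover have "x \<notin> B" using False sp fs.span_base by blast
    ultimately show ?thesis using False B fin by simp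
  qed
qed

text \<open>When vectors are added one at a time, the dimension rises exactly at those outside the
  span of their predecessors. This turns the growth of a Hilbert function into a count of standard
  monomials.\<close>

lemma fs_dim_chain:
  assumes "finite X"
  shows "fs.dim (X \<union> f ` {..<n::nat}) =
    fs.dim X + card {i. i < n \<and> f i \<notin> fs.span (X \<union> f ` {..<i})}"
proof (induction n)
  case (Suc n)
  let ?N = "\<lambda>n. {i. i < n \<and> f i \<notin> fs.span (X \<union> f ` {..<i})}"
  have "X \<union> f ` {..<Suc n} = insert (f n) (X \<union> f ` {..<n})" by (auto simp: lessThan_Suc)
  moreover have "?N (Suc n) = (if f n \<in> fs.span (X \<union> f ` {..<n}) then ?N n else insert n (?N n))"
    by (auto simp: less_Suc_eq)
  ultimately show ?case using Suc assms by (simp add: fs_dim_insert)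
qed simp

text \<open>The separating functions form a diagonal matrix with nonzero diagonal at the points of
  \<open>U\<close>, so they are independent.\<close>

lemma card_le_dim_of_deltas:
  assumes "finite X" "finite U"
    "\<And>P. P \<in> U \<Longrightarrow> \<exists>f\<in>fs.span X. f P \<noteq> 0 \<and> (\<forall>Q\<in>U - {P}. f Q = 0)"
  shows "card U \<le> fs.dim X"
proof -
  obtain B where B: "B \<subseteq> X" "fs.independent B" "X \<subseteq> fs.span B" "card B = fs.dim X"
    using fs.basis_exists by metis
  then have finB: "finite B" using assms finite_subset by blast
  have sp: "fs.span B = fs.span X"
    using B by (metis fs.span_mono fs.span_span subset_antisym)
  obtain e where e: "\<And>P. P \<in> U \<Longrightarrow> e P \<in> fs.span X" "\<And>P. P \<in> U \<Longrightarrow> e P P \<noteq> 0"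
    "\<And>P Q. P \<in> U \<Longrightarrow> Q \<in> U \<Longrightarrow> Q \<noteq> P \<Longrightarrow> e P Q = 0"
    using assms(3) by (metis DiffI singletonD)
  have inj: "inj_on e U"
    by (rule inj_onI) (metis e(2,3))
  have "fs.independent (e ` U)"
    unfolding fs.dependent_def
  proof safe
    fix P assume P: "P \<in> U" "e P \<in> fs.span (e ` U - {e P})"
    have "e P P = 0" by (rule span_vanish[OF P(2)]) (use e(3) P in auto)
    then show False using e P by blast
  qed
  then have "card (e ` U) \<le> card B"
    using fs.independent_span_bound[OF finB] e(1) sp by blast
  then show ?thesis using inj B by (simp add: card_image)
qed

text \<open>Interpolation nodes are added one per basis vector. Both the duality argument for
  Hilbert functions and the choice of a nonzero minor rest on this.\<close>

lemma exists_interpolation_set: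
  assumes "finite B" "fs.independent B" "finite S"
    "\<And>f. f \<in> fs.span B \<Longrightarrow> (\<And>p. p \<in> S \<Longrightarrow> f p = 0) \<Longrightarrow> f = 0"
  shows "\<exists>U\<subseteq>S. card U = card B \<and>
    (\<forall>P\<in>U. \<exists>f\<in>fs.span B. f P = 1 \<and> (\<forall>Q\<in>U - {P}. f Q = 0))"
  using assms
proof (induction B rule: finite_induct)
  case (insert b B)
  have ind: "fs.independent B" "b \<notin> fs.span B"
    using insert.prems insert.hyps by (auto simp: fs.independent_insert)
  have sub: "fs.span B \<subseteq> fs.span (insert b B)" by (intro fs.span_mono) auto
  obtain U where U: "U \<subseteq> S" "card U = card B"
    "\<forall>P\<in>U. \<exists>f\<in>fs.span B. f P = 1 \<and> (\<forall>Q\<in>U - {P}. f Q = 0)"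
    using insert.IH ind insert.prems sub by blast
  then obtain e where e: "\<And>P. P \<in> U \<Longrightarrow> e P \<in> fs.span B" "\<And>P. P \<in> U \<Longrightarrow> e P P = 1"
    "\<And>P Q. P \<in> U \<Longrightarrow> Q \<in> U \<Longrightarrow> Q \<noteq> P \<Longrightarrow> e P Q = 0"
    by (metis DiffI singletonD)
  have finU: "finite U" using U insert.prems finite_subset by blast
  define s where "s = (\<Sum>P\<in>U. fscale (b P) (e P))"
  have s: "s \<in> fs.span B" unfolding s_def by (intro fs.span_sum fs.span_scale e)
  \<comment> \<open>\<open>s\<close> interpolates \<open>b\<close> on \<open>U\<close>, so
    \<open>g\<close> vanishes on \<open>U\<close>; being nonzero, it has a nonzero value at some
    point \<open>P\<close> of \<open>S\<close>, which becomes the new node.\<close>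
  define g where "g = b - s"
  have g_in: "g \<in> fs.span (insert b B)"
    unfolding g_def using s sub fs.span_base[of b "insert b B"] by (auto intro: fs.span_diff)
  have "g \<noteq> 0" using s ind by (auto simp: g_def)
  then obtain P where P: "P \<in> S" "g P \<noteq> 0"
    using insert.prems g_in by blast
  have gU: "g Q = 0" if "Q \<in> U" for Q
  proof -
    have "s Q = (\<Sum>P\<in>U. if P = Q then b P else 0)"
      unfolding s_def sum_fun_apply using e that by (intro sum.cong) (auto simp: fscale_def)
    also have "\<dots> = b Q" using that finU by simp
    finally show ?thesis by (simp add: g_def)
  qed
  then have PU: "P \<notin> U" using P by blast
  have "\<exists>f\<in>fs.span (insert b B). f R = 1 \<and> (\<forall>Q\<in>insert P U - {R}. f Q = 0)" if R: "R \<in> insert P U" for R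
  proof (cases "R = P")
    case True
    have "fscale (inverse (g P)) g \<in> fs.span (insert b B)" by (intro fs.span_scale g_in)
    then show ?thesis using True P gU by (intro bexI) (auto simp: fscale_def)
  next
    case False
    then have RU: "R \<in> U" using R by blast
    let ?f = "e R - fscale (e R P / g P) g"
    have "?f \<in> fs.span (insert b B)"
      using e(1)[OF RU] sub by (intro fs.span_diff fs.span_scale g_in) auto
    moreover have "?f R = 1" using gU[OF RU] e(2)[OF RU] by (simp add: fscale_def)
    moreover have "?f Q = 0" if "Q \<in> insert P U - {R}" for Q
      using that gU[of Q] e(3)[OF RU, of Q] P by (auto simp: fscale_def)
    ultimately show ?thesis by blast
  qed
  then show ?case using U P PU finU insert.hyps
    by (intro exI[of _ "insert P U"]) auto
qed (auto)

section \<open>Linear relations among points of the affine plane\<close>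

text \<open>Extension by 0 puts the functions on all sets \<open>S\<close> into one vector space;
  \<open>S = UNIV\<close> gives the polynomial functions.\<close>

definition mon_on :: "(complex \<times> complex) set \<Rightarrow> nat \<Rightarrow> nat \<Rightarrow> complex \<times> complex \<Rightarrow> complex" where
  "mon_on S a b = (\<lambda>p. if p \<in> S then fst p ^ a * snd p ^ b else 0)"

definition mons :: "(complex \<times> complex) set \<Rightarrow> nat \<Rightarrow> (complex \<times> complex \<Rightarrow> complex) set" where
  "mons S d = (\<lambda>(a, b). mon_on S a b) ` {(a, b). a + b \<le> d}"

abbreviation Pol :: "nat \<Rightarrow> (complex \<times> complex \<Rightarrow> complex) set" where
  "Pol d \<equiv> fs.span (mons UNIV d)"

lemma finite_mons: "finite (mons S d)"
proof -
  have "{(a, b). a + b \<le> d} \<subseteq> {..d} \<times> {..d}" by auto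
  then show ?thesis unfolding mons_def by (meson finite_SigmaI finite_atMost finite_imageI finite_subset)
qed

lemma mons_mono: "d \<le> e \<Longrightarrow> mons S d \<subseteq> mons S e"
  unfolding mons_def by (intro image_mono) auto

lemma span_mons_mult:
  assumes "f \<in> fs.span (mons S d)" "g \<in> fs.span (mons S e)"
  shows "(\<lambda>p. f p * g p) \<in> fs.span (mons S (d + e))"
proof (rule span_mult_closed[OF assms(2)])
  fix x assume "x \<in> mons S e"
  then obtain a b where x: "x = mon_on S a b" "a + b \<le> e" by (auto simp: mons_def)
  have "(\<lambda>p. x p * f p) \<in> fs.span (mons S (d + e))"
  proof (rule span_mult_closed[OF assms(1)])
    fix y assume "y \<in> mons S d"
    then obtain a' b' where y: "y = mon_on S a' b'" "a' + b' \<le> d" by (auto simp: mons_def)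
    have "(\<lambda>p. x p * y p) = mon_on S (a + a') (b + b')"
      by (auto simp: x y mon_on_def power_add)
    then show "(\<lambda>p. x p * y p) \<in> fs.span (mons S (d + e))"
      using x y by (auto simp: mons_def intro!: fs.span_base)
  qed
  then show "(\<lambda>p. f p * x p) \<in> fs.span (mons S (d + e))" by (simp add: mult.commute)
qed

text \<open>A zero set of \<open>lin l\<close> with \<open>l \<noteq> 0\<close> may be the line at infinity, hence empty.\<close>

definition lin :: "complex \<times> complex \<times> complex \<Rightarrow> complex \<times> complex \<Rightarrow> complex" where
  "lin = (\<lambda>(a, b, c) (x, y). a * x + b * y + c)"

definition quad :: "(nat \<Rightarrow> complex) \<Rightarrow> complex \<times> complex \<Rightarrow> complex" where
  "quad k = (\<lambda>(x, y). k 0 * x\<^sup>2 + k 1 * (x * y) + k 2 * y\<^sup>2 + k 3 * x + k 4 * y + k 5)"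

definition quad_nz :: "(nat \<Rightarrow> complex) \<Rightarrow> bool" where
  "quad_nz k \<longleftrightarrow> (\<exists>i<6. k i \<noteq> 0)"

lemma const_Pol: "(\<lambda>_. c) \<in> Pol d"
proof -
  have "mon_on UNIV 0 0 \<in> Pol d" by (rule fs.span_base) (auto simp: mons_def)
  then have "fscale c (mon_on UNIV 0 0) \<in> Pol d" by (rule fs.span_scale)
  then show ?thesis by (simp add: fscale_def mon_on_def)
qed

lemma lin_Pol: "lin l \<in> Pol 1"
proof -
  obtain a b c where l: "l = (a, b, c)" by (cases l)
  have "fscale a (mon_on UNIV 1 0) + fscale b (mon_on UNIV 0 1) + fscale c (mon_on UNIV 0 0) \<in> Pol 1"
    by (intro fs.span_add fs.span_scale fs.span_base) (auto simp: mons_def)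
  also have "fscale a (mon_on UNIV 1 0) + fscale b (mon_on UNIV 0 1) + fscale c (mon_on UNIV 0 0) = lin l"
    by (auto simp: l lin_def fscale_def mon_on_def)
  finally show ?thesis .
qed

lemma quad_Pol: "quad k \<in> Pol 2"
proof -
  let ?q = "fscale (k 0) (mon_on UNIV 2 0) + fscale (k 1) (mon_on UNIV 1 1) + fscale (k 2) (mon_on UNIV 0 2)
    + fscale (k 3) (mon_on UNIV 1 0) + fscale (k 4) (mon_on UNIV 0 1) + fscale (k 5) (mon_on UNIV 0 0)"
  have "?q \<in> Pol 2"
    by (intro fs.span_add fs.span_scale fs.span_base) (auto simp: mons_def)
  also have "?q = quad k"
    by (auto simp: quad_def fscale_def mon_on_def)
  finally show ?thesis .
qed

lemma lin_mult_lin: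
  assumes "l \<noteq> 0" "l' \<noteq> 0"
  obtains k where "quad_nz k" "\<And>p. quad k p = lin l p * lin l' p"
proof -
  obtain a b c where l: "l = (a, b, c)" by (cases l)
  obtain a' b' c' where l': "l' = (a', b', c')" by (cases l')
  define k :: "nat \<Rightarrow> complex" where "k = (\<lambda>i. [a * a', a * b' + b * a', b * b', a * c' + c * a', b * c' + c * b', c * c'] ! i)"
  have "quad k p = lin l p * lin l' p" for p
    by (cases p) (simp add: quad_def k_def lin_def l l' algebra_simps power2_eq_square)
  moreover have "quad_nz k"
  proof (rule ccontr)
    assume "\<not> quad_nz k"
    then have "k 0 = 0" "k 1 = 0" "k 2 = 0" "k 3 = 0" "k 4 = 0" "k 5 = 0" by (auto simp: quad_nz_def)
    then have "a * a' = 0" "a * b' + b * a' = 0" "b * b' = 0" "a * c' + c * a' = 0" "b * c' + c * b' = 0" "c * c' = 0"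
      by (auto simp: k_def)
    then show False using assms by (auto simp: l l' zero_prod_def)
  qed
  ultimately show thesis using that by blast
qed

lemma conic_through:
  assumes "finite T" "card T \<le> 5"
  obtains k where "quad_nz k" "\<And>p. p \<in> T \<Longrightarrow> quad k p = 0"
proof -
  define f :: "nat \<Rightarrow> complex \<times> complex \<Rightarrow> complex" where
    "f i = (\<lambda>(x, y). [x\<^sup>2, x * y, y\<^sup>2, x, y, 1] ! i)" for i
  obtain c where c: "\<exists>i\<in>{..<6}. c i \<noteq> 0" "\<forall>p\<in>T. (\<Sum>i\<in>{..<6}. c i * f i p) = 0"
    using underdetermined_system[of T "{..<6::nat}" f] assms by auto
  have "(\<Sum>i\<in>{..<6::nat}. g i) = g 0 + g 1 + g 2 + g 3 + g 4 + g 5" for g :: "nat \<Rightarrow> complex"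
    by (simp add: eval_nat_numeral)
  then have "(\<Sum>i\<in>{..<6}. c i * f i p) = quad c p" for p
    by (cases p) (simp add: f_def quad_def)
  then show thesis using that[of c] c by (auto simp: quad_nz_def)
qed

lemma line_through:
  assumes "P \<noteq> Q"
  obtains l where "l \<noteq> 0" "lin l P = 0" "lin l Q = 0"
proof -
  obtain x y where P: "P = (x, y)" by (cases P)
  obtain x' y' where Q: "Q = (x', y')" by (cases Q)
  show thesis
    by (rule that[of "(y - y', x' - x, x * y' - x' * y)"])
      (use assms in \<open>auto simp: P Q lin_def zero_prod_def algebra_simps\<close>)
qed

lemma line_separating:
  assumes "P \<noteq> Q"
  obtains l where "lin l P = 0" "lin l Q \<noteq> 0"
proof -
  obtain x y where P: "P = (x, y)" by (cases P)
  obtain x' y' where Q: "Q = (x', y')" by (cases Q)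
  show thesis
  proof (cases "x = x'")
    case True
    then show thesis using assms by (intro that[of "(0, 1, - y)"]) (auto simp: P Q lin_def)
  next
    case False
    then show thesis by (intro that[of "(1, 0, - x)"]) (auto simp: P Q lin_def)
  qed
qed

section \<open>Full relations, their residuals, and lower bounds for their support\<close>

definition full_relation :: "nat \<Rightarrow> (complex \<times> complex) set \<Rightarrow> (complex \<times> complex \<Rightarrow> complex) \<Rightarrow> bool" where
  "full_relation d S c \<longleftrightarrow> finite S \<and> (\<forall>p\<in>S. c p \<noteq> 0) \<and> (\<forall>f\<in>Pol d. (\<Sum>p\<in>S. c p * f p) = 0)"

text \<open>If \<open>c\<close> annihilates degree \<open>d\<close>, then \<open>c f\<close>
  annihilates degree \<open>d - e\<close>. Exactly the points on the curve \<open>f = 0\<close> drop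
  out: since all coefficients of a full relation are nonzero, the support of the residual relation
  is known.\<close>

lemma full_relation_residual:
  assumes "full_relation d S c" "f \<in> Pol e" "e \<le> d"
  shows "full_relation (d - e) {p \<in> S. f p \<noteq> 0} (\<lambda>p. c p * f p)"
proof -
  have fin: "finite S" using assms by (simp add: full_relation_def)
  have "(\<Sum>p\<in>{p \<in> S. f p \<noteq> 0}. c p * f p * g p) = 0" if "g \<in> Pol (d - e)" for g
  proof -
    have "(\<lambda>p. f p * g p) \<in> Pol d" using span_mons_mult[OF assms(2) that] assms(3) by simp
    then have "(\<Sum>p\<in>S. c p * (f p * g p)) = 0" using assms(1) by (simp add: full_relation_def)
    moreover have "(\<Sum>p\<in>S. c p * (f p * g p)) = (\<Sum>p\<in>{p \<in> S. f p \<noteq> 0}. c p * f p * g p)"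
      using fin by (intro sum.mono_neutral_cong_right) auto
    ultimately show ?thesis by simp
  qed
  then show ?thesis using assms by (auto simp: full_relation_def)
qed

lemma card_residual:
  assumes "finite S"
  shows "card {p \<in> S. f p \<noteq> (0::complex)} + card {p \<in> S. f p = 0} = card S"
proof -
  have "S = {p \<in> S. f p \<noteq> 0} \<union> {p \<in> S. f p = 0}" by auto
  then have "card S = card ({p \<in> S. f p \<noteq> 0} \<union> {p \<in> S. f p = 0})" by simp
  also have "\<dots> = card {p \<in> S. f p \<noteq> 0} + card {p \<in> S. f p = 0}"
    using assms by (intro card_Un_disjoint) auto
  finally show ?thesis by simp
qed

lemma full_relation_card_ge2:
  assumes "full_relation d S c" "S \<noteq> {}"
  shows "card S \<ge> 2"
proof (rule ccontr)
  assume "\<not> card S \<ge> 2"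
  moreover have "finite S" using assms by (simp add: full_relation_def)
  ultimately have "card S = 1" using assms(2) by (metis One_nat_def Suc_1 Suc_leI card_gt_0_iff le_antisym not_less_eq_eq)
  then obtain P where "S = {P}" by (auto simp: card_1_singleton_iff)
  then show False using assms const_Pol[of 1 d] by (fastforce simp: full_relation_def)
qed

text \<open>A line through one point that misses another takes off at least one point and leaves
  some, at the cost of one degree. Collinear points attain the bound.\<close>

lemma card_ge_of_relation:
  assumes "full_relation d S c" "S \<noteq> {}"
  shows "card S \<ge> d + 2"
  using assms
proof (induction d arbitrary: S c)
  case 0
  then show ?case using full_relation_card_ge2 by fastforce
next
  case (Suc d)
  have fin: "finite S" using Suc.prems by (simp add: full_relation_def)
  obtain P Q where PQ: "P \<in> S" "Q \<in> S" "P \<noteq> Q"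
    using full_relation_card_ge2[OF Suc.prems] card_le_Suc0_iff_eq[OF fin] by force
  obtain l where l: "lin l P = 0" "lin l Q \<noteq> 0" using line_separating PQ by metis
  let ?S = "{p \<in> S. lin l p \<noteq> 0}"
  have rel: "full_relation d ?S (\<lambda>p. c p * lin l p)"
    using full_relation_residual[OF Suc.prems(1) lin_Pol] by simp
  have "?S \<noteq> {}" using PQ l by blast
  then have "card ?S \<ge> d + 2" using Suc.IH[OF rel] by simp
  moreover have "P \<in> {p \<in> S. lin l p = 0}" "finite {p \<in> S. lin l p = 0}" using PQ l fin by auto
  then have "card {p \<in> S. lin l p = 0} > 0" by (metis card_gt_0_iff empty_iff)
  ultimately show ?case using card_residual[OF fin, of "lin l"] by simp
qed

definition no_three_collinear :: "(complex \<times> complex) set \<Rightarrow> bool" where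
  "no_three_collinear S \<longleftrightarrow> (\<forall>l. l \<noteq> 0 \<longrightarrow> card {p \<in> S. lin l p = 0} \<le> 2)"

definition no_six_conconic :: "(complex \<times> complex) set \<Rightarrow> bool" where
  "no_six_conconic S \<longleftrightarrow> (\<forall>k. quad_nz k \<longrightarrow> card {p \<in> S. quad k p = 0} \<le> 5)"

lemma no_three_collinear_subset:
  assumes "no_three_collinear S" "S' \<subseteq> S" "finite S"
  shows "no_three_collinear S'"
  unfolding no_three_collinear_def
proof (intro allI impI)
  fix l :: "complex \<times> complex \<times> complex" assume "l \<noteq> 0"
  moreover have "card {p \<in> S'. lin l p = 0} \<le> card {p \<in> S. lin l p = 0}"
    using assms by (intro card_mono) auto
  ultimately show "card {p \<in> S'. lin l p = 0} \<le> 2"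
    using assms(1) unfolding no_three_collinear_def by (meson order_trans)
qed

lemma no_six_conconic_subset:
  assumes "no_six_conconic S" "S' \<subseteq> S" "finite S"
  shows "no_six_conconic S'"
  unfolding no_six_conconic_def
proof (intro allI impI)
  fix k assume "quad_nz k"
  moreover have "card {p \<in> S'. quad k p = 0} \<le> card {p \<in> S. quad k p = 0}"
    using assms by (intro card_mono) auto
  ultimately show "card {p \<in> S'. quad k p = 0} \<le> 5"
    using assms(1) unfolding no_six_conconic_def by (meson order_trans)
qed

lemma line_through_avoiding:
  assumes "no_three_collinear S" "finite S" "P \<in> S" "Q \<in> S" "R \<in> S" "P \<noteq> Q" "R \<noteq> P" "R \<noteq> Q"
  obtains l where "l \<noteq> 0" "lin l P = 0" "lin l Q = 0" "lin l R \<noteq> 0"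
proof -
  obtain l where l: "l \<noteq> 0" "lin l P = 0" "lin l Q = 0" using line_through assms by metis
  have "lin l R \<noteq> 0"
  proof
    assume "lin l R = 0"
    then have "card {P, Q, R} \<le> card {p \<in> S. lin l p = 0}" using assms l by (intro card_mono) auto
    moreover have "card {P, Q, R} = 3" using assms by auto
    moreover have "card {p \<in> S. lin l p = 0} \<le> 2" using assms(1) l unfolding no_three_collinear_def by blast
    ultimately show False by simp
  qed
  then show thesis using that l by blast
qed

lemma conic_through_avoiding:
  assumes "no_six_conconic S" "finite S" "T \<subseteq> S" "card T = 5" "R \<in> S" "R \<notin> T"
  obtains k where "quad_nz k" "\<And>p. p \<in> T \<Longrightarrow> quad k p = 0" "quad k R \<noteq> 0"
proof -
  have finT: "finite T" using assms finite_subset by blast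
  obtain k where k: "quad_nz k" "\<And>p. p \<in> T \<Longrightarrow> quad k p = 0" using conic_through[OF finT] assms by auto
  have "quad k R \<noteq> 0"
  proof
    assume "quad k R = 0"
    then have "card (insert R T) \<le> card {p \<in> S. quad k p = 0}" using assms k by (intro card_mono) auto
    moreover have "card (insert R T) = 6" using assms finT by simp
    moreover have "card {p \<in> S. quad k p = 0} \<le> 5" using assms(1) k by (simp add: no_six_conconic_def)
    ultimately show False by simp
  qed
  then show thesis using that k by blast
qed

text \<open>Each degree now pays for a line through two points; a third point survives because no
  line holds three. Points of a smooth conic attain the bound.\<close>

lemma card_ge_of_relation_no_three_collinear:
  assumes "full_relation d S c" "S \<noteq> {}" "no_three_collinear S"
  shows "card S \<ge> 2 * d + 2"
  using assms
proof (induction d arbitrary: S c)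
  case 0
  then show ?case using full_relation_card_ge2 by fastforce
next
  case (Suc d)
  have fin: "finite S" using Suc.prems by (simp add: full_relation_def)
  have "card S \<ge> 3" using card_ge_of_relation[OF Suc.prems(1,2)] by simp
  then obtain U where "U \<subseteq> S" "card U = 3" by (meson obtain_subset_with_card_n)
  then obtain P Q R where PQ: "P \<in> S" "Q \<in> S" "R \<in> S" "P \<noteq> Q" "R \<noteq> P" "R \<noteq> Q"
    by (auto simp: card_3_iff)
  obtain l where l: "l \<noteq> 0" "lin l P = 0" "lin l Q = 0" "lin l R \<noteq> 0"
    using line_through_avoiding[OF Suc.prems(3) fin PQ] by metis
  let ?S = "{p \<in> S. lin l p \<noteq> 0}"
  have "no_three_collinear ?S" by (rule no_three_collinear_subset[OF Suc.prems(3) _ fin]) auto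
  moreover have rel: "full_relation d ?S (\<lambda>p. c p * lin l p)"
    using full_relation_residual[OF Suc.prems(1) lin_Pol] by simp
  moreover have "?S \<noteq> {}" using PQ l by blast
  ultimately have "card ?S \<ge> 2 * d + 2" using Suc.IH by blast
  moreover have "card {P, Q} \<le> card {p \<in> S. lin l p = 0}" using PQ l fin by (intro card_mono) auto
  ultimately show ?case using card_residual[OF fin, of "lin l"] PQ by simp
qed

lemma curve_with_most_points:
  fixes F :: "'k \<Rightarrow> 'p \<Rightarrow> complex"
  assumes "finite S" "Q k0" "n \<le> card {p \<in> S. F k0 p = 0}"
  obtains k where "Q k" "n \<le> card {p \<in> S. F k p = 0}"
    "\<And>k'. Q k' \<Longrightarrow> card {p \<in> S. F k' p = 0} \<le> card {p \<in> S. F k p = 0}"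
proof -
  have "\<forall>k. Q k \<longrightarrow> card {p \<in> S. F k p = 0} < Suc (card S)"
    using assms(1) by (auto simp: less_Suc_eq_le intro: card_mono)
  then obtain k where k: "Q k" "\<And>k'. Q k' \<Longrightarrow> card {p \<in> S. F k' p = 0} \<le> card {p \<in> S. F k p = 0}"
    using ex_has_greatest_nat[of Q k0 "\<lambda>k. card {p \<in> S. F k p = 0}" "Suc (card S)"] assms(2) by auto
  have "n \<le> card {p \<in> S. F k p = 0}" using k(2)[OF assms(2)] assms(3) by linarith
  then show thesis by (rule that[OF k(1) _ k(2)])
qed

lemma line_with_most_points:
  assumes "finite S" "\<not> no_three_collinear S"
  obtains l where "l \<noteq> 0" "card {p \<in> S. lin l p = 0} \<ge> 3"
    "\<And>l'. l' \<noteq> 0 \<Longrightarrow> card {p \<in> S. lin l' p = 0} \<le> card {p \<in> S. lin l p = 0}"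
proof -
  obtain l0 where l0: "l0 \<noteq> 0" "\<not> card {p \<in> S. lin l0 p = 0} \<le> 2"
    using assms(2) unfolding no_three_collinear_def by blast
  then have "3 \<le> card {p \<in> S. lin l0 p = 0}" by linarith
  then show thesis
    by (rule curve_with_most_points[where Q = "\<lambda>l. l \<noteq> 0" and F = lin, OF assms(1) l0(1)])
      (rule that; assumption)
qed

lemma conic_with_most_points:
  assumes "finite S" "\<not> no_six_conconic S"
  obtains k where "quad_nz k" "card {p \<in> S. quad k p = 0} \<ge> 6"
    "\<And>k'. quad_nz k' \<Longrightarrow> card {p \<in> S. quad k' p = 0} \<le> card {p \<in> S. quad k p = 0}"
proof -
  obtain k0 where k0: "quad_nz k0" "\<not> card {p \<in> S. quad k0 p = 0} \<le> 5"
    using assms(2) unfolding no_six_conconic_def by blast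
  then have "6 \<le> card {p \<in> S. quad k0 p = 0}" by linarith
  then show thesis
    by (rule curve_with_most_points[where Q = quad_nz and F = quad, OF assms(1) k0(1)])
      (rule that; assumption)
qed

text \<open>A line with the most points of \<open>S\<close> is removed. Starting from degree
  \<open>Suc d\<close>, a nonempty rest would lie on a line by induction, have at least d + 2 points
  and be no larger than the part removed, giving 2 d + 4 points where 2 d + 3 are allowed.\<close>

lemma relation_in_line:
  assumes "full_relation d S c" "card S \<le> 2 * d + 1"
  shows "\<exists>l. l \<noteq> 0 \<and> (\<forall>p\<in>S. lin l p = 0)"
proof (cases "S = {}")
  case True
  then show ?thesis by (auto intro!: exI[of _ "(1, 0, 0)"] simp: zero_prod_def)
next
  case False
  then show ?thesis using assms
  proof (induction d arbitrary: S c)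
    case 0
    then show ?case using full_relation_card_ge2 by fastforce
  next
    case (Suc d)
    have fin: "finite S" using Suc.prems by (simp add: full_relation_def)
    have ntc: "\<not> no_three_collinear S"
      using card_ge_of_relation_no_three_collinear[OF Suc.prems(2,1)] Suc.prems(3) by auto
    obtain l where l: "l \<noteq> 0" "card {p \<in> S. lin l p = 0} \<ge> 3"
      "\<And>l'. l' \<noteq> 0 \<Longrightarrow> card {p \<in> S. lin l' p = 0} \<le> card {p \<in> S. lin l p = 0}"
      by (rule line_with_most_points[OF fin ntc]) blast
    let ?S = "{p \<in> S. lin l p \<noteq> 0}"
    have rel: "full_relation d ?S (\<lambda>p. c p * lin l p)"
      using full_relation_residual[OF Suc.prems(2) lin_Pol] by simp
    have cr: "card ?S + card {p \<in> S. lin l p = 0} = card S" using card_residual[OF fin] .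
    have "?S = {}"
    proof (rule ccontr)
      assume ne: "?S \<noteq> {}"
      have "card ?S \<le> 2 * d + 1" using l(2) cr Suc.prems(3) by simp
      then obtain l' where l': "l' \<noteq> 0" "\<forall>p\<in>?S. lin l' p = 0" using Suc.IH[OF ne rel] by blast
      have "card ?S \<le> card {p \<in> S. lin l' p = 0}" using l' fin by (intro card_mono) auto
      then have "card ?S \<le> card {p \<in> S. lin l p = 0}" using l(3)[OF l'(1)] by linarith
      moreover have "card ?S \<ge> d + 2" using card_ge_of_relation[OF rel ne] .
      ultimately show False using cr Suc.prems(3) by simp
    qed
    then show ?case using l(1) by blast
  qed
qed

section \<open>Hilbert functions of finite plane sets\<close>

text \<open>The affine Hilbert function: the number of conditions that the points of
  \<open>S\<close> impose on polynomials of degree at most \<open>d\<close>.\<close>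

definition hilb :: "(complex \<times> complex) set \<Rightarrow> nat \<Rightarrow> nat" where
  "hilb S d = fs.dim (mons S d)"

text \<open>Index \<open>i\<close> stands for the monomial \<open>x^(j + 1 - i) y^i\<close>, of degree \<open>j + 1\<close>.\<close>

definition std_mons :: "(complex \<times> complex) set \<Rightarrow> nat \<Rightarrow> nat set" where
  "std_mons S j = {i. i \<le> Suc j \<and> mon_on S (Suc j - i) i \<notin>
     fs.span (mons S j \<union> (\<lambda>i. mon_on S (Suc j - i) i) ` {..<i})}"

lemma mons_Suc: "mons S (Suc j) = mons S j \<union> (\<lambda>i. mon_on S (Suc j - i) i) ` {..<Suc (Suc j)}"
proof -
  have "{(a, b). a + b \<le> Suc j} = {(a, b). a + b \<le> j} \<union> (\<lambda>i. (Suc j - i, i)) ` {..<Suc (Suc j)}"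
    by (auto simp: image_iff)
  then show ?thesis unfolding mons_def by (simp only: image_Un image_image) simp
qed

lemma hilb_Suc: "hilb S (Suc j) = hilb S j + card (std_mons S j)"
proof -
  have "{i. i < Suc (Suc j) \<and> mon_on S (Suc j - i) i \<notin>
      fs.span (mons S j \<union> (\<lambda>i. mon_on S (Suc j - i) i) ` {..<i})} = std_mons S j"
    by (auto simp: std_mons_def less_Suc_eq_le)
  then show ?thesis
    unfolding hilb_def mons_Suc by (subst fs_dim_chain[OF finite_mons]) simp
qed

lemma finite_std_mons: "finite (std_mons S j)"
  by (rule finite_subset[of _ "{..Suc j}"]) (auto simp: std_mons_def)

text \<open>Divisors of standard monomials are standard: a dependence of the divisor on earlier
  monomials, multiplied by a coordinate \<open>g\<close>, becomes one of the multiple.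
  \<open>k = 0\<close> stands for the first coordinate and \<open>k = 1\<close> for the
  second.\<close>

lemma std_mons_divisor:
  assumes g: "\<And>a b. (\<lambda>p. g p * mon_on S a b p) = mon_on S (a + (1 - k)) (b + k)" and "k \<le> 1"
    and ik: "i + k \<in> std_mons S (Suc j)" and i: "i \<le> Suc j"
  shows "i \<in> std_mons S j"
proof (rule ccontr)
  let ?Y = "mons S (Suc j) \<union> (\<lambda>i. mon_on S (Suc (Suc j) - i) i) ` {..<i + k}"
  have shift: "(\<lambda>p. g p * mon_on S (Suc j - l) l p) = mon_on S (Suc (Suc j) - (l + k)) (l + k)" if "l \<le> Suc j" for l
  proof -
    have "Suc j - l + (1 - k) = Suc (Suc j) - (l + k)" using that \<open>k \<le> 1\<close> by linarith
    then show ?thesis unfolding g by simp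
  qed
  assume "i \<notin> std_mons S j"
  then have "mon_on S (Suc j - i) i \<in> fs.span (mons S j \<union> (\<lambda>i. mon_on S (Suc j - i) i) ` {..<i})"
    using i by (auto simp: std_mons_def)
  then have "(\<lambda>p. g p * mon_on S (Suc j - i) i p) \<in> fs.span ?Y"
  proof (rule span_mult_closed)
    fix x assume "x \<in> mons S j \<union> (\<lambda>i. mon_on S (Suc j - i) i) ` {..<i}"
    then consider a b where "x = mon_on S a b" "a + b \<le> j" | l where "l < i" "x = mon_on S (Suc j - l) l"
      by (auto simp: mons_def)
    then show "(\<lambda>p. g p * x p) \<in> fs.span ?Y"
    proof cases
      case 1
      then have "(\<lambda>p. g p * x p) \<in> mons S (Suc j)"
        using g[of a b] \<open>k \<le> 1\<close> by (auto simp: mons_def)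
      then show ?thesis by (intro fs.span_base) auto
    next
      case 2
      then have "(\<lambda>p. g p * x p) = mon_on S (Suc (Suc j) - (l + k)) (l + k)" using shift[of l] i by simp
      then show ?thesis using 2(1) by (intro fs.span_base UnI2 image_eqI[of _ _ "l + k"]) auto
    qed
  qed
  then show False using ik unfolding shift[OF i] by (simp add: std_mons_def)
qed

lemma std_mons_Suc_fst:
  assumes "i \<in> std_mons S (Suc j)" "i \<le> Suc j"
  shows "i \<in> std_mons S j"
  by (rule std_mons_divisor[of fst _ 0]) (use assms in \<open>auto simp: mon_on_def\<close>)

lemma std_mons_Suc_snd:
  assumes "Suc i \<in> std_mons S (Suc j)"
  shows "i \<in> std_mons S j"
  by (rule std_mons_divisor[of snd _ 1]) (use assms in \<open>auto simp: mon_on_def std_mons_def\<close>)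

text \<open>A standard monomial other than the two pure powers has two standard divisors of the preceding
  degree, so three standard monomials in one degree force three in the preceding one.\<close>

lemma hilb_growth:
  assumes "card (std_mons S j) \<le> 2" "j \<ge> 1"
  shows "card (std_mons S (Suc j)) \<le> 2"
proof (rule ccontr)
  let ?N = "std_mons S j" and ?N' = "std_mons S (Suc j)"
  assume "\<not> card ?N' \<le> 2"
  then have c3: "card ?N' \<ge> 3" by simp
  have bnd: "i \<le> Suc (Suc j)" if "i \<in> ?N'" for i using that by (simp add: std_mons_def)
  have s1: "?N' - {Suc (Suc j)} \<subseteq> ?N"
    using std_mons_Suc_fst bnd by (metis Diff_iff le_SucE singletonI subsetI)
  have s2: "(\<lambda>i. i - 1) ` (?N' - {0}) \<subseteq> ?N"
  proof (rule image_subsetI)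
    fix i assume "i \<in> ?N' - {0}"
    then show "i - 1 \<in> ?N" using std_mons_Suc_snd[of "i - 1"] by simp
  qed
  have inj: "inj_on (\<lambda>i. i - 1) (?N' - {0::nat})" by (auto simp: inj_on_def)
  have "card (?N' - {Suc (Suc j)}) \<le> 2"
    using card_mono[OF finite_std_mons s1] assms(1) by linarith
  then have 1: "Suc (Suc j) \<in> ?N'" "card ?N' = 3"
    using c3 finite_std_mons[of S "Suc j"] by (auto simp: card_Diff_singleton_if split: if_splits)
  have "card (?N' - {0}) \<le> 2"
    using card_mono[OF finite_std_mons s2] assms(1) card_image[OF inj] by linarith
  then have 2: "0 \<in> ?N'"
    using c3 by (auto simp: card_Diff_singleton_if split: if_splits)
  have "card (?N' - {0, Suc (Suc j)}) = 1" using 1 2 finite_std_mons[of S "Suc j"] by (subst card_Diff_subset) auto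
  then obtain u where u: "?N' - {0, Suc (Suc j)} = {u}" by (auto simp: card_1_singleton_iff)
  then have "u \<in> ?N' - {0, Suc (Suc j)}" by blast
  then have u': "u \<in> ?N'" "u > 0" "u \<le> Suc j" using bnd[of u] by simp_all
  have N: "0 \<in> ?N" "u \<in> ?N" "u - 1 \<in> ?N" "Suc j \<in> ?N"
    using std_mons_Suc_fst[OF 2] std_mons_Suc_fst[OF u'(1)] std_mons_Suc_snd[of "u - 1" S j]
      std_mons_Suc_snd[of "Suc j" S j] 1 u' by simp_all
  \<comment> \<open>The third standard monomial is \<open>Suc j\<close>, unless \<open>u\<close> is
    that index; then \<open>u - 1 = j\<close> serves, and \<open>j \<ge> 1\<close> keeps it
    different from 0.\<close>
  obtain x where x: "x \<in> ?N" "x \<noteq> 0" "x \<noteq> u"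
  proof (cases "u = Suc j")
    case True
    then show thesis using N assms(2) by (intro that[of "u - 1"]) simp_all
  next
    case False
    then show thesis using N by (intro that[of "Suc j"]) simp_all
  qed
  have "card {0, u, x} \<le> card ?N" using N x by (intro card_mono finite_std_mons) simp
  moreover have "card {0, u, x} = 3" using x u' by simp
  ultimately show False using assms(1) by simp
qed

lemma hilb_growth_le:
  assumes "card (std_mons S j) \<le> 2" "j \<ge> 1" "j \<le> i"
  shows "card (std_mons S i) \<le> 2"
  using assms(3) by (induction i rule: dec_induct) (use assms hilb_growth in auto)

lemma hilb_slow:
  assumes "card (std_mons S j) \<le> 2" "j \<ge> 1" "j \<le> i"
  shows "hilb S (i + k) \<le> hilb S i + 2 * k"
proof (induction k)
  case (Suc k)
  have "card (std_mons S (i + k)) \<le> 2" using hilb_growth_le[OF assms(1,2)] assms(3) by simp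
  then show ?case using Suc by (simp add: hilb_Suc)
qed simp

text \<open>The bilinear form \<open>(f, g) \<mapsto> \<Sum> c p * f p * g p\<close> is nondegenerate on functions on \<open>S\<close>, and
  polynomials of degrees \<open>a\<close> and \<open>b\<close> are orthogonal for it.\<close>

lemma hilb_isotropic:
  assumes rel: "full_relation (a + b) S c"
  shows "hilb S a + hilb S b \<le> card S"
proof -
  have fin: "finite S" using rel by (simp add: full_relation_def)
  have sup: "f p = 0" if "f \<in> fs.span (mons S d)" "p \<notin> S" for f p d
    by (rule span_vanish[OF that(1)]) (use that(2) in \<open>auto simp: mons_def mon_on_def\<close>)
  have basis: "\<exists>B. B \<subseteq> mons S d \<and> fs.independent B \<and> finite B \<and> card B = hilb S d \<and> mons S d \<subseteq> fs.span B" for d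
    using fs.basis_exists[of "mons S d"] finite_mons[of S d] by (metis hilb_def finite_subset)
  obtain B where B: "B \<subseteq> mons S b" "fs.independent B" "finite B" "card B = hilb S b" using basis by blast
  have Bsp: "fs.span B \<subseteq> fs.span (mons S b)" using B by (intro fs.span_mono)
  have faithful: "f = 0" if "f \<in> fs.span B" "\<And>p. p \<in> S \<Longrightarrow> f p = 0" for f
  proof
    fix p show "f p = 0 p" using that Bsp sup[of f b p] by (cases "p \<in> S") auto
  qed
  obtain U where U: "U \<subseteq> S" "card U = card B"
    "\<forall>P\<in>U. \<exists>f\<in>fs.span B. f P = 1 \<and> (\<forall>Q\<in>U - {P}. f Q = 0)"
    using exists_interpolation_set[OF B(3,2) fin faithful] by auto
  obtain A where A: "A \<subseteq> mons S a" "fs.independent A" "finite A" "card A = hilb S a" using basis by blast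
  have Asp: "fs.span A \<subseteq> fs.span (mons S a)" using A by (intro fs.span_mono)
  have orth: "(\<Sum>p\<in>S. c p * (f p * g p)) = 0" if "f \<in> fs.span (mons S a)" "g \<in> fs.span (mons S b)" for f g
  proof -
    have "(\<lambda>p. f p * g p) \<in> fs.span (mons S (a + b))" by (rule span_mons_mult[OF that])
    then show ?thesis
    proof (rule span_weighted_sum_zero)
      fix x assume "x \<in> mons S (a + b)"
      then obtain i j where x: "x = mon_on S i j" "i + j \<le> a + b" by (auto simp: mons_def)
      have "mon_on UNIV i j \<in> Pol (a + b)" using x by (intro fs.span_base) (auto simp: mons_def)
      then have "(\<Sum>p\<in>S. c p * mon_on UNIV i j p) = 0" using rel by (simp add: full_relation_def)
      moreover have "(\<Sum>p\<in>S. c p * mon_on UNIV i j p) = (\<Sum>p\<in>S. c p * x p)"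
        by (intro sum.cong) (auto simp: x mon_on_def)
      ultimately show "(\<Sum>p\<in>S. c p * x p) = 0" by simp
    qed
  qed
  \<comment> \<open>Restricting functions of degree \<open>a\<close> to \<open>S - U\<close> loses
    nothing: if \<open>f\<close> vanishes there, pairing it with the dual function \<open>g\<close>
    of a node \<open>P\<close> isolates the term \<open>c P * f P\<close>. So the space embeds into
    functions on \<open>card S - hilb S b\<close> points.\<close>
  have faithful': "f = 0" if f: "f \<in> fs.span A" "\<And>p. p \<in> S - U \<Longrightarrow> f p = 0" for f
  proof
    fix P show "f P = 0 P"
    proof (cases "P \<in> U")
      case False
      then show ?thesis using f Asp sup[of f a P] by (cases "P \<in> S") auto
    next
      case True
      then obtain g where g: "g \<in> fs.span B" "g P = 1" "\<forall>Q\<in>U - {P}. g Q = 0" using U by blast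
      have "0 = (\<Sum>p\<in>S. c p * (f p * g p))" using orth f g Asp Bsp by (metis subsetD)
      also have "\<dots> = (\<Sum>p\<in>S. if p = P then c P * f P else 0)"
      proof (intro sum.cong refl)
        fix p assume "p \<in> S"
        then show "c p * (f p * g p) = (if p = P then c P * f P else 0)"
          using f(2)[of p] g by (cases "p \<in> U") auto
      qed
      also have "\<dots> = c P * f P" using True U fin by auto
      finally show ?thesis using True U rel by (auto simp: full_relation_def)
    qed
  qed
  have "finite (S - U)" using fin by simp
  obtain U' where U': "U' \<subseteq> S - U" "card U' = card A"
    using exists_interpolation_set[OF A(3,2) \<open>finite (S - U)\<close>, OF faithful'] by metis
  have "card A \<le> card (S - U)" using U' \<open>finite (S - U)\<close> card_mono[of "S - U" U'] by simp
  also have "\<dots> = card S - card B"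
    using card_Diff_subset[OF finite_subset[OF U(1) fin] U(1)] U(2) by simp
  finally have "card A \<le> card S - card B" .
  moreover have "card B \<le> card S" using card_mono[OF fin U(1)] U(2) by simp
  ultimately show ?thesis using A B by simp
qed

text \<open>A conic through five points that misses a sixth takes off at least five points for two
  degrees. The recursion starts from 2 points in degree 0 and 4 in degree 1.\<close>

lemma card_ge_of_relation_generic:
  assumes "full_relation d S c" "S \<noteq> {}" "no_three_collinear S" "no_six_conconic S"
  shows "card S \<ge> 5 * (d div 2) + 2 * (d mod 2) + 2"
  using assms
proof (induction d arbitrary: S c rule: induct_nat_012)
  case 0
  then show ?case using full_relation_card_ge2 by fastforce
next
  case 1
  then show ?case using card_ge_of_relation_no_three_collinear by fastforce
next
  case (ge2 d)
  have fin: "finite S" using ge2.prems by (simp add: full_relation_def)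
  have "card S \<ge> 6" using card_ge_of_relation_no_three_collinear[OF ge2.prems(1-3)] by simp
  then obtain U where U: "U \<subseteq> S" "card U = 6" by (meson obtain_subset_with_card_n)
  then have "U \<noteq> {}" by auto
  then obtain R where R: "R \<in> U" by blast
  have T: "U - {R} \<subseteq> S" "card (U - {R}) = 5" "R \<in> S" "R \<notin> U - {R}" using U R by auto
  obtain k where k: "quad_nz k" "\<And>p. p \<in> U - {R} \<Longrightarrow> quad k p = 0" "quad k R \<noteq> 0"
    using conic_through_avoiding[OF ge2.prems(4) fin T] by metis
  let ?S = "{p \<in> S. quad k p \<noteq> 0}"
  have "no_three_collinear ?S" "no_six_conconic ?S"
    using no_three_collinear_subset[OF ge2.prems(3) _ fin] no_six_conconic_subset[OF ge2.prems(4) _ fin] by auto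
  moreover have "full_relation d ?S (\<lambda>p. c p * quad k p)"
    using full_relation_residual[OF ge2.prems(1) quad_Pol] by simp
  moreover have "?S \<noteq> {}" using k(3) T(3) by blast
  ultimately have "card ?S \<ge> 5 * (d div 2) + 2 * (d mod 2) + 2" using ge2.IH(1) by blast
  moreover have "card (U - {R}) \<le> card {p \<in> S. quad k p = 0}" using k T fin by (intro card_mono) auto
  ultimately show ?case using card_residual[OF fin, of "quad k"] T by simp
qed

text \<open>The points other than \<open>P\<close> are split into groups of five, each on a conic
  missing \<open>P\<close>, and for odd \<open>d\<close> one pair on a line missing
  \<open>P\<close>. The product of the equations is the required function.\<close>

lemma generic_points_interpolate:
  assumes "finite U" "card U = 5 * (d div 2) + 2 * (d mod 2) + 1"
    "no_three_collinear U" "no_six_conconic U" "P \<in> U"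
  shows "\<exists>f\<in>Pol d. f P \<noteq> 0 \<and> (\<forall>Q\<in>U - {P}. f Q = 0)"
  using assms
proof (induction d arbitrary: U rule: induct_nat_012)
  case 0
  then have "U = {P}" by (auto simp: card_1_singleton_iff)
  then show ?case using const_Pol[of 1 0] by (intro bexI[of _ "\<lambda>_. 1"]) auto
next
  case 1
  then have "card (U - {P}) = 2" by simp
  then obtain Q R where QR: "U - {P} = {Q, R}" "Q \<noteq> R" by (meson card_2_iff)
  then have "Q \<in> U" "R \<in> U" "P \<noteq> Q" "P \<noteq> R" by auto
  then obtain l where "l \<noteq> 0" "lin l Q = 0" "lin l R = 0" "lin l P \<noteq> 0"
    using line_through_avoiding[OF 1(3,1), of Q R P] 1(5) QR(2) by metis
  then show ?case using QR lin_Pol[of l] by (intro bexI[of _ "lin l"]) auto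
next
  case (ge2 d)
  have c: "card U = 5 * (d div 2) + 2 * (d mod 2) + 6" using ge2.prems by simp
  then have "card (U - {P}) \<ge> 5" using ge2.prems by simp
  then obtain T where T: "T \<subseteq> U - {P}" "card T = 5" by (meson obtain_subset_with_card_n)
  have T': "T \<subseteq> U" "P \<notin> T" using T by auto
  obtain k where k: "quad_nz k" "\<And>p. p \<in> T \<Longrightarrow> quad k p = 0" "quad k P \<noteq> 0"
    using conic_through_avoiding[OF ge2.prems(4,1) T'(1) T(2) ge2.prems(5) T'(2)] by metis
  have "finite T" using T' ge2.prems finite_subset by blast
  then have "card (U - T) = 5 * (d div 2) + 2 * (d mod 2) + 1" using c T T' by (simp add: card_Diff_subset)
  then obtain f where f: "f \<in> Pol d" "f P \<noteq> 0" "\<forall>Q\<in>U - T - {P}. f Q = 0"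
    using ge2.IH(1)[of "U - T"] ge2.prems T' no_three_collinear_subset[OF ge2.prems(3)]
      no_six_conconic_subset[OF ge2.prems(4)] by blast
  have "(\<lambda>p. f p * quad k p) \<in> Pol (Suc (Suc d))" using span_mons_mult[OF f(1) quad_Pol[of k]] by simp
  then show ?case using f k by (intro bexI[of _ "\<lambda>p. f p * quad k p"]) auto
qed

lemma hilb_ge:
  assumes "finite S" "U \<subseteq> S" "\<And>P. P \<in> U \<Longrightarrow> \<exists>f\<in>Pol d. f P \<noteq> 0 \<and> (\<forall>Q\<in>U - {P}. f Q = 0)"
  shows "card U \<le> hilb S d"
  unfolding hilb_def
proof (rule card_le_dim_of_deltas)
  show "finite (mons S d)" by (rule finite_mons)
  show "finite U" using assms finite_subset by blast
  fix P assume P: "P \<in> U"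
  then obtain f where f: "f \<in> Pol d" "f P \<noteq> 0" "\<forall>Q\<in>U - {P}. f Q = 0" using assms(3) by blast
  let ?i = "\<lambda>p. if p \<in> S then 1 else (0::complex)"
  have "(\<lambda>p. ?i p * f p) \<in> fs.span (mons S d)"
  proof (rule span_mult_closed[OF f(1)])
    fix x assume "x \<in> mons UNIV d"
    then obtain a b where x: "x = mon_on UNIV a b" "a + b \<le> d" by (auto simp: mons_def)
    then have "(\<lambda>p. ?i p * x p) = mon_on S a b" by (auto simp: mon_on_def)
    then show "(\<lambda>p. ?i p * x p) \<in> fs.span (mons S d)" using x by (intro fs.span_base) (auto simp: mons_def)
  qed
  then show "\<exists>f\<in>fs.span (mons S d). f P \<noteq> 0 \<and> (\<forall>Q\<in>U - {P}. f Q = 0)"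
    using f P assms(2) by (intro bexI[of _ "\<lambda>p. ?i p * f p"]) auto
qed

text \<open>If the Hilbert function grew by at least 3 in every degree from 2 up to half of \<open>d\<close>, then
  \<open>hilb_isotropic\<close> would be violated; once it grows by at most 2 it does so forever, which
  contradicts the number of conditions imposed by points in general position.\<close>

lemma relation_not_generic:
  assumes rel: "full_relation d S c" and "card S + 1 \<le> 3 * d"
    and nt: "no_three_collinear S" and ns: "no_six_conconic S"
  shows "S = {}"
proof (rule ccontr)
  assume ne: "S \<noteq> {}"
  have fin: "finite S" using rel by (simp add: full_relation_def)
  have c2: "card S \<ge> 2 * d + 2" using card_ge_of_relation_no_three_collinear[OF rel ne nt] .
  then have d3: "d \<ge> 3" using assms(2) by linarith
  define m where "m = d div 2"
  define e where "e = d mod 2"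
  have dm: "d = 2 * m + e" "e \<le> 1" "m \<ge> 1" using d3 by (auto simp: m_def e_def)
  have big: "hilb S d \<ge> 5 * m + 2 * e + 1"
  proof -
    have "card S \<ge> 5 * m + 2 * e + 1"
      using card_ge_of_relation_generic[OF rel ne nt ns] by (simp add: m_def e_def)
    then obtain U where U: "U \<subseteq> S" "card U = 5 * m + 2 * e + 1" by (meson obtain_subset_with_card_n)
    then have "finite U" using fin finite_subset by blast
    then have "card U \<le> hilb S d"
      using generic_points_interpolate[of U d] no_three_collinear_subset[OF nt U(1) fin]
        no_six_conconic_subset[OF ns U(1) fin] U by (intro hilb_ge[OF fin U(1)]) (auto simp: m_def e_def)
    then show ?thesis using U by simp
  qed
  have h1: "hilb S 1 \<ge> 3"
  proof -
    have "card S \<ge> 3" using c2 d3 by linarith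
    then obtain U where U: "U \<subseteq> S" "card U = 3" by (meson obtain_subset_with_card_n)
    then have "finite U" using fin finite_subset by blast
    then have "card U \<le> hilb S 1"
      using generic_points_interpolate[of U 1] no_three_collinear_subset[OF nt U(1) fin]
        no_six_conconic_subset[OF ns U(1) fin] U by (intro hilb_ge[OF fin U(1)]) auto
    then show ?thesis using U by simp
  qed
  have iso: "hilb S m + hilb S (m + e) \<le> card S"
    using hilb_isotropic[of m "m + e" S c] rel dm by (simp add: mult_2 add.assoc)
  \<comment> \<open>Growth by at least 3 throughout would give \<open>hilb S i \<ge> 3 * i\<close>
    for the two halves \<open>m\<close> and \<open>m + e\<close> of \<open>d\<close>, and 3 d
    exceeds \<open>card S\<close>.\<close>
  have "\<exists>j. 1 \<le> j \<and> j < m + e \<and> card (std_mons S j) \<le> 2"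
  proof (rule ccontr)
    assume *: "\<not> ?thesis"
    have grow: "hilb S (Suc i) \<ge> 3 * Suc i" if "Suc i \<le> m + e" for i
      using that
    proof (induction i)
      case (Suc i)
      have "card (std_mons S (Suc i)) \<ge> 3" using *[unfolded not_ex, rule_format, of "Suc i"] Suc.prems by simp
      then show ?case using Suc hilb_Suc[of S "Suc i"] by simp
    qed (use h1 in simp)
    have "hilb S m \<ge> 3 * m" "hilb S (m + e) \<ge> 3 * (m + e)"
      using grow[of "m - 1"] grow[of "m + e - 1"] dm by auto
    then show False using iso assms(2) dm by simp
  qed
  then obtain j where j: "1 \<le> j" "j < m + e" "card (std_mons S j) \<le> 2" by blast
  then have jm: "j \<le> m" using dm by simp
  \<comment> \<open>Together with \<open>iso\<close> this gives 2 \<open>hilb S (m + e)\<close>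
    \<le> 3 d - 1 + 2 e. Adding 2 m for the remaining degrees leaves \<open>hilb S d\<close> below
    the bound \<open>big\<close>.\<close>
  have "hilb S (m + e) \<le> hilb S m + 2 * e" using hilb_slow[OF j(3,1) jm] .
  moreover have "hilb S (m + e + m) \<le> hilb S (m + e) + 2 * m"
    using hilb_slow[OF j(3,1), of "m + e" m] j by simp
  moreover have "m + e + m = d" using dm by simp
  ultimately have "hilb S d \<le> hilb S (m + e) + 2 * m" "hilb S (m + e) \<le> hilb S m + 2 * e" by simp_all
  then show False using iso big assms(2) dm by linarith
qed

text \<open>Taking off a line with three points or a conic with six lowers the degree by 1 or 2 and
  the bound 3 d - 1 by 3 or 6, so the residual relation satisfies the induction hypothesis. Sets
  without such curves are excluded by \<open>relation_not_generic\<close>.\<close>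

lemma relation_in_conic:
  assumes "full_relation d S c" "card S + 1 \<le> 3 * d"
  shows "\<exists>k. quad_nz k \<and> (\<forall>p\<in>S. quad k p = 0)"
  using assms
proof (induction d arbitrary: S c rule: less_induct)
  case (less d)
  have fin: "finite S" using less.prems by (simp add: full_relation_def)
  have triv: ?case if "S = {}"
    using that by (auto intro!: exI[of _ "\<lambda>_. 1"] exI[of _ "0::nat"] simp: quad_nz_def)
  show ?case
  proof (cases "no_three_collinear S")
    case False
    obtain l where l: "l \<noteq> 0" "card {p \<in> S. lin l p = 0} \<ge> 3"
      by (rule line_with_most_points[OF fin False]) blast
    let ?S = "{p \<in> S. lin l p \<noteq> 0}"
    have cr: "card ?S + card {p \<in> S. lin l p = 0} = card S" using card_residual[OF fin] .
    have d2: "d \<ge> 2" using cr l less.prems by linarith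
    have rel: "full_relation (d - 1) ?S (\<lambda>p. c p * lin l p)"
      using full_relation_residual[OF less.prems(1) lin_Pol] d2 by simp
    show ?thesis
    proof (cases "card ?S \<le> 2 * (d - 1) + 1")
      case True
      then obtain l' where l': "l' \<noteq> 0" "\<forall>p\<in>?S. lin l' p = 0" using relation_in_line[OF rel] by auto
      obtain k where "quad_nz k" "\<And>p. quad k p = lin l p * lin l' p" using lin_mult_lin[OF l(1) l'(1)] by metis
      moreover have "lin l p * lin l' p = 0" if "p \<in> S" for p
      proof (cases "lin l p = 0")
        case False
        then have "lin l' p = 0" using l'(2) that by blast
        then show ?thesis by simp
      qed simp
      ultimately show ?thesis by auto
    next
      case big: False
      have "card ?S + 1 \<le> 3 * (d - 1)" using l(2) cr less.prems(2) d2 by linarith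
      then obtain k where k: "quad_nz k" "\<forall>p\<in>?S. quad k p = 0" using less.IH[OF _ rel] d2 by auto
      let ?R = "{p \<in> S. quad k p \<noteq> 0}"
      have relR: "full_relation (d - 2) ?R (\<lambda>p. c p * quad k p)"
        using full_relation_residual[OF less.prems(1) quad_Pol] d2 by simp
      \<comment> \<open>The conic already holds the at least 2 d points of \<open>?S\<close>; a
        nonempty rest would add at least d more, and 3 d is too many.\<close>
      have "?R = {}"
      proof (rule ccontr)
        assume "?R \<noteq> {}"
        then have "card ?R \<ge> d - 2 + 2" using card_ge_of_relation[OF relR] by simp
        moreover have "card ?S \<le> card {p \<in> S. quad k p = 0}" using k fin by (intro card_mono) auto
        ultimately show False
          using card_residual[OF fin, of "quad k"] big less.prems(2) d2 by linarith
      qed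
      then show ?thesis using k by auto
    qed
  next
    case nt: True
    show ?thesis
    proof (cases "no_six_conconic S")
      case True
      then show ?thesis using relation_not_generic[OF less.prems nt] triv by simp
    next
      case False
      obtain k where k: "quad_nz k" "card {p \<in> S. quad k p = 0} \<ge> 6"
        "\<And>k'. quad_nz k' \<Longrightarrow> card {p \<in> S. quad k' p = 0} \<le> card {p \<in> S. quad k p = 0}"
        by (rule conic_with_most_points[OF fin False]) blast
      let ?S = "{p \<in> S. quad k p \<noteq> 0}"
      have cr: "card ?S + card {p \<in> S. quad k p = 0} = card S" using card_residual[OF fin] .
      have d3: "d \<ge> 3" using cr k less.prems by linarith
      have rel: "full_relation (d - 2) ?S (\<lambda>p. c p * quad k p)"
        using full_relation_residual[OF less.prems(1) quad_Pol] d3 by simp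
      \<comment> \<open>By maximality of the conic, \<open>?S\<close> is at most half of
        \<open>S\<close>, so 4 d - 4 \<le> 3 d - 1. This leaves d = 3, where \<open>?S\<close> would
        need at least 4 points but has at most 2.\<close>
      have "?S = {}"
      proof (rule ccontr)
        assume ne: "?S \<noteq> {}"
        have c: "card ?S \<ge> 2 * (d - 2) + 2"
          by (rule card_ge_of_relation_no_three_collinear[OF rel ne no_three_collinear_subset[OF nt _ fin]]) auto
        have "card ?S + 1 \<le> 3 * (d - 2)" using k(2) cr less.prems(2) d3 by linarith
        then obtain k' where k': "quad_nz k'" "\<forall>p\<in>?S. quad k' p = 0" using less.IH[OF _ rel] d3 by auto
        have "card ?S \<le> card {p \<in> S. quad k' p = 0}" using k' fin by (intro card_mono) auto
        then have "card ?S \<le> card {p \<in> S. quad k p = 0}" using k(3)[OF k'(1)] by linarith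
        then show False using c cr less.prems(2) d3 \<open>card ?S + 1 \<le> 3 * (d - 2)\<close> by linarith
      qed
      then show ?thesis using k by auto
    qed
  qed
qed

section \<open>Deforming apolar polynomials in one variable\<close>

definition lagr :: "'i set \<Rightarrow> ('i \<Rightarrow> complex) \<Rightarrow> 'i \<Rightarrow> complex poly" where
  "lagr I \<alpha> i = (\<Prod>j\<in>I - {i}. [:- \<alpha> j, 1:])"

text \<open>The value at \<open>\<alpha> i\<close> of the derivative of the monic polynomial with
  roots \<open>\<alpha> j\<close>.\<close>

definition lagr_weight :: "'i set \<Rightarrow> ('i \<Rightarrow> complex) \<Rightarrow> 'i \<Rightarrow> complex" where
  "lagr_weight I \<alpha> i = (\<Prod>j\<in>I - {i}. \<alpha> i - \<alpha> j)"

lemma degree_monic_prod: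
  assumes "finite J"
  shows "degree (\<Prod>j\<in>J. [:- \<alpha> j :: complex, 1:]) = card J" "lead_coeff (\<Prod>j\<in>J. [:- \<alpha> j :: complex, 1:]) = 1"
  by (subst degree_prod_eq_sum_degree) (auto simp: lead_coeff_prod)

lemma poly_lagr:
  assumes "finite I" "i \<in> I" "j \<in> I"
  shows "poly (lagr I \<alpha> i) (\<alpha> j) = (if j = i then lagr_weight I \<alpha> i else 0)"
  using assms by (auto simp: lagr_def lagr_weight_def poly_prod)

lemma lagr_weight_nz:
  assumes "finite I" "inj_on \<alpha> I" "i \<in> I"
  shows "lagr_weight I \<alpha> i \<noteq> 0"
  using assms by (auto simp: lagr_weight_def inj_on_def)

lemma lagrange_interpolation:
  assumes "finite I" "inj_on \<alpha> I" "degree p < card I"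
  shows "p = (\<Sum>i\<in>I. Polynomial.smult (poly p (\<alpha> i) / lagr_weight I \<alpha> i) (lagr I \<alpha> i))" (is "p = ?q")
proof (rule ccontr)
  assume "p \<noteq> ?q"
  then have nz: "p - ?q \<noteq> 0" by simp
  have "degree (Polynomial.smult (poly p (\<alpha> i) / lagr_weight I \<alpha> i) (lagr I \<alpha> i)) \<le> card I - 1" if "i \<in> I" for i
    using degree_monic_prod(1)[of "I - {i}" \<alpha>] assms that
    by (intro order_trans[OF degree_smult_le]) (simp add: lagr_def)
  then have "degree ?q \<le> card I - 1"
    using assms by (intro degree_sum_le) auto
  then have "degree (p - ?q) < card I"
    using assms(3) by (intro degree_diff_less) auto
  moreover have "\<alpha> ` I \<subseteq> {x. poly (p - ?q) x = 0}"
  proof (rule image_subsetI)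
    fix j assume j: "j \<in> I"
    have "poly ?q (\<alpha> j) = (\<Sum>i\<in>I. if i = j then poly p (\<alpha> j) else 0)"
      unfolding poly_sum using assms j lagr_weight_nz[OF assms(1,2)]
      by (intro sum.cong) (auto simp: poly_lagr)
    then show "\<alpha> j \<in> {x. poly (p - ?q) x = 0}" using assms j by simp
  qed
  then have "card (\<alpha> ` I) \<le> card {x. poly (p - ?q) x = 0}"
    using poly_roots_finite[OF nz] by (intro card_mono)
  then have "card I \<le> degree (p - ?q)"
    using card_image[OF assms(2)] card_poly_roots_bound[OF nz] by linarith
  ultimately show False by simp
qed

text \<open>Euler's identity: the sum is the coefficient of degree \<open>card I - 1\<close> in the
  Lagrange interpolation of \<open>p\<close>, and \<open>p\<close> has smaller degree.\<close>

lemma euler_sum_zero: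
  assumes "finite I" "inj_on \<alpha> I" "Suc (degree p) < card I"
  shows "(\<Sum>i\<in>I. poly p (\<alpha> i) / lagr_weight I \<alpha> i) = 0"
proof -
  have c: "coeff (lagr I \<alpha> i) (card I - 1) = 1" if "i \<in> I" for i
    using degree_monic_prod[of "I - {i}" \<alpha>] assms(1) that by (simp add: lagr_def)
  have "0 = coeff p (card I - 1)" using assms(3) by (simp add: coeff_eq_0)
  also have "\<dots> = (\<Sum>i\<in>I. poly p (\<alpha> i) / lagr_weight I \<alpha> i * coeff (lagr I \<alpha> i) (card I - 1))"
    by (subst lagrange_interpolation[OF assms(1,2), of p]) (use assms(3) in \<open>simp_all add: coeff_sum\<close>)
  also have "\<dots> = (\<Sum>i\<in>I. poly p (\<alpha> i) / lagr_weight I \<alpha> i)"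
    using c by (intro sum.cong) auto
  finally show ?thesis by simp
qed

text \<open>The monic polynomial \<open>h\<close> with roots \<open>\<alpha> i\<close> and the polynomial \<open>g\<close> with
  \<open>g(\<alpha> i) = 1 / (a i * h'(\<alpha> i))\<close> span a pencil annihilated by the functional
  \<open>p \<mapsto> \<Sum> a i * p(\<alpha> i)\<close>; the roots of \<open>h + t g\<close> are the values at \<open>t\<close> of the local
  inverses of \<open>- h / g\<close>.\<close>

lemma binary_family:
  fixes \<alpha> a :: "'i \<Rightarrow> complex"
  assumes I: "finite I" "card I = Suc M" "inj_on \<alpha> I" and a: "\<And>i. i \<in> I \<Longrightarrow> a i \<noteq> 0"
  obtains \<epsilon> \<beta> where "\<epsilon> > 0"
    "\<And>i. i \<in> I \<Longrightarrow> \<beta> i holomorphic_on ball 0 \<epsilon>"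
    "\<And>i. i \<in> I \<Longrightarrow> \<beta> i 0 = \<alpha> i"
    "\<And>i. i \<in> I \<Longrightarrow> inj_on (\<beta> i) (ball 0 \<epsilon>)"
    "\<And>t. t \<in> ball 0 \<epsilon> \<Longrightarrow> \<exists>c. \<forall>p. degree p \<le> 2 * M \<longrightarrow>
      (\<Sum>i\<in>I. a i * poly p (\<alpha> i)) = (\<Sum>i\<in>I. c i * poly p (\<beta> i t))"
proof -
  define w where "w = lagr_weight I \<alpha>"
  have w: "w i \<noteq> 0" if "i \<in> I" for i using lagr_weight_nz[OF I(1,3) that] by (simp add: w_def)
  define h where "h = (\<Prod>i\<in>I. [:- \<alpha> i, 1:])"
  have h: "degree h = Suc M" "lead_coeff h = 1" using degree_monic_prod[OF I(1), of \<alpha>] I by (simp_all add: h_def)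
  define g where "g = (\<Sum>i\<in>I. Polynomial.smult (1 / (a i * w i) / w i) (lagr I \<alpha> i))"
  have g\<alpha>: "poly g (\<alpha> j) = 1 / (a j * w j)" if j: "j \<in> I" for j
  proof -
    have "poly g (\<alpha> j) = (\<Sum>i\<in>I. if i = j then 1 / (a j * w j) else 0)"
      unfolding g_def poly_sum using I(1) j w
      by (intro sum.cong) (auto simp: poly_lagr w_def)
    then show ?thesis using I(1) j by simp
  qed
  have h\<alpha>: "poly h (\<alpha> j) = 0" if "j \<in> I" for j using that I(1) by (auto simp: h_def poly_prod)
  have h'\<alpha>: "poly (pderiv h) (\<alpha> j) = w j" if j: "j \<in> I" for j
  proof -
    have "h = [:- \<alpha> j, 1:] * lagr I \<alpha> j" using I(1) j by (simp add: h_def lagr_def prod.remove)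
    then have "pderiv h = [:- \<alpha> j, 1:] * pderiv (lagr I \<alpha> j) + lagr I \<alpha> j * pderiv [:- \<alpha> j, 1:]"
      by (simp only: pderiv_mult)
    then have "poly (pderiv h) (\<alpha> j) = poly [:- \<alpha> j, 1:] (\<alpha> j) * poly (pderiv (lagr I \<alpha> j)) (\<alpha> j)
        + poly (lagr I \<alpha> j) (\<alpha> j) * poly (pderiv [:- \<alpha> j, 1:]) (\<alpha> j)"
      by (simp only: poly_add poly_mult)
    then show ?thesis using I(1) j by (simp add: pderiv_pCons poly_lagr w_def)
  qed
  have deg_g: "degree g \<le> M"
    unfolding g_def
  proof (rule degree_sum_le[OF I(1)])
    fix i assume "i \<in> I"
    then show "degree (Polynomial.smult (1 / (a i * w i) / w i) (lagr I \<alpha> i)) \<le> M"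
      using degree_monic_prod(1)[of "I - {i}" \<alpha>] I
      by (intro order_trans[OF degree_smult_le]) (simp add: lagr_def)
  qed
  have deg_ht: "degree (h + Polynomial.smult t g) = Suc M" for t
    using deg_g h(1) by (subst degree_add_eq_left) (auto intro: le_less_trans[OF degree_smult_le])

  define \<psi> where "\<psi> s = - poly h s / poly g s" for s
  have "\<exists>d>0. \<forall>x\<in>\<alpha> ` I. x \<noteq> \<alpha> i \<longrightarrow> d \<le> dist (\<alpha> i) x" for i
    using finite_set_avoid[of "\<alpha> ` I" "\<alpha> i"] I(1) by auto
  then obtain d where d: "\<And>i. d i > 0" "\<And>i j. j \<in> I \<Longrightarrow> \<alpha> j \<noteq> \<alpha> i \<Longrightarrow> d i \<le> dist (\<alpha> i) (\<alpha> j)"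
    by (metis image_eqI)
  \<comment> \<open>Discs of radius at most half the distance to every other root are disjoint,
    which keeps the moving roots distinct; off the zeros of \<open>g\<close> the quotient
    \<open>\<psi>\<close> is holomorphic.\<close>
  define S where "S i = {s. poly g s \<noteq> 0} \<inter> ball (\<alpha> i) (d i / 2)" for i
  have "open {s. poly g s \<noteq> 0}"
    by (intro open_Collect_neq continuous_intros)
  then have openS: "open (S i)" for i by (auto simp: S_def)
  have disj: "S i \<inter> S j = {}" if "i \<in> I" "j \<in> I" "i \<noteq> j" for i j
  proof (rule ccontr)
    assume "S i \<inter> S j \<noteq> {}"
    then obtain x where x: "dist (\<alpha> i) x < d i / 2" "dist (\<alpha> j) x < d j / 2" by (auto simp: S_def)
    have "dist (\<alpha> i) (\<alpha> j) \<le> dist (\<alpha> i) x + dist (\<alpha> j) x" by (metis dist_commute dist_triangle)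
    moreover have "\<alpha> i \<noteq> \<alpha> j" using I(3) that by (auto simp: inj_on_def)
    then have "d i \<le> dist (\<alpha> i) (\<alpha> j)" "d j \<le> dist (\<alpha> i) (\<alpha> j)"
      using d(2)[of j i] d(2)[of i j] that by (auto simp: dist_commute)
    ultimately show False using x by linarith
  qed
  define Q where "Q i e \<beta> \<longleftrightarrow> e > 0 \<and> \<beta> holomorphic_on ball 0 e \<and> \<beta> 0 = \<alpha> i \<and>
      (\<forall>t\<in>ball 0 e. \<beta> t \<in> S i \<and> \<psi> (\<beta> t) = t)" for i e \<beta>
  have "\<exists>e \<beta>. Q i e \<beta>" if i: "i \<in> I" for i
  proof -
    have gi: "poly g (\<alpha> i) \<noteq> 0" using g\<alpha>[OF i] a[OF i] w[OF i] by simp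
    have \<alpha>S: "\<alpha> i \<in> S i" using gi d(1)[of i] by (simp add: S_def)
    have hol: "\<psi> holomorphic_on S i"
      unfolding \<psi>_def by (intro holomorphic_intros) (auto simp: S_def)
    have "(\<psi> has_field_derivative (- poly (pderiv h) (\<alpha> i) * poly g (\<alpha> i) - (- poly h (\<alpha> i)) * poly (pderiv g) (\<alpha> i)) / (poly g (\<alpha> i) * poly g (\<alpha> i))) (at (\<alpha> i))"
      unfolding \<psi>_def using gi by (intro derivative_intros) auto
    then have "deriv \<psi> (\<alpha> i) = - poly (pderiv h) (\<alpha> i) / poly g (\<alpha> i)"
      using h\<alpha>[OF i] gi by (simp add: DERIV_imp_deriv)
    then have "deriv \<psi> (\<alpha> i) \<noteq> 0" using h'\<alpha>[OF i] w[OF i] gi by simp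
    then obtain r where r: "r > 0" "ball (\<alpha> i) r \<subseteq> S i" "inj_on \<psi> (ball (\<alpha> i) r)"
      using has_complex_derivative_locally_injective[OF hol \<alpha>S openS] by metis
    have hol': "\<psi> holomorphic_on ball (\<alpha> i) r" using hol r(2) by (rule holomorphic_on_subset)
    obtain \<beta> where \<beta>: "\<beta> holomorphic_on (\<psi> ` ball (\<alpha> i) r)" "\<And>z. z \<in> ball (\<alpha> i) r \<Longrightarrow> \<beta> (\<psi> z) = z"
      using holomorphic_has_inverse[OF hol' open_ball r(3)] by metis
    have "open (\<psi> ` ball (\<alpha> i) r)" by (rule open_mapping_thm3[OF hol' open_ball r(3)])
    moreover have \<psi>0: "\<psi> (\<alpha> i) = 0" using h\<alpha>[OF i] by (simp add: \<psi>_def)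
    then have "0 \<in> \<psi> ` ball (\<alpha> i) r" using r(1) by (metis centre_in_ball imageI)
    ultimately obtain e where e: "e > 0" "ball 0 e \<subseteq> \<psi> ` ball (\<alpha> i) r"
      using open_contains_ball by metis
    have "\<beta> holomorphic_on ball 0 e" using \<beta>(1) e(2) by (rule holomorphic_on_subset)
    moreover have "\<beta> 0 = \<alpha> i" using \<beta>(2)[of "\<alpha> i"] \<psi>0 r(1) by simp
    moreover have "\<beta> t \<in> S i \<and> \<psi> (\<beta> t) = t" if t: "t \<in> ball 0 e" for t
    proof -
      obtain z where "z \<in> ball (\<alpha> i) r" "t = \<psi> z" using e(2) t by blast
      then show ?thesis using \<beta>(2)[of z] r(2) by auto
    qed
    ultimately show ?thesis using e(1) unfolding Q_def by blast
  qed
  then obtain e \<beta> where Q: "\<And>i. i \<in> I \<Longrightarrow> Q i (e i) (\<beta> i)" by metis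
  have e: "\<And>i. i \<in> I \<Longrightarrow> e i > 0"
    and \<beta>: "\<And>i. i \<in> I \<Longrightarrow> \<beta> i holomorphic_on ball 0 (e i)" "\<And>i. i \<in> I \<Longrightarrow> \<beta> i 0 = \<alpha> i"
      "\<And>i t. i \<in> I \<Longrightarrow> t \<in> ball 0 (e i) \<Longrightarrow> \<beta> i t \<in> S i" "\<And>i t. i \<in> I \<Longrightarrow> t \<in> ball 0 (e i) \<Longrightarrow> \<psi> (\<beta> i t) = t"
    using Q unfolding Q_def by blast+
  define \<epsilon> where "\<epsilon> = Min (e ` I)"
  have Ine: "I \<noteq> {}" using I(2) by auto
  have \<epsilon>: "\<epsilon> > 0" using e I(1) Ine by (simp add: \<epsilon>_def)
  have sub: "ball 0 \<epsilon> \<subseteq> ball (0::complex) (e i)" if "i \<in> I" for i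
    using I(1) that by (intro subset_ball) (simp add: \<epsilon>_def)
  show thesis
  proof (rule that[OF \<epsilon>])
    fix i assume i: "i \<in> I"
    show "\<beta> i holomorphic_on ball 0 \<epsilon>" using \<beta>(1)[OF i] sub[OF i] by (rule holomorphic_on_subset)
    show "\<beta> i 0 = \<alpha> i" by (rule \<beta>(2)[OF i])
    show "inj_on (\<beta> i) (ball 0 \<epsilon>)"
      by (rule inj_onI) (metis \<beta>(4)[OF i] sub[OF i] subsetD)
  next
    fix t :: complex assume t: "t \<in> ball 0 \<epsilon>"
    let ?b = "\<lambda>i. \<beta> i t" and ?h = "h + Polynomial.smult t g"
    have injb: "inj_on ?b I"
    proof (rule inj_onI, rule ccontr)
      fix i j assume ij: "i \<in> I" "j \<in> I" "?b i = ?b j" "i \<noteq> j"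
      have "t \<in> ball 0 (e i)" "t \<in> ball 0 (e j)" using sub[OF ij(1)] sub[OF ij(2)] t by blast+
      then have "?b i \<in> S i" "?b j \<in> S j" using \<beta>(3) ij by blast+
      then have "?b i \<in> S i \<inter> S j" using ij(3) by simp
      then show False using disj ij by blast
    qed
    have root: "poly ?h (?b i) = 0" if i: "i \<in> I" for i
    proof -
      have tt: "t \<in> ball 0 (e i)" using sub[OF i] t by blast
      then have "poly g (?b i) \<noteq> 0" using \<beta>(3)[OF i tt] by (simp add: S_def)
      then have "- poly h (?b i) = t * poly g (?b i)" using \<beta>(4)[OF i tt] by (simp add: \<psi>_def field_simps)
      then have "t * poly g (?b i) = - poly h (?b i)" by (rule sym)
      then show ?thesis by simp
    qed
    \<comment> \<open>These values are forced by testing the functional on the Lagrange polynomials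
      of the new nodes.\<close>
    define c where "c i = (\<Sum>k\<in>I. a k * poly (lagr I ?b i) (\<alpha> k)) / lagr_weight I ?b i" for i
    have "(\<Sum>i\<in>I. a i * poly p (\<alpha> i)) = (\<Sum>i\<in>I. c i * poly p (?b i))" if p: "degree p \<le> 2 * M" for p
    proof -
      define q r where "q = p div ?h" and "r = p mod ?h"
      have pqr: "p = ?h * q + r" by (simp add: q_def r_def)
      have hnz: "?h \<noteq> 0" using deg_ht[of t] by auto
      have degr: "degree r < Suc M"
        using degree_mod_less[OF hnz, of p] deg_ht[of t] by (auto simp: r_def)
      \<comment> \<open>At the old nodes \<open>h\<close> vanishes and
        \<open>a i * poly g (\<alpha> i) = 1 / w i\<close>, so multiples of \<open>h + t g\<close>
        are killed by Euler's identity, \<open>q\<close> having degree at most M - 1. Only the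
        remainder \<open>r\<close>, of degree at most M, counts, and its values at the M + 1 new
        roots determine it.\<close>
      have hq: "(\<Sum>i\<in>I. a i * poly (?h * q) (\<alpha> i)) = 0"
      proof (cases "q = 0")
        case False
        have "degree (?h * q) \<le> 2 * M"
        proof -
          have "?h * q = p - r" using pqr by (metis add_diff_cancel_right')
          moreover have "degree r \<le> 2 * M" using degr by simp
          ultimately show ?thesis using p degree_diff_le by metis
        qed
        moreover have "degree (?h * q) = Suc M + degree q"
          using degree_mult_eq[OF hnz False] deg_ht[of t] by simp
        ultimately have dq: "Suc (degree q) < card I" using I(2) by linarith
        have "(\<Sum>i\<in>I. a i * poly (?h * q) (\<alpha> i)) = t * (\<Sum>i\<in>I. poly q (\<alpha> i) / w i)"
          unfolding sum_distrib_left
          using h\<alpha> g\<alpha> a w by (intro sum.cong) (auto simp: field_simps)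
        then show ?thesis using euler_sum_zero[OF I(1,3) dq] by (simp add: w_def)
      qed simp
      have "(\<Sum>i\<in>I. a i * poly p (\<alpha> i)) = (\<Sum>i\<in>I. a i * poly (?h * q) (\<alpha> i)) + (\<Sum>i\<in>I. a i * poly r (\<alpha> i))"
        by (subst pqr) (simp only: poly_add distrib_left sum.distrib)
      also have "\<dots> = (\<Sum>k\<in>I. a k * poly r (\<alpha> k))" using hq by simp
      also have "\<dots> = (\<Sum>k\<in>I. a k * (\<Sum>i\<in>I. poly r (?b i) / lagr_weight I ?b i * poly (lagr I ?b i) (\<alpha> k)))"
        by (subst lagrange_interpolation[OF I(1) injb, of r]) (use degr I(2) in \<open>simp_all add: poly_sum\<close>)
      also have "\<dots> = (\<Sum>i\<in>I. c i * poly r (?b i))"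
        unfolding c_def sum_distrib_left sum_divide_distrib sum_distrib_right
        by (subst sum.swap) (simp add: mult_ac)
      also have "\<dots> = (\<Sum>i\<in>I. c i * poly p (?b i))"
      proof (rule sum.cong[OF refl])
        fix i assume "i \<in> I"
        have "poly p (?b i) = poly ?h (?b i) * poly q (?b i) + poly r (?b i)"
          by (subst pqr) (simp only: poly_add poly_mult)
        then show "c i * poly r (?b i) = c i * poly p (?b i)" using root[OF \<open>i \<in> I\<close>] by simp
      qed
      finally show ?thesis .
    qed
    then show "\<exists>c. \<forall>p. degree p \<le> 2 * M \<longrightarrow>
      (\<Sum>i\<in>I. a i * poly p (\<alpha> i)) = (\<Sum>i\<in>I. c i * poly p (\<beta> i t))"
      by blast
  qed
qed

section \<open>Powers of linear forms\<close>

abbreviation vmon :: "complex ^ 'n \<Rightarrow> ('n \<Rightarrow>\<^sub>0 nat) \<Rightarrow> complex" where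
  "vmon v u \<equiv> monom_eval (\<lambda>j. v $ j) u"

definition tdeg :: "('n::finite \<Rightarrow>\<^sub>0 nat) \<Rightarrow> nat" where
  "tdeg u = (\<Sum>i\<in>UNIV. Poly_Mapping.lookup u i)"

lemma single_mult_eq_sum:
  fixes F :: "'v cpoly"
  shows "Poly_Mapping.single k a * F =
    (\<Sum>w\<in>Poly_Mapping.keys F. Poly_Mapping.single (k + w) (a * Poly_Mapping.lookup F w))"
proof -
  have "Poly_Mapping.single k a * F =
      Poly_Mapping.single k a * (\<Sum>w\<in>Poly_Mapping.keys F. Poly_Mapping.single w (Poly_Mapping.lookup F w))"
    by (simp only: cpoly_sum_monomials)
  then show ?thesis by (simp add: sum_distrib_left mult_single)
qed

lemma lookup_single_mult_add:
  fixes F :: "'v cpoly"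
  shows "Poly_Mapping.lookup (Poly_Mapping.single k a * F) (k + w) = a * Poly_Mapping.lookup F w"
  unfolding single_mult_eq_sum
  by (auto simp: lookup_sum lookup_single when_def in_keys_iff sum.delta')

lemma lookup_single_mult_other:
  fixes F :: "'v cpoly"
  assumes "\<And>w. u \<noteq> k + w"
  shows "Poly_Mapping.lookup (Poly_Mapping.single k a * F) u = 0"
  unfolding single_mult_eq_sum
  using assms[symmetric] by (simp add: lookup_sum lookup_single when_def)

abbreviation unit_mon :: "'n \<Rightarrow> ('n \<Rightarrow>\<^sub>0 nat)" where
  "unit_mon i \<equiv> Poly_Mapping.single i 1"

lemma unit_mon_add_minus:
  assumes "Poly_Mapping.lookup u i > 0"
  shows "u = unit_mon i + (u - unit_mon i)"
  by (rule poly_mapping_eqI) (use assms in \<open>auto simp: lookup_add lookup_minus lookup_single when_def\<close>)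

lemma tdeg_unit_mon_add: "tdeg (unit_mon i + w) = Suc (tdeg w)"
  by (simp add: tdeg_def lookup_add sum.distrib lookup_single when_def)

lemma tdeg_eq_0_iff: "tdeg u = 0 \<longleftrightarrow> u = 0"
  by (auto simp: tdeg_def intro: poly_mapping_eqI)

lemma monom_eval_unit_mon: "monom_eval x (unit_mon i) = x i"
  by (simp add: monom_eval_def)

text \<open>The multinomial coefficient of \<open>u\<close> when \<open>tdeg u = d\<close>; junk otherwise.\<close>

fun multi :: "nat \<Rightarrow> ('n::finite \<Rightarrow>\<^sub>0 nat) \<Rightarrow> nat" where
  "multi 0 u = 1"
| "multi (Suc d) u = (\<Sum>i\<in>{i. Poly_Mapping.lookup u i > 0}. multi d (u - unit_mon i))"

lemma multi_pos: "tdeg u = d \<Longrightarrow> multi d u > 0"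
proof (induction d arbitrary: u)
  case (Suc d)
  have "\<exists>i. Poly_Mapping.lookup u i > 0"
  proof (rule ccontr)
    assume "\<not> ?thesis"
    then have "tdeg u = 0" by (simp add: tdeg_def)
    then show False using Suc.prems by simp
  qed
  then obtain i where i: "Poly_Mapping.lookup u i > 0" by blast
  have "tdeg (u - unit_mon i) = d"
    using Suc.prems tdeg_unit_mon_add[of i "u - unit_mon i"] unit_mon_add_minus[OF i] by simp
  then have "multi d (u - unit_mon i) > 0" by (rule Suc.IH)
  moreover have "multi d (u - unit_mon i) \<le> multi (Suc d) u"
    using member_le_sum[of i "{i. Poly_Mapping.lookup u i > 0}" "\<lambda>i. multi d (u - unit_mon i)"] i by simp
  ultimately show ?case by simp
qed simp

text \<open>The multinomial theorem. Splitting one linear factor off the power lowers one exponent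
  of \<open>u\<close>, which is the recursion of \<open>multi\<close>.\<close>

lemma lookup_linear_form_power:
  "Poly_Mapping.lookup (linear_form v ^ d) u =
    (if tdeg u = d then of_nat (multi d u) * vmon v u else 0)"
proof (induction d arbitrary: u)
  case 0
  show ?case by (auto simp: lookup_one when_def tdeg_eq_0_iff monom_eval_def)
next
  case (Suc d)
  let ?L = "linear_form v ^ d"
  have summand: "Poly_Mapping.lookup (Poly_Mapping.single (unit_mon i) (v $ i) * ?L) u =
      (if Poly_Mapping.lookup u i > 0 then v $ i * Poly_Mapping.lookup ?L (u - unit_mon i) else 0)" for i
  proof (cases "Poly_Mapping.lookup u i > 0")
    case True
    then show ?thesis
      using lookup_single_mult_add[of "unit_mon i" "v $ i" ?L "u - unit_mon i"] unit_mon_add_minus[OF True] by simp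
  next
    case False
    then have "u \<noteq> unit_mon i + w" for w by (auto simp: lookup_add)
    then have "Poly_Mapping.lookup (Poly_Mapping.single (unit_mon i) (v $ i) * ?L) u = 0"
      by (rule lookup_single_mult_other)
    then show ?thesis using False by simp
  qed
  have "Poly_Mapping.lookup (linear_form v ^ Suc d) u =
      (\<Sum>i\<in>UNIV. Poly_Mapping.lookup (Poly_Mapping.single (unit_mon i) (v $ i) * ?L) u)"
    by (simp add: linear_form_def sum_distrib_right lookup_sum)
  also have "\<dots> = (\<Sum>i\<in>{i. Poly_Mapping.lookup u i > 0}. v $ i * Poly_Mapping.lookup ?L (u - unit_mon i))"
    unfolding summand by (simp add: sum.If_cases)
  also have "\<dots> = (\<Sum>i\<in>{i. Poly_Mapping.lookup u i > 0}.
      if tdeg u = Suc d then of_nat (multi d (u - unit_mon i)) * vmon v u else 0)"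
  proof (rule sum.cong[OF refl])
    fix i assume "i \<in> {i. Poly_Mapping.lookup u i > 0}"
    then have u: "u = unit_mon i + (u - unit_mon i)" by (intro unit_mon_add_minus) simp
    have "tdeg u = Suc (tdeg (u - unit_mon i))" by (subst u) (rule tdeg_unit_mon_add)
    moreover have "vmon v u = v $ i * vmon v (u - unit_mon i)"
      by (subst u) (simp only: monom_eval_add monom_eval_unit_mon)
    ultimately show "v $ i * Poly_Mapping.lookup ?L (u - unit_mon i) =
        (if tdeg u = Suc d then of_nat (multi d (u - unit_mon i)) * vmon v u else 0)"
      by (simp add: Suc.IH)
  qed
  also have "\<dots> = (if tdeg u = Suc d then of_nat (multi (Suc d) u) * vmon v u else 0)"
    by (simp add: sum_distrib_right)
  finally show ?case .
qed

text \<open>Division by the multinomial coefficients turns the coefficients of a power of a linear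
  form into plain monomials in its coordinates, and so a power sum into a combination of point
  evaluations.\<close>

definition coef :: "nat \<Rightarrow> 'n::finite cpoly \<Rightarrow> ('n \<Rightarrow>\<^sub>0 nat) \<Rightarrow> complex" where
  "coef d T u = Poly_Mapping.lookup T u / of_nat (multi d u)"

lemma power_sum_eq_iff:
  assumes "is_form d T"
  shows "T = (\<Sum>i\<in>I. cscale (c i) (linear_form (v i) ^ d)) \<longleftrightarrow>
    (\<forall>u. tdeg u = d \<longrightarrow> coef d T u = (\<Sum>i\<in>I. c i * vmon (v i) u))"
    (is "T = ?S \<longleftrightarrow> _")
proof -
  have S: "Poly_Mapping.lookup ?S u = (if tdeg u = d then of_nat (multi d u) * (\<Sum>i\<in>I. c i * vmon (v i) u) else 0)" for u
    by (simp add: lookup_sum lookup_linear_form_power sum_distrib_left mult_ac)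
  have T: "Poly_Mapping.lookup T u = 0" if "tdeg u \<noteq> d" for u
    using assms that by (auto simp: is_form_def tdeg_def in_keys_iff)
  have "T = ?S \<longleftrightarrow> (\<forall>u. Poly_Mapping.lookup T u = Poly_Mapping.lookup ?S u)"
    by (simp only: poly_mapping_eq_iff fun_eq_iff)
  also have "\<dots> \<longleftrightarrow> (\<forall>u. tdeg u = d \<longrightarrow> coef d T u = (\<Sum>i\<in>I. c i * vmon (v i) u))"
  proof (intro all_cong1)
    fix u
    show "Poly_Mapping.lookup T u = Poly_Mapping.lookup ?S u \<longleftrightarrow>
        (tdeg u = d \<longrightarrow> coef d T u = (\<Sum>i\<in>I. c i * vmon (v i) u))"
    proof (cases "tdeg u = d")
      case True
      then have "complex_of_nat (multi d u) \<noteq> 0" using multi_pos[OF True] by simp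
      then show ?thesis using True by (simp add: S coef_def divide_eq_eq mult.commute)
    qed (use S T in simp)
  qed
  finally show ?thesis .
qed

lemma monom_eval_scale:
  "vmon (c *s v) u = c ^ tdeg u * vmon v (u :: 'n::finite \<Rightarrow>\<^sub>0 nat)"
  by (simp add: monom_eval_superset[of UNIV] power_mult_distrib prod.distrib tdeg_def power_sum)

lemma finite_tdeg: "finite {u :: 'n::finite \<Rightarrow>\<^sub>0 nat. tdeg u = d}"
proof (induction d)
  case (Suc d)
  have "{u :: 'n \<Rightarrow>\<^sub>0 nat. tdeg u = Suc d} \<subseteq> (\<lambda>(i, u). unit_mon i + u) ` (UNIV \<times> {u. tdeg u = d})"
  proof
    fix u :: "'n \<Rightarrow>\<^sub>0 nat" assume u: "u \<in> {u. tdeg u = Suc d}"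
    have "\<exists>i. Poly_Mapping.lookup u i > 0"
    proof (rule ccontr)
      assume "\<not> ?thesis"
      then have "tdeg u = 0" by (simp add: tdeg_def)
      then show False using u by simp
    qed
    then obtain i where i: "Poly_Mapping.lookup u i > 0" by blast
    have "u = unit_mon i + (u - unit_mon i)" by (rule unit_mon_add_minus[OF i])
    moreover from this have "tdeg (u - unit_mon i) = d" using u tdeg_unit_mon_add[of i "u - unit_mon i"] by simp
    ultimately show "u \<in> (\<lambda>(i, u). unit_mon i + u) ` (UNIV \<times> {u. tdeg u = d})"
      by (intro image_eqI[of _ _ "(i, u - unit_mon i)"]) auto
  qed
  then show ?case by (rule finite_subset) (simp add: Suc)
qed (simp add: tdeg_eq_0_iff)

section \<open>Representatives and decompositions\<close>

definition rep_vec :: "'n::finite proj_space \<Rightarrow> complex ^ 'n" where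
  "rep_vec P = (SOME v. v \<in> reps P)"

definition pt_of :: "complex ^ 'n::finite \<Rightarrow> 'n proj_space" where
  "pt_of v = Abs_proj_space (vec.span {v})"

lemma rep_vec_reps: "rep_vec P \<in> reps P"
  unfolding rep_vec_def using reps_nonempty[of P] by (simp add: some_in_eq)

lemma rep_vec_nz: "rep_vec P \<noteq> 0"
  using rep_vec_reps[of P] by (simp add: reps_def)

lemma Rep_pt_of:
  assumes "v \<noteq> 0"
  shows "Rep_proj_space (pt_of v) = vec.span {v}"
  unfolding pt_of_def
proof (rule Abs_proj_space_inverse)
  have "vec.independent {v}" using assms by simp
  then have "vec.dim (vec.span {v}) = card {v}" by (rule vec.dim_span_eq_card_independent)
  then show "vec.span {v} \<in> {V. vec.subspace V \<and> vec.dim V = 1}" by simp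
qed

lemma pt_of_reps: "v \<noteq> 0 \<Longrightarrow> v \<in> reps (pt_of v)"
  by (simp add: reps_def Rep_pt_of vec.span_base)

lemma reps_eq:
  assumes "v \<in> reps P"
  shows "Rep_proj_space P = vec.span {v}"
proof -
  have V: "vec.subspace (Rep_proj_space P)" using Rep_proj_space[of P] by blast
  have "vec.span {v} \<subseteq> Rep_proj_space P"
    using assms V by (intro vec.span_minimal) (auto simp: reps_def)
  moreover have "Rep_proj_space P \<subseteq> vec.span {v}"
  proof
    fix w assume w: "w \<in> Rep_proj_space P"
    show "w \<in> vec.span {v}"
    proof (cases "w = 0")
      case False
      then have "w \<in> reps P" using w by (simp add: reps_def)
      then obtain c where "w = c *s v" using reps_scaling[OF assms] by metis
      then show ?thesis by (auto simp: vec.span_singleton)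
    qed (simp add: vec.span_zero)
  qed
  ultimately show ?thesis by blast
qed

lemma pt_of_eq: "v \<in> reps P \<Longrightarrow> pt_of v = P"
  by (metis Rep_proj_space_inject Rep_pt_of reps_eq reps_def DiffE singletonI)

lemma pt_of_rep_vec [simp]: "pt_of (rep_vec P) = P"
  by (rule pt_of_eq[OF rep_vec_reps])

lemma reps_scale: "v \<in> reps P \<Longrightarrow> c \<noteq> 0 \<Longrightarrow> c *s v \<in> reps P"
  using Rep_proj_space[of P] by (auto simp: reps_def vec.subspace_scale)

lemma reps_scale_iff:
  assumes "v \<in> reps P"
  shows "w \<in> reps P \<longleftrightarrow> (\<exists>c. c \<noteq> 0 \<and> w = c *s v)"
proof
  assume w: "w \<in> reps P"
  then obtain c where c: "w = c *s v" using reps_scaling[OF assms] by metis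
  moreover have "w \<noteq> 0" using w by (simp add: reps_def)
  ultimately show "\<exists>c. c \<noteq> 0 \<and> w = c *s v" by (intro exI[of _ c]) auto
qed (use assms reps_scale in auto)

lemma linear_form_scale_power:
  "linear_form (c *s v) ^ d = cscale (c ^ d) (linear_form v ^ d)"
  by (rule poly_mapping_eqI) (simp add: lookup_linear_form_power monom_eval_scale del: vector_smult_component)

lemma veronese_eq:
  assumes "v \<in> reps P"
  shows "veronese d P = cpoly.span {linear_form v ^ d}"
proof (rule subset_antisym)
  show "veronese d P \<subseteq> cpoly.span {linear_form v ^ d}"
    unfolding veronese_def
  proof (rule cpoly.span_minimal[OF _ cpoly.subspace_span], rule image_subsetI)
    fix w assume "w \<in> reps P"
    then obtain c where "w = c *s v" using reps_scaling[OF assms] by metis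
    then show "linear_form w ^ d \<in> cpoly.span {linear_form v ^ d}"
      by (auto simp: linear_form_scale_power intro: cpoly.span_scale cpoly.span_base)
  qed
  show "cpoly.span {linear_form v ^ d} \<subseteq> veronese d P"
    unfolding veronese_def using assms by (intro cpoly.span_mono) auto
qed

lemma in_veronese_span_iff:
  assumes "finite A"
  shows "T \<in> veronese_span d A \<longleftrightarrow> (\<exists>c. T = (\<Sum>P\<in>A. cscale (c P) (linear_form (rep_vec P) ^ d)))"
proof
  have "(\<Sum>P\<in>A. cscale (c P) (linear_form (rep_vec P) ^ d)) \<in> veronese_span d A" for c
    unfolding veronese_span_def
    by (intro cpoly.span_sum cpoly.span_scale cpoly.span_base UN_I)
      (auto simp: veronese_eq[OF rep_vec_reps] intro: cpoly.span_base)
  then show "\<exists>c. T = (\<Sum>P\<in>A. cscale (c P) (linear_form (rep_vec P) ^ d)) \<Longrightarrow> T \<in> veronese_span d A" by auto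
next
  assume "T \<in> veronese_span d A"
  then show "\<exists>c. T = (\<Sum>P\<in>A. cscale (c P) (linear_form (rep_vec P) ^ d))"
    unfolding veronese_span_def
  proof (induction rule: cpoly.span_induct_alt)
    case base
    show ?case by (rule exI[of _ "\<lambda>_. 0"]) simp
  next
    case (step k x y)
    then obtain c where c: "y = (\<Sum>P\<in>A. cscale (c P) (linear_form (rep_vec P) ^ d))" by blast
    obtain Q where Q: "Q \<in> A" "x \<in> veronese d Q" using step by blast
    then obtain e where e: "x = cscale e (linear_form (rep_vec Q) ^ d)"
      by (auto simp: veronese_eq[OF rep_vec_reps] cpoly.span_singleton)
    have "cscale k x + y = (\<Sum>P\<in>A. cscale ((if P = Q then k * e else 0) + c P) (linear_form (rep_vec P) ^ d))"
      using assms Q by (simp add: c e cpoly.scale_left_distrib sum.distrib if_distrib[of "\<lambda>x. cscale x _"] sum.delta cong: if_cong)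
    then show ?case by (intro exI[of _ "\<lambda>P. (if P = Q then k * e else 0) + c P"])
  qed
qed

lemma decomposition_iff:
  "decomposition d T A \<longleftrightarrow> finite A \<and> (\<exists>c. T = (\<Sum>P\<in>A. cscale (c P) (linear_form (rep_vec P) ^ d)))"
  using in_veronese_span_iff by (auto simp: decomposition_def)

lemma decomposition_image_pt_of:
  assumes "finite I" "\<And>i. i \<in> I \<Longrightarrow> v i \<noteq> 0" "T = (\<Sum>i\<in>I. cscale (c i) (linear_form (v i) ^ d))"
  shows "decomposition d T ((\<lambda>i. pt_of (v i)) ` I)"
proof -
  have "T \<in> veronese_span d ((\<lambda>i. pt_of (v i)) ` I)"
    unfolding assms(3) veronese_span_def
  proof (intro cpoly.span_sum cpoly.span_scale cpoly.span_base)
    fix i assume i: "i \<in> I"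
    then have "linear_form (v i) ^ d \<in> veronese d (pt_of (v i))"
      unfolding veronese_def using pt_of_reps assms(2) by (blast intro: cpoly.span_base)
    then show "linear_form (v i) ^ d \<in> (\<Union>P\<in>(\<lambda>i. pt_of (v i)) ` I. veronese d P)" using i by auto
  qed
  then show ?thesis using assms(1) by (simp add: decomposition_def)
qed

lemma form_rank_le: "decomposition d T B \<Longrightarrow> form_rank d T \<le> card B"
  unfolding form_rank_def by (rule Least_le) blast

text \<open>A vanishing coefficient would leave a decomposition with one point fewer than the
  rank.\<close>

lemma minimal_coefficient_nz:
  assumes "finite B" "T = (\<Sum>P\<in>B. cscale (c P) (linear_form (rep_vec P) ^ d))"
    "form_rank d T = card B" "Q \<in> B"
  shows "c Q \<noteq> 0"
proof
  assume "c Q = 0"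
  then have "T = (\<Sum>P\<in>B - {Q}. cscale (c P) (linear_form (rep_vec P) ^ d))"
    using assms by (simp add: sum.remove)
  then have "decomposition d T (B - {Q})" using assms(1) by (auto simp: decomposition_iff)
  then have "card B \<le> card (B - {Q})" using form_rank_le assms(3) by metis
  moreover have "card B > 0" using assms by (auto simp: card_gt_0_iff)
  ultimately show False using assms(1,4) by simp
qed

section \<open>Independent rows and minors\<close>

definition indep_rows :: "nat \<Rightarrow> 'u set \<Rightarrow> (nat \<Rightarrow> 'u \<Rightarrow> complex) \<Rightarrow> bool" where
  "indep_rows N U f \<longleftrightarrow> (\<forall>c. (\<forall>u\<in>U. (\<Sum>i<N. c i * f i u) = 0) \<longrightarrow> (\<forall>i<N. c i = 0))"

definition minor :: "nat \<Rightarrow> (nat \<Rightarrow> 'u \<Rightarrow> complex) \<Rightarrow> (nat \<Rightarrow> 'u) \<Rightarrow> complex" where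
  "minor N f us = Determinant.det (Matrix.mat N N (\<lambda>(i, k). f i (us k)))"

lemma minor_eq_0_iff_columns:
  "minor N f us = 0 \<longleftrightarrow> (\<exists>w. (\<exists>k<N. w k \<noteq> 0) \<and> (\<forall>i<N. (\<Sum>k<N. f i (us k) * w k) = 0))"
proof -
  let ?M = "Matrix.mat N N (\<lambda>(i, k). f i (us k))"
  have M: "?M \<in> carrier_mat N N" by simp
  have "minor N f us = 0 \<longleftrightarrow> (\<exists>v. v \<in> carrier_vec N \<and> v \<noteq> 0\<^sub>v N \<and> ?M *\<^sub>v v = 0\<^sub>v N)"
    unfolding minor_def by (rule det_0_iff_vec_prod_zero[OF M])
  also have "\<dots> \<longleftrightarrow> (\<exists>w. (\<exists>k<N. w k \<noteq> 0) \<and> (\<forall>i<N. (\<Sum>k<N. f i (us k) * w k) = 0))"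
  proof
    assume "\<exists>v. v \<in> carrier_vec N \<and> v \<noteq> 0\<^sub>v N \<and> ?M *\<^sub>v v = 0\<^sub>v N"
    then obtain v where v: "v \<in> carrier_vec N" "v \<noteq> 0\<^sub>v N" "?M *\<^sub>v v = 0\<^sub>v N" by blast
    have "(\<Sum>k<N. f i (us k) * vec_index v k) = 0" if i: "i < N" for i
    proof -
      have "vec_index (?M *\<^sub>v v) i = 0" using v(3) i by simp
      then show ?thesis using v(1) i by (simp add: scalar_prod_def lessThan_atLeast0)
    qed
    moreover have "\<exists>k<N. vec_index v k \<noteq> 0"
    proof (rule ccontr)
      assume "\<not> ?thesis"
      then have "v = 0\<^sub>v N" using v(1) by (intro eq_vecI) auto
      then show False using v(2) by blast
    qed
    ultimately show "\<exists>w. (\<exists>k<N. w k \<noteq> 0) \<and> (\<forall>i<N. (\<Sum>k<N. f i (us k) * w k) = 0)"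
      by (intro exI[of _ "vec_index v"]) blast
  next
    assume "\<exists>w. (\<exists>k<N. w k \<noteq> 0) \<and> (\<forall>i<N. (\<Sum>k<N. f i (us k) * w k) = 0)"
    then obtain w k where w: "k < N" "w k \<noteq> 0" "\<And>i. i < N \<Longrightarrow> (\<Sum>k<N. f i (us k) * w k) = 0" by blast
    let ?v = "Matrix.vec N w"
    have "?v \<noteq> 0\<^sub>v N"
    proof
      assume "?v = 0\<^sub>v N"
      then have "vec_index ?v k = 0" using w(1) by simp
      then show False using w by simp
    qed
    moreover have "?M *\<^sub>v ?v = 0\<^sub>v N"
      using w(3) by (intro eq_vecI) (simp_all add: scalar_prod_def lessThan_atLeast0)
    ultimately show "\<exists>v. v \<in> carrier_vec N \<and> v \<noteq> 0\<^sub>v N \<and> ?M *\<^sub>v v = 0\<^sub>v N"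
      by (intro exI[of _ ?v]) simp
  qed
  finally show ?thesis .
qed

lemma minor_eq_0_iff_rows:
  "minor N f us = 0 \<longleftrightarrow> (\<exists>c. (\<exists>i<N. c i \<noteq> 0) \<and> (\<forall>k<N. (\<Sum>i<N. c i * f i (us k)) = 0))"
proof -
  let ?M = "Matrix.mat N N (\<lambda>(i, k). f i (us k))"
  have "Determinant.det (transpose_mat ?M) = Determinant.det ?M"
    by (rule det_transpose[of _ N]) simp
  moreover have "transpose_mat ?M = Matrix.mat N N (\<lambda>(i, k). f k (us i))"
    by (rule eq_matI) auto
  ultimately have "minor N f us = minor N (\<lambda>i k. f k (us i)) (\<lambda>k. k)" by (simp add: minor_def)
  then show ?thesis
    using minor_eq_0_iff_columns[of N "\<lambda>i k. f k (us i)" "\<lambda>k. k"] by (simp add: mult.commute)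
qed

lemma indep_rows_if_minor:
  assumes "minor N f us \<noteq> 0" "\<And>k. k < N \<Longrightarrow> us k \<in> U"
  shows "indep_rows N U f"
  unfolding indep_rows_def
proof (intro allI impI, rule ccontr)
  fix c i assume c: "\<forall>u\<in>U. (\<Sum>i<N. c i * f i u) = 0" and i: "i < N" "c i \<noteq> 0"
  have "\<exists>c. (\<exists>i<N. c i \<noteq> 0) \<and> (\<forall>k<N. (\<Sum>i<N. c i * f i (us k)) = 0)"
    using c i assms(2) by (intro exI[of _ c]) blast
  then show False using assms(1) minor_eq_0_iff_rows[of N f us] by blast
qed

text \<open>Row rank equals column rank. Interpolation nodes for the span of the rows serve as
  columns: a kernel vector of the square matrix would be orthogonal to every row, hence to the dual
  function at each node, hence 0.\<close>

lemma minor_if_indep_rows: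
  assumes "indep_rows N U f" "finite U"
  obtains us where "\<And>k. k < N \<Longrightarrow> us k \<in> U" "minor N f us \<noteq> 0"
proof -
  define g where "g i u = (if u \<in> U then f i u else 0)" for i u
  have ind: "c i = 0" if "\<And>u. (\<Sum>i<N. c i * g i u) = 0" "i < N" for c i
  proof -
    have "(\<Sum>i<N. c i * f i u) = 0" if "u \<in> U" for u
      using that \<open>\<And>u. (\<Sum>i<N. c i * g i u) = 0\<close>[of u] by (simp add: g_def)
    then show ?thesis using assms(1) \<open>i < N\<close> unfolding indep_rows_def by blast
  qed
  have inj: "inj_on g {..<N}"
  proof (rule inj_onI, rule ccontr)
    fix i j assume ij: "i \<in> {..<N}" "j \<in> {..<N}" "g i = g j" "i \<noteq> j"
    let ?c = "\<lambda>k. (if k = i then 1 else 0) - (if k = j then 1 else 0) :: complex"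
    have "(\<Sum>k<N. ?c k * g k u) = (\<Sum>k<N. if k = i then g k u else 0) - (\<Sum>k<N. if k = j then g k u else 0)" for u
      unfolding sum_subtractf[symmetric] by (intro sum.cong) auto
    then have "(\<Sum>k<N. ?c k * g k u) = 0" for u using ij by simp
    then have "?c i = 0" using ij(1) ind[of ?c i] by simp
    then show False using ij(4) by simp
  qed
  have indep: "fs.independent (g ` {..<N})"
  proof
    assume dep: "fs.dependent (g ` {..<N})"
    have "finite (g ` {..<N})" by simp
    then have "\<exists>k. (\<exists>v\<in>g ` {..<N}. k v \<noteq> 0) \<and> (\<Sum>v\<in>g ` {..<N}. fscale (k v) v) = 0"
      using dep by (rule iffD1[OF fs.dependent_finite])
    then obtain k where k: "\<exists>v\<in>g ` {..<N}. k v \<noteq> 0" "(\<Sum>v\<in>g ` {..<N}. fscale (k v) v) = 0"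
      by (elim exE conjE)
    have "(\<Sum>i<N. fscale (k (g i)) (g i)) = 0" using k(2) by (simp add: sum.reindex[OF inj])
    then have z: "(\<Sum>i<N. k (g i) * g i u) = 0" for u
      using sum_fun_apply[of "\<lambda>i. fscale (k (g i)) (g i)" "{..<N}" u] by (simp add: fscale_def)
    have "k (g i) = 0" if "i < N" for i by (rule ind[of "\<lambda>i. k (g i)", OF z that])
    then show False using k(1) by auto
  qed
  have zero_out: "h u = 0" if "h \<in> fs.span (g ` {..<N})" "u \<notin> U" for h u
    by (rule span_vanish[OF that(1)]) (use that(2) in \<open>auto simp: g_def\<close>)
  have faithful: "h = 0" if h: "h \<in> fs.span (g ` {..<N})" "\<And>u. u \<in> U \<Longrightarrow> h u = 0" for h
  proof
    fix u show "h u = 0 u" using h zero_out[OF h(1)] by (cases "u \<in> U") auto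
  qed
  have "\<exists>V\<subseteq>U. card V = card (g ` {..<N}) \<and>
    (\<forall>P\<in>V. \<exists>f\<in>fs.span (g ` {..<N}). f P = 1 \<and> (\<forall>Q\<in>V - {P}. f Q = 0))"
    by (rule exists_interpolation_set[OF _ indep assms(2) faithful]) auto
  then obtain V where V: "V \<subseteq> U" "card V = card (g ` {..<N})"
    "\<forall>P\<in>V. \<exists>f\<in>fs.span (g ` {..<N}). f P = 1 \<and> (\<forall>Q\<in>V - {P}. f Q = 0)" by blast
  have cV: "card V = card {..<N}" using V(2) card_image[OF inj] by simp
  have finV: "finite V" using V(1) assms(2) finite_subset by blast
  obtain us where us: "bij_betw us {..<N} V"
    using finite_same_card_bij[OF _ finV cV[symmetric]] by auto
  show thesis
  proof (rule that[of us])
    show "us k \<in> U" if "k < N" for k using us V(1) that by (auto simp: bij_betw_def)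
    show "minor N f us \<noteq> 0"
    proof
      assume "minor N f us = 0"
      then obtain w where w: "\<exists>k<N. w k \<noteq> 0" "\<And>i. i < N \<Longrightarrow> (\<Sum>k<N. f i (us k) * w k) = 0"
        unfolding minor_eq_0_iff_columns by blast
      then obtain k where k: "k < N" "w k \<noteq> 0" by blast
      define w' where "w' u = w (the_inv_into {..<N} us u)" for u
      have w': "w' (us k) = w k" if "k < N" for k
        using that us by (simp add: w'_def bij_betw_def the_inv_into_f_f)
      have re: "(\<Sum>u\<in>V. w' u * h u) = (\<Sum>k<N. w k * h (us k))" for h
      proof -
        have "(\<Sum>u\<in>V. w' u * h u) = (\<Sum>k<N. w' (us k) * h (us k))"
          by (rule sum.reindex_bij_betw[OF us, symmetric])
        then show ?thesis using w' by simp
      qed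
      have usk: "us k \<in> V" using us k(1) by (auto simp: bij_betw_def)
      then obtain h where h: "h \<in> fs.span (g ` {..<N})" "h (us k) = 1" "\<forall>Q\<in>V - {us k}. h Q = 0"
        using V(3) by blast
      have "(\<Sum>u\<in>V. w' u * h u) = 0"
      proof (rule span_weighted_sum_zero[OF h(1)])
        fix x assume "x \<in> g ` {..<N}"
        then obtain i where i: "i < N" "x = g i" by auto
        have "us k \<in> U" if "k < N" for k using us V(1) that by (auto simp: bij_betw_def)
        then show "(\<Sum>u\<in>V. w' u * x u) = 0"
          using w(2)[OF i(1)] unfolding re i(2) by (simp add: g_def mult.commute)
      qed
      moreover have "(\<Sum>u\<in>V. w' u * h u) = (\<Sum>u\<in>V. if u = us k then w' u else 0)"
        using h(2,3) by (intro sum.cong) auto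
      ultimately show False using usk finV w'[OF k(1)] k(2) by simp
    qed
  qed
qed

section \<open>Open conditions on tuples of points\<close>

definition shift_mon :: "nat \<Rightarrow> ('n::finite \<Rightarrow>\<^sub>0 nat) \<Rightarrow> (nat \<times> 'n) \<Rightarrow>\<^sub>0 nat" where
  "shift_mon i u = (\<Sum>j\<in>UNIV. Poly_Mapping.single (i, j) (Poly_Mapping.lookup u j))"

lemma lookup_shift_mon:
  "Poly_Mapping.lookup (shift_mon i u) (i', j) = (if i' = i then Poly_Mapping.lookup u j else 0)"
proof -
  have "Poly_Mapping.lookup (shift_mon i u) (i', j) =
      (\<Sum>k\<in>UNIV. if k = j then (if i' = i then Poly_Mapping.lookup u k else 0) else 0)"
    unfolding shift_mon_def lookup_sum by (intro sum.cong) (auto simp: lookup_single when_def)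
  then show ?thesis by simp
qed

lemma keys_shift_mon: "Poly_Mapping.keys (shift_mon i u) \<subseteq> {i} \<times> UNIV"
  by (auto simp: in_keys_iff lookup_shift_mon split: if_splits)

lemma monom_eval_shift_mon:
  "monom_eval (\<lambda>(i, j). v i $ j) (shift_mon i u) = vmon (v i) u"
proof -
  have e: "{i} \<times> UNIV = Pair i ` UNIV" by auto
  have "monom_eval (\<lambda>(i, j). v i $ j) (shift_mon i u) =
      (\<Prod>p\<in>{i} \<times> UNIV. (case p of (i, j) \<Rightarrow> v i $ j) ^ Poly_Mapping.lookup (shift_mon i u) p)"
    by (rule monom_eval_superset) (simp, rule keys_shift_mon)
  also have "\<dots> = (\<Prod>j\<in>UNIV. v i $ j ^ Poly_Mapping.lookup u j)"
    unfolding e by (subst prod.reindex) (simp_all add: inj_on_def lookup_shift_mon)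
  also have "\<dots> = vmon (v i) u"
    by (rule monom_eval_superset[symmetric]) auto
  finally show ?thesis .
qed

text \<open>Rows from \<open>r\<close> on are all equal to \<open>\<tau>\<close>; only \<open>N = r\<close> and \<open>N = r + 1\<close> rows are ever used.\<close>

definition point_rows :: "nat \<Rightarrow> (('n::finite \<Rightarrow>\<^sub>0 nat) \<Rightarrow> complex) \<Rightarrow> (nat \<Rightarrow> complex ^ 'n) \<Rightarrow> nat \<Rightarrow> ('n \<Rightarrow>\<^sub>0 nat) \<Rightarrow> complex" where
  "point_rows r \<tau> v i u = (if i < r then vmon (v i) u else \<tau> u)"

text \<open>The Leibniz expansion with the coordinates of the points as variables. When the columns
  are monomials of degree \<open>d\<close>, it has degree \<open>d\<close> in each point; the rows
  from \<open>r\<close> on contribute constants.\<close>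

definition minor_poly :: "nat \<Rightarrow> nat \<Rightarrow> (('n::finite \<Rightarrow>\<^sub>0 nat) \<Rightarrow> complex) \<Rightarrow> (nat \<Rightarrow> ('n \<Rightarrow>\<^sub>0 nat)) \<Rightarrow> (nat \<times> 'n) cpoly" where
  "minor_poly r N \<tau> us = (\<Sum>p\<in>{p. p permutes {0..<N}}.
     Poly_Mapping.single (\<Sum>i<r. shift_mon i (us (p i))) (signof p * (\<Prod>i\<in>{r..<N}. \<tau> (us (p i)))))"

lemma monom_eval_sum: "finite I \<Longrightarrow> monom_eval x (sum f I) = (\<Prod>i\<in>I. monom_eval x (f i))"
  by (induction rule: finite_induct) (simp_all add: monom_eval_add, simp add: monom_eval_def)

lemma eval_minor_poly:
  assumes "r \<le> N"
  shows "cpoly_eval (\<lambda>(i, j). v i $ j) (minor_poly r N \<tau> us) = minor N (point_rows r \<tau> v) us"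
proof -
  have split: "{0..<N} = {..<r} \<union> {r..<N}" using assms by auto
  have "minor N (point_rows r \<tau> v) us =
      (\<Sum>p\<in>{p. p permutes {0..<N}}. signof p * (\<Prod>i=0..<N. point_rows r \<tau> v i (us (p i))))"
    unfolding minor_def
  proof (subst det_def'[of _ N], simp, rule sum.cong[OF refl])
    fix p assume "p \<in> {p. p permutes {0..<N}}"
    then have "p i < N" if "i < N" for i using permutes_in_image[of p "{0..<N}" i] that by simp
    then show "signof p * (\<Prod>i=0..<N. Matrix.mat N N (\<lambda>(i, k). point_rows r \<tau> v i (us k)) $$ (i, p i)) =
        signof p * (\<Prod>i=0..<N. point_rows r \<tau> v i (us (p i)))" by simp
  qed
  also have "\<dots> = cpoly_eval (\<lambda>(i, j). v i $ j) (minor_poly r N \<tau> us)"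
    unfolding minor_poly_def cpoly_eval_sum cpoly_eval_single
  proof (rule sum.cong[OF refl])
    fix p
    have "(\<Prod>i=0..<N. point_rows r \<tau> v i (us (p i))) =
        (\<Prod>i<r. point_rows r \<tau> v i (us (p i))) * (\<Prod>i\<in>{r..<N}. point_rows r \<tau> v i (us (p i)))"
      unfolding split by (rule prod.union_disjoint) auto
    also have "(\<Prod>i<r. point_rows r \<tau> v i (us (p i))) = (\<Prod>i<r. vmon (v i) (us (p i)))"
      by (intro prod.cong) (auto simp: point_rows_def)
    also have "(\<Prod>i\<in>{r..<N}. point_rows r \<tau> v i (us (p i))) = (\<Prod>i\<in>{r..<N}. \<tau> (us (p i)))"
      by (intro prod.cong) (auto simp: point_rows_def)
    finally show "signof p * (\<Prod>i=0..<N. point_rows r \<tau> v i (us (p i))) =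
        signof p * (\<Prod>i\<in>{r..<N}. \<tau> (us (p i))) *
        monom_eval (\<lambda>(i, j). v i $ j) (\<Sum>i<r. shift_mon i (us (p i)))"
      by (simp add: monom_eval_sum monom_eval_shift_mon mult_ac)
  qed
  finally show ?thesis by simp
qed

lemma multihomogeneous_minor_poly:
  assumes "r \<le> N" "\<And>k. k < N \<Longrightarrow> tdeg (us k) = d"
  shows "multihomogeneous r (minor_poly r N \<tau> us)"
  unfolding multihomogeneous_def
proof (intro exI[of _ "\<lambda>_. d"] ballI)
  fix u assume "u \<in> Poly_Mapping.keys (minor_poly r N \<tau> us)"
  then have "u \<in> (\<Union>p\<in>{p. p permutes {0..<N}}. Poly_Mapping.keys
      (Poly_Mapping.single (\<Sum>i<r. shift_mon i (us (p i))) (signof p * (\<Prod>i\<in>{r..<N}. \<tau> (us (p i))))))"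
    unfolding minor_poly_def by (rule subsetD[OF keys_sum])
  then obtain p where "p \<in> {p. p permutes {0..<N}}" "u \<in> Poly_Mapping.keys
      (Poly_Mapping.single (\<Sum>i<r. shift_mon i (us (p i))) (signof p * (\<Prod>i\<in>{r..<N}. \<tau> (us (p i)))))"
    by (rule UN_E)
  then have p: "p permutes {0..<N}" "u = (\<Sum>i<r. shift_mon i (us (p i)))"
    by (simp_all add: keys_single split: if_splits)
  have l: "Poly_Mapping.lookup u (i, j) = (if i < r then Poly_Mapping.lookup (us (p i)) j else 0)" for i j
  proof -
    have "Poly_Mapping.lookup u (i, j) = (\<Sum>k<r. if k = i then Poly_Mapping.lookup (us (p k)) j else 0)"
      unfolding p(2) lookup_sum by (intro sum.cong) (auto simp: lookup_shift_mon)
    then show ?thesis by simp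
  qed
  have "fst ` Poly_Mapping.keys u \<subseteq> {..<r}"
    by (auto simp: in_keys_iff l split: if_splits)
  moreover have "(\<Sum>j\<in>UNIV. Poly_Mapping.lookup u (i, j)) = d" if "i < r" for i
  proof -
    have "p i < N" using p(1) that assms(1) permutes_in_image[OF p(1), of i] by simp
    then show ?thesis using assms(2)[of "p i"] that by (simp add: l tdeg_def)
  qed
  ultimately show "fst ` Poly_Mapping.keys u \<subseteq> {..<r} \<and> (\<forall>i<r. (\<Sum>j\<in>UNIV. Poly_Mapping.lookup u (i, j)) = d)"
    by blast
qed

text \<open>For \<open>N = r\<close> the \<open>d\<close>-th powers at the points are independent;
  for \<open>N = Suc r\<close> and \<open>\<tau> = coef d T\<close> the form \<open>T\<close> is
  moreover outside their span.\<close>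

definition indep_tuples :: "nat \<Rightarrow> nat \<Rightarrow> nat \<Rightarrow> (('n::finite \<Rightarrow>\<^sub>0 nat) \<Rightarrow> complex) \<Rightarrow> 'n proj_space list set" where
  "indep_tuples d r N \<tau> = {ps. length ps = r \<and>
     indep_rows N {u. tdeg u = d} (point_rows r \<tau> (\<lambda>i. rep_vec (ps ! i)))}"

text \<open>Independence means that some maximal minor is nonzero, and minors are multihomogeneous
  in the points, so the set is a union of basic open sets.\<close>

lemma open_indep_tuples:
  assumes "r \<le> N"
  shows "openin (zariski_prod r) (indep_tuples d r N \<tau> :: 'n::finite proj_space list set)"
proof -
  let ?US = "{us :: nat \<Rightarrow> ('n \<Rightarrow>\<^sub>0 nat). \<forall>k<N. tdeg (us k) = d}"
  let ?O = "\<lambda>us. {ps. length ps = r} - zero_locus r {minor_poly r N \<tau> us}"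
  have mem: "ps \<in> ?O us \<longleftrightarrow> length ps = r \<and> minor N (point_rows r \<tau> (\<lambda>i. rep_vec (ps ! i))) us \<noteq> 0"
    if "us \<in> ?US" for us ps
  proof -
    have "vanishes_at r (minor_poly r N \<tau> us) ps \<longleftrightarrow> minor N (point_rows r \<tau> (\<lambda>i. rep_vec (ps ! i))) us = 0"
      unfolding eval_minor_poly[OF assms, symmetric]
      using that by (intro vanishes_at_iff multihomogeneous_minor_poly[OF assms, of us d] rep_vec_reps) simp
    then show ?thesis by (auto simp: zero_locus_def)
  qed
  have "indep_tuples d r N \<tau> = (\<Union>us\<in>?US. ?O us)"
  proof (intro subset_antisym subsetI)
    fix ps :: "'n proj_space list" assume ps: "ps \<in> indep_tuples d r N \<tau>"
    then have "indep_rows N {u. tdeg u = d} (point_rows r \<tau> (\<lambda>i. rep_vec (ps ! i)))" by (simp add: indep_tuples_def)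
    then obtain us where us: "\<And>k. k < N \<Longrightarrow> us k \<in> {u. tdeg u = d}"
      "minor N (point_rows r \<tau> (\<lambda>i. rep_vec (ps ! i))) us \<noteq> 0"
      by (rule minor_if_indep_rows[OF _ finite_tdeg]) blast
    have "us \<in> ?US" using us(1) by blast
    moreover have "length ps = r" using ps by (simp add: indep_tuples_def)
    then have "ps \<in> ?O us" using mem[OF \<open>us \<in> ?US\<close>] us(2) by blast
    ultimately show "ps \<in> (\<Union>us\<in>?US. ?O us)" by blast
  next
    fix ps :: "'n proj_space list" assume "ps \<in> (\<Union>us\<in>?US. ?O us)"
    then obtain us where us: "us \<in> ?US" "ps \<in> ?O us" by blast
    then have m: "length ps = r" "minor N (point_rows r \<tau> (\<lambda>i. rep_vec (ps ! i))) us \<noteq> 0"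
      using mem[OF us(1), of ps] by blast+
    have "indep_rows N {u. tdeg u = d} (point_rows r \<tau> (\<lambda>i. rep_vec (ps ! i)))"
      by (rule indep_rows_if_minor[OF m(2)]) (use us(1) in simp)
    then show "ps \<in> indep_tuples d r N \<tau>" using m(1) by (simp add: indep_tuples_def)
  qed
  moreover have "openin (zariski_prod r) (\<Union>us\<in>?US. ?O us)"
  proof (intro openin_Union ballI, elim imageE)
    fix K us assume us: "us \<in> ?US" and K: "K = ?O us"
    show "openin (zariski_prod r) K"
      unfolding openin_zariski_prod K
      using multihomogeneous_minor_poly[OF assms, of us d] us by (intro exI[of _ "{minor_poly r N \<tau> us}"]) simp
  qed
  ultimately show ?thesis by simp
qed

lemma indep_tuples_perm:
  assumes "ps \<in> indep_tuples d r N \<tau>" "mset qs = mset ps" "r \<le> N"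
  shows "qs \<in> indep_tuples d r N \<tau>"
proof -
  have len: "length ps = r" "length qs = r"
    using assms mset_eq_length by (auto simp: indep_tuples_def)
  obtain \<pi> where \<pi>: "\<pi> permutes {..<r}" "permute_list \<pi> ps = qs"
    using mset_eq_permutation[OF assms(2)] len by auto
  have \<pi>N: "\<pi> permutes {..<N}" using permutes_subset[OF \<pi>(1)] assms(3) by auto
  have row: "point_rows r \<tau> (\<lambda>i. rep_vec (qs ! i)) i = point_rows r \<tau> (\<lambda>i. rep_vec (ps ! i)) (\<pi> i)" for i
  proof (cases "i < r")
    case True
    then have "qs ! i = ps ! \<pi> i" "\<pi> i < r"
      using \<pi> len permutes_in_image[OF \<pi>(1), of i] by (auto simp: permute_list_def)
    then show ?thesis using True by (auto simp: point_rows_def fun_eq_iff)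
  next
    case False
    then have "\<pi> i = i" using \<pi>(1) by (simp add: permutes_def)
    then show ?thesis using False by (auto simp: point_rows_def fun_eq_iff)
  qed
  have "indep_rows N {u. tdeg u = d} (point_rows r \<tau> (\<lambda>i. rep_vec (qs ! i)))"
    unfolding indep_rows_def
  proof (intro allI impI)
    fix c i assume c: "\<forall>u\<in>{u. tdeg u = d}. (\<Sum>i<N. c i * point_rows r \<tau> (\<lambda>i. rep_vec (qs ! i)) i u) = 0" and i: "i < N"
    define e where "e k = c (Hilbert_Choice.inv \<pi> k)" for k
    have e\<pi>: "e (\<pi> k) = c k" for k using permutes_inverses[OF \<pi>(1)] by (simp add: e_def)
    have "(\<Sum>i<N. e i * point_rows r \<tau> (\<lambda>i. rep_vec (ps ! i)) i u) = 0" if "tdeg u = d" for u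
    proof -
      have "(\<Sum>i<N. e i * point_rows r \<tau> (\<lambda>i. rep_vec (ps ! i)) i u) =
          (\<Sum>i<N. e (\<pi> i) * point_rows r \<tau> (\<lambda>i. rep_vec (ps ! i)) (\<pi> i) u)"
        by (rule sum.reindex_bij_betw[OF permutes_imp_bij[OF \<pi>N], symmetric])
      also have "\<dots> = 0" using c that by (simp add: e\<pi> row)
      finally show ?thesis .
    qed
    then have "\<forall>k<N. e k = 0" using assms(1) by (simp add: indep_tuples_def indep_rows_def)
    moreover have "\<pi> i < N" using permutes_in_image[OF \<pi>N, of i] i by simp
    ultimately show "c i = 0" using e\<pi>[of i] by simp
  qed
  then show ?thesis using len by (simp add: indep_tuples_def)
qed

text \<open>Independence ignores the order of the points, so the set of tuples is the full preimage
  of its image and openness passes to the quotient.\<close>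

lemma open_mset_indep_tuples:
  assumes "r \<le> N"
  shows "openin (zariski_sym r) (mset ` indep_tuples d r N \<tau>)"
proof -
  have "{ps. length ps = r \<and> mset ps \<in> mset ` indep_tuples d r N \<tau>} = indep_tuples d r N \<tau>"
    using indep_tuples_perm[OF _ _ assms] by (auto simp: indep_tuples_def)
  then show ?thesis
    using open_indep_tuples[OF assms, of d \<tau>] by (auto simp: openin_zariski_sym indep_tuples_def)
qed

section \<open>Minimal decompositions as tuples with independent powers and dependent
  \<open>T\<close>\<close>

lemma power_sum_tuple_iff:
  assumes "is_form d T" "length ps = r"
  shows "T = (\<Sum>i<r. cscale (c i) (linear_form (rep_vec (ps ! i)) ^ d)) \<longleftrightarrow>
    (\<forall>u. tdeg u = d \<longrightarrow> (\<Sum>i<r. c i * point_rows r (coef d T) (\<lambda>i. rep_vec (ps ! i)) i u) = coef d T u)"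
proof -
  have "(\<Sum>i<r. c i * point_rows r (coef d T) (\<lambda>i. rep_vec (ps ! i)) i u) =
      (\<Sum>i<r. c i * vmon (rep_vec (ps ! i)) u)" for u
    by (intro sum.cong) (auto simp: point_rows_def)
  then show ?thesis using power_sum_eq_iff[OF assms(1), where I = "{..<r}" and c = c and v = "\<lambda>i. rep_vec (ps ! i)"] by (auto simp: eq_commute)
qed

text \<open>In a dependence among the powers and \<open>T\<close> the coefficient of
  \<open>T\<close> is nonzero, because the powers alone are independent. The rank then forbids
  repeated points.\<close>

lemma tuple_decomposition:
  assumes T: "is_form d T" and rk: "form_rank d T = r"
    and ps: "ps \<in> indep_tuples d r r (coef d T)" "ps \<notin> indep_tuples d r (Suc r) (coef d T)"
  shows "distinct ps" "decomposition d T (set ps)" "card (set ps) = r"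
proof -
  let ?R = "point_rows r (coef d T) (\<lambda>i. rep_vec (ps ! i))"
  have len: "length ps = r" using ps by (simp add: indep_tuples_def)
  then have "\<not> indep_rows (Suc r) {u. tdeg u = d} ?R" using ps(2) by (simp add: indep_tuples_def)
  then obtain c k where c: "\<And>u. tdeg u = d \<Longrightarrow> (\<Sum>i<Suc r. c i * ?R i u) = 0" and k: "k < Suc r" "c k \<noteq> 0"
    unfolding indep_rows_def by auto
  have cr: "c r \<noteq> 0"
  proof
    assume z: "c r = 0"
    then have "(\<Sum>i<r. c i * ?R i u) = 0" if "tdeg u = d" for u using c[OF that] by simp
    then have "\<forall>i<r. c i = 0" using ps(1) by (simp add: indep_tuples_def indep_rows_def)
    then show False using k z by (auto simp: less_Suc_eq)
  qed
  have eq: "(\<Sum>i<r. (- c i / c r) * ?R i u) = coef d T u" if "tdeg u = d" for u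
  proof -
    have "(\<Sum>i<r. c i * ?R i u) = - (c r * coef d T u)"
      using c[OF that] by (simp add: point_rows_def add_eq_0_iff)
    moreover have "(\<Sum>i<r. (- c i / c r) * ?R i u) = - (\<Sum>i<r. c i * ?R i u) / c r"
      by (simp add: sum_divide_distrib sum_negf)
    ultimately show ?thesis using cr by simp
  qed
  then have "T = (\<Sum>i<r. cscale (- c i / c r) (linear_form (rep_vec (ps ! i)) ^ d))"
    using power_sum_tuple_iff[OF T len, of "\<lambda>i. - c i / c r"] by blast
  then have "decomposition d T ((\<lambda>i. pt_of (rep_vec (ps ! i))) ` {..<r})"
    by (rule decomposition_image_pt_of[rotated 2]) (simp_all add: rep_vec_nz)
  moreover have "(\<lambda>i. pt_of (rep_vec (ps ! i))) ` {..<r} = set ps" using len by (auto simp: set_conv_nth)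
  ultimately show dec: "decomposition d T (set ps)" by simp
  have "r \<le> card (set ps)" using form_rank_le[OF dec] rk by simp
  moreover have "card (set ps) \<le> r" using card_length[of ps] len by simp
  ultimately show "card (set ps) = r" by simp
  then show "distinct ps" using len by (simp add: card_distinct)
qed

lemma decomposition_tuple:
  assumes T: "is_form d T" and rk: "form_rank d T = r" and len: "length ps = r"
    and dec: "decomposition d T (set ps)"
  shows "ps \<in> indep_tuples d r r (coef d T)" "ps \<notin> indep_tuples d r (Suc r) (coef d T)" "distinct ps"
proof -
  let ?R = "point_rows r (coef d T) (\<lambda>i. rep_vec (ps ! i))"
  have "r \<le> card (set ps)" using form_rank_le[OF dec] rk by simp
  moreover have "card (set ps) \<le> r" using card_length[of ps] len by simp
  ultimately have card: "card (set ps) = r" by simp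
  then show dist: "distinct ps" using len by (simp add: card_distinct)
  have bij: "bij_betw ((!) ps) {..<r} (set ps)" using bij_betw_nth[OF dist] len by simp
  obtain a0 where "T = (\<Sum>P\<in>set ps. cscale (a0 P) (linear_form (rep_vec P) ^ d))" using dec by (auto simp: decomposition_iff)
  then have "T = (\<Sum>i<r. cscale (a0 (ps ! i)) (linear_form (rep_vec (ps ! i)) ^ d))"
    by (simp add: sum.reindex_bij_betw[OF bij, symmetric, of "\<lambda>P. cscale (a0 P) (linear_form (rep_vec P) ^ d)"])
  moreover define a where "a i = a0 (ps ! i)" for i
  ultimately have aT: "T = (\<Sum>i<r. cscale (a i) (linear_form (rep_vec (ps ! i)) ^ d))" by simp
  then have a: "\<And>u. tdeg u = d \<Longrightarrow> (\<Sum>i<r. a i * ?R i u) = coef d T u"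
    using power_sum_tuple_iff[OF T len] by blast
  show "ps \<in> indep_tuples d r r (coef d T)"
  proof (rule ccontr)
    assume "ps \<notin> indep_tuples d r r (coef d T)"
    then obtain c k where c: "\<And>u. tdeg u = d \<Longrightarrow> (\<Sum>i<r. c i * ?R i u) = 0" and k: "k < r" "c k \<noteq> 0"
      using len unfolding indep_tuples_def indep_rows_def by auto
    \<comment> \<open>Subtracting this multiple of the dependence cancels the coefficient at
      \<open>k\<close>; the remaining r - 1 points contradict the rank.\<close>
    define b where "b i = a i - a k / c k * c i" for i
    have "(\<Sum>i<r. b i * ?R i u) = coef d T u" if "tdeg u = d" for u
    proof -
      have "(\<Sum>i<r. b i * ?R i u) = (\<Sum>i<r. a i * ?R i u) - a k / c k * (\<Sum>i<r. c i * ?R i u)"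
        by (simp add: b_def algebra_simps sum_subtractf sum_distrib_left)
      then show ?thesis using a[OF that] c[OF that] by simp
    qed
    then have "T = (\<Sum>i<r. cscale (b i) (linear_form (rep_vec (ps ! i)) ^ d))"
      using power_sum_tuple_iff[OF T len, of b] by blast
    also have "\<dots> = (\<Sum>i\<in>{..<r} - {k}. cscale (b i) (linear_form (rep_vec (ps ! i)) ^ d))"
      using k by (subst sum.remove[of _ k]) (auto simp: b_def)
    finally have "T = (\<Sum>i\<in>{..<r} - {k}. cscale (b i) (linear_form (rep_vec (ps ! i)) ^ d))" .
    then have "decomposition d T ((\<lambda>i. pt_of (rep_vec (ps ! i))) ` ({..<r} - {k}))"
      by (rule decomposition_image_pt_of[rotated 2]) (simp_all add: rep_vec_nz)
    then have "r \<le> card ((\<lambda>i. pt_of (rep_vec (ps ! i))) ` ({..<r} - {k}))" using form_rank_le rk by blast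
    also have "\<dots> \<le> card ({..<r} - {k})" by (rule card_image_le) simp
    also have "\<dots> < r" using k by simp
    finally show False by simp
  qed
  show "ps \<notin> indep_tuples d r (Suc r) (coef d T)"
  proof
    assume "ps \<in> indep_tuples d r (Suc r) (coef d T)"
    then have ind: "\<And>c. (\<forall>u. tdeg u = d \<longrightarrow> (\<Sum>i<Suc r. c i * ?R i u) = 0) \<Longrightarrow> \<forall>i<Suc r. c i = 0"
      by (simp add: indep_tuples_def indep_rows_def)
    define c where "c i = (if i < r then a i else - 1)" for i
    have "(\<Sum>i<Suc r. c i * ?R i u) = 0" if "tdeg u = d" for u
    proof -
      have "(\<Sum>i<r. c i * ?R i u) = (\<Sum>i<r. a i * ?R i u)" by (intro sum.cong) (auto simp: c_def)
      then show ?thesis using a[OF that] by (simp add: c_def point_rows_def)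
    qed
    then have "c r = 0" using ind by blast
    then show False by (simp add: c_def)
  qed
qed

section \<open>Holomorphic families are positive dimensional\<close>

lemma closed_sym_vanishing:
  assumes "closedin (zariski_sym r) (C :: 'n::finite proj_space multiset set)"
  obtains S where "\<And>F. F \<in> S \<Longrightarrow> multihomogeneous r F"
    "\<And>ps. length ps = r \<Longrightarrow> mset ps \<in> C \<longleftrightarrow> (\<forall>F\<in>S. vanishes_at r F ps)"
proof -
  have "closedin (zariski_prod r) {ps \<in> topspace (zariski_prod r). mset ps \<in> C}"
    using closedin_continuous_map_preimage[OF quotient_imp_continuous_map[OF quotient_map_mset] assms] .
  then obtain S where S: "\<forall>F\<in>S. multihomogeneous r F" "{ps \<in> topspace (zariski_prod r). mset ps \<in> C} = zero_locus r S"
    unfolding closedin_zariski_prod by blast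
  have "mset ps \<in> C \<longleftrightarrow> (\<forall>F\<in>S. vanishes_at r F ps)" if "length ps = r" for ps
  proof -
    have "mset ps \<in> C \<longleftrightarrow> ps \<in> {ps \<in> topspace (zariski_prod r). mset ps \<in> C}" using that by simp
    also have "\<dots> \<longleftrightarrow> ps \<in> zero_locus r S" by (simp only: S(2))
    also have "\<dots> \<longleftrightarrow> (\<forall>F\<in>S. vanishes_at r F ps)" using that by (simp add: zero_locus_def)
    finally show ?thesis .
  qed
  then show thesis using that[of S] S(1) by blast
qed

lemma holomorphic_cpoly_eval:
  assumes F: "multihomogeneous r F" and v: "\<And>i j. i < r \<Longrightarrow> (\<lambda>t. v i t $ j) holomorphic_on S"
  shows "(\<lambda>t. cpoly_eval (\<lambda>(i, j). v i t $ j) F) holomorphic_on S"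
  unfolding cpoly_eval_def monom_eval_def
proof (intro holomorphic_on_sum holomorphic_on_mult holomorphic_on_const holomorphic_on_prod holomorphic_on_power)
  fix u p assume "u \<in> Poly_Mapping.keys F" "p \<in> Poly_Mapping.keys u"
  then have "fst p < r" using F unfolding multihomogeneous_def by blast
  then show "(\<lambda>t. case p of (i, j) \<Rightarrow> v i t $ j) holomorphic_on S"
    using v[of "fst p" "snd p"] by (simp add: split_def)
qed

lemma vanishes_at_pt_of:
  assumes "multihomogeneous r F" "\<And>i. i < r \<Longrightarrow> w i \<noteq> 0"
  shows "vanishes_at r F (map (\<lambda>i. pt_of (w i)) [0..<r]) \<longleftrightarrow> cpoly_eval (\<lambda>(i, j). w i $ j) F = 0"
  using assms by (intro vanishes_at_iff) (auto intro: pt_of_reps)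

text \<open>An equation of \<open>C\<close> that fails at \<open>t1\<close> fails on a nonempty open
  set of parameters. There the arc lies in \<open>D\<close>, so the equations of \<open>D\<close>
  vanish on that open set and, by the identity theorem, on the whole disc.\<close>

lemma holomorphic_family_irreducible:
  fixes v :: "nat \<Rightarrow> complex \<Rightarrow> complex ^ 'n::finite"
  assumes v: "\<And>i j. i < r \<Longrightarrow> (\<lambda>t. v i t $ j) holomorphic_on ball 0 \<epsilon>"
    and nz: "\<And>i t. i < r \<Longrightarrow> t \<in> ball 0 \<epsilon> \<Longrightarrow> v i t \<noteq> 0"
    and C: "closedin (zariski_sym r) C" and D: "closedin (zariski_sym r) D"
    and cover: "\<And>t. t \<in> ball 0 \<epsilon> \<Longrightarrow> mset (map (\<lambda>i. pt_of (v i t)) [0..<r]) \<in> C \<union> D"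
    and t1: "t1 \<in> ball 0 \<epsilon>" "mset (map (\<lambda>i. pt_of (v i t1)) [0..<r]) \<notin> C"
    and t: "t \<in> ball 0 \<epsilon>"
  shows "mset (map (\<lambda>i. pt_of (v i t)) [0..<r]) \<in> D"
proof -
  let ?p = "\<lambda>t. map (\<lambda>i. pt_of (v i t)) [0..<r]"
  let ?e = "\<lambda>F t. cpoly_eval (\<lambda>(i, j). v i t $ j) F"
  obtain S where S: "\<And>F. F \<in> S \<Longrightarrow> multihomogeneous r F"
    "\<And>ps. length ps = r \<Longrightarrow> mset ps \<in> C \<longleftrightarrow> (\<forall>F\<in>S. vanishes_at r F ps)"
    using closed_sym_vanishing[OF C] by blast
  obtain S' where S': "\<And>F. F \<in> S' \<Longrightarrow> multihomogeneous r F"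
    "\<And>ps. length ps = r \<Longrightarrow> mset ps \<in> D \<longleftrightarrow> (\<forall>F\<in>S'. vanishes_at r F ps)"
    using closed_sym_vanishing[OF D] by blast
  have van: "vanishes_at r F (?p t) \<longleftrightarrow> ?e F t = 0" if "multihomogeneous r F" "t \<in> ball 0 \<epsilon>" for F t
    using that nz by (intro vanishes_at_pt_of) auto
  obtain F where F: "F \<in> S" "\<not> vanishes_at r F (?p t1)" using S(2)[of "?p t1"] t1(2) by auto
  have holF: "?e F holomorphic_on ball 0 \<epsilon>" by (rule holomorphic_cpoly_eval[OF S(1)[OF F(1)] v])
  have F1: "?e F t1 \<noteq> 0" using van[OF S(1)[OF F(1)] t1(1)] F(2) by simp
  have "continuous_on (ball 0 \<epsilon>) (?e F)" by (rule holomorphic_on_imp_continuous_on[OF holF])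
  then have opn: "open (ball 0 \<epsilon> \<inter> ?e F -` (- {0}))"
    by (rule continuous_open_preimage) auto
  have "vanishes_at r G (?p t)" if G: "G \<in> S'" for G
  proof -
    have holG: "?e G holomorphic_on ball 0 \<epsilon>" by (rule holomorphic_cpoly_eval[OF S'(1)[OF G] v])
    have "?e G t = 0"
    proof (rule analytic_continuation_open[OF opn open_ball _ _ _ holG holomorphic_on_const])
      show "ball 0 \<epsilon> \<inter> ?e F -` (- {0}) \<noteq> {}" using t1(1) F1 by blast
      show "connected (ball (0::complex) \<epsilon>)" by simp
      fix s assume s: "s \<in> ball 0 \<epsilon> \<inter> ?e F -` (- {0})"
      then have "\<not> vanishes_at r F (?p s)" using van[OF S(1)[OF F(1)], of s] by simp
      then have "mset (?p s) \<notin> C" using S(2)[of "?p s"] F(1) by auto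
      then have "mset (?p s) \<in> D" using cover[of s] s by blast
      then have "vanishes_at r G (?p s)" using S'(2)[of "?p s"] G by simp
      then show "?e G s = 0" using van[OF S'(1)[OF G], of s] s by simp
    qed (use t in auto)
    then show ?thesis using van[OF S'(1)[OF G] t] by simp
  qed
  then show ?thesis using S'(2)[of "?p t"] by simp
qed

text \<open>Two vectors that are not proportional have a nonzero 2 by 2 minor; with its first row
  fixed at \<open>P\<close>, this minor is a linear functional of the second.\<close>

lemma separating_functional:
  assumes "P \<noteq> (Q :: 'n::finite proj_space)"
  obtains l :: "complex ^ 'n" where "(\<Sum>j\<in>UNIV. l $ j * rep_vec P $ j) = 0" "(\<Sum>j\<in>UNIV. l $ j * rep_vec Q $ j) \<noteq> 0"
proof -
  let ?w = "rep_vec P" and ?z = "rep_vec Q"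
  obtain k where k: "?w $ k \<noteq> 0" using rep_vec_nz[of P] by (auto simp: cart_eq_iff)
  have "\<exists>l. ?z $ l * ?w $ k \<noteq> ?z $ k * ?w $ l"
  proof (rule ccontr)
    assume *: "\<not> ?thesis"
    have "?z = (?z $ k / ?w $ k) *s ?w"
      using * k by (simp add: cart_eq_iff field_simps)
    moreover have "?z \<noteq> 0" by (rule rep_vec_nz)
    ultimately have "?z \<in> reps P"
      using reps_scale_iff[OF rep_vec_reps[of P], of ?z] by (metis vector_smult_lzero)
    then have "pt_of ?z = P" by (rule pt_of_eq)
    then show False using assms by simp
  qed
  then obtain l where l: "?z $ l * ?w $ k \<noteq> ?z $ k * ?w $ l" by blast
  define m :: "complex ^ 'n" where "m = (\<chi> j. (if j = l then ?w $ k else 0) - (if j = k then ?w $ l else 0))"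
  have m: "(\<Sum>j\<in>UNIV. m $ j * x $ j) = ?w $ k * x $ l - ?w $ l * x $ k" for x :: "complex ^ 'n"
  proof -
    have "(\<Sum>j\<in>UNIV. m $ j * x $ j) = (\<Sum>j\<in>UNIV. (if j = l then ?w $ k * x $ j else 0) - (if j = k then ?w $ l * x $ j else 0))"
      by (intro sum.cong) (auto simp: m_def algebra_simps)
    then show ?thesis by (simp add: sum_subtractf)
  qed
  show thesis
  proof (rule that[of m])
    show "(\<Sum>j\<in>UNIV. m $ j * ?w $ j) = 0" unfolding m by simp
    show "(\<Sum>j\<in>UNIV. m $ j * ?z $ j) \<noteq> 0" unfolding m using l by (simp add: mult.commute)
  qed
qed

definition coord_form :: "nat \<Rightarrow> complex ^ 'n::finite \<Rightarrow> (nat \<times> 'n) cpoly" where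
  "coord_form i l = (\<Sum>j\<in>UNIV. Poly_Mapping.single (Poly_Mapping.single (i, j) 1) (l $ j))"

lemma eval_coord_form: "cpoly_eval (\<lambda>(i, j). v i $ j) (coord_form i l) = (\<Sum>j\<in>UNIV. l $ j * v i $ j)"
  by (simp add: coord_form_def cpoly_eval_sum monom_eval_def)

lemma multihomogeneous_coord_form:
  assumes "i < r"
  shows "multihomogeneous r (coord_form i l)"
  unfolding multihomogeneous_def
proof (intro exI[of _ "\<lambda>k. if k = i then 1 else 0"] ballI)
  fix u assume "u \<in> Poly_Mapping.keys (coord_form i l)"
  then have "u \<in> (\<Union>j\<in>UNIV. Poly_Mapping.keys (Poly_Mapping.single (Poly_Mapping.single (i, j) (1::nat)) (l $ j)))"
    unfolding coord_form_def by (rule subsetD[OF keys_sum])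
  then obtain j where "u \<in> Poly_Mapping.keys (Poly_Mapping.single (Poly_Mapping.single (i, j) (1::nat)) (l $ j))" by blast
  then have u: "u = Poly_Mapping.single (i, j) 1" by (simp add: keys_single split: if_splits)
  have "(\<Sum>k\<in>UNIV. Poly_Mapping.lookup u (i', k)) = (if i' = i then 1 else 0)" for i'
  proof -
    have "(\<Sum>k\<in>UNIV. Poly_Mapping.lookup u (i', k)) = (\<Sum>k\<in>UNIV. if k = j then (if i' = i then 1 else 0) else 0)"
      unfolding u by (intro sum.cong) (auto simp: lookup_single when_def)
    then show ?thesis by simp
  qed
  then show "fst ` Poly_Mapping.keys u \<subseteq> {..<r} \<and> (\<forall>i'<r. (\<Sum>k\<in>UNIV. Poly_Mapping.lookup u (i', k)) = (if i' = i then 1 else 0))"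
    using assms by (simp add: u)
qed

lemma multihomogeneous_1: "multihomogeneous r 1"
  by (auto simp: multihomogeneous_def)

lemma multihomogeneous_prod:
  "finite I \<Longrightarrow> (\<And>i. i \<in> I \<Longrightarrow> multihomogeneous r (f i)) \<Longrightarrow> multihomogeneous r (prod f I)"
  by (induction rule: finite_induct) (simp_all add: multihomogeneous_1 multihomogeneous_mult)

lemma cpoly_eval_prod: "finite I \<Longrightarrow> cpoly_eval x (prod f I) = (\<Prod>i\<in>I. cpoly_eval x (f i))"
proof (induction rule: finite_induct)
  case empty
  show ?case by (simp add: cpoly_eval_def monom_eval_def)
qed (simp add: cpoly_eval_mult)

text \<open>Each factor of \<open>f\<close> is a linear form that vanishes at one point of
  \<open>A\<close> but not at \<open>Q\<close>. Asking for \<open>f = 0\<close> at every member of a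
  multiset is symmetric, hence a closed condition on the symmetric product.\<close>

lemma closed_set_avoiding:
  fixes A :: "'n::finite proj_space set"
  assumes "finite A" "Q \<notin> A"
  obtains C where "closedin (zariski_sym r) C" "\<And>M. size M = r \<Longrightarrow> set_mset M \<subseteq> A \<Longrightarrow> M \<in> C"
    "\<And>M. Q \<in># M \<Longrightarrow> M \<notin> C"
proof -
  have "\<forall>P\<in>A. \<exists>l. (\<Sum>j\<in>UNIV. l $ j * rep_vec P $ j) = 0 \<and> (\<Sum>j\<in>UNIV. l $ j * rep_vec Q $ j) \<noteq> 0"
  proof
    fix P assume "P \<in> A"
    then have "P \<noteq> Q" using assms(2) by blast
    then show "\<exists>l. (\<Sum>j\<in>UNIV. l $ j * rep_vec P $ j) = 0 \<and> (\<Sum>j\<in>UNIV. l $ j * rep_vec Q $ j) \<noteq> 0"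
      using separating_functional[of P Q] by blast
  qed
  then obtain l where l: "\<And>P. P \<in> A \<Longrightarrow> (\<Sum>j\<in>UNIV. l P $ j * rep_vec P $ j) = 0"
    "\<And>P. P \<in> A \<Longrightarrow> (\<Sum>j\<in>UNIV. l P $ j * rep_vec Q $ j) \<noteq> 0"
    using bchoice[of A "\<lambda>P l. (\<Sum>j\<in>UNIV. l $ j * rep_vec P $ j) = 0 \<and> (\<Sum>j\<in>UNIV. l $ j * rep_vec Q $ j) \<noteq> 0"] by blast
  define f where "f R = (\<Prod>P\<in>A. \<Sum>j\<in>UNIV. l P $ j * rep_vec R $ j)" for R
  have fA: "f R = 0" if "R \<in> A" for R
    using l(1)[OF that] assms(1) that by (auto simp: f_def intro: prod_zero)
  have fQ: "f Q \<noteq> 0" using l(2) assms(1) by (simp add: f_def)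
  define C where "C = {M. size M = r \<and> (\<forall>R\<in>#M. f R = 0)}"
  define F where "F i = (\<Prod>P\<in>A. coord_form i (l P))" for i
  have Fh: "multihomogeneous r (F i)" if "i < r" for i
    unfolding F_def using that assms(1) by (intro multihomogeneous_prod multihomogeneous_coord_form)
  have van: "vanishes_at r (F i) ps \<longleftrightarrow> f (ps ! i) = 0" if "i < r" for i and ps :: "'n proj_space list"
    by (subst vanishes_at_iff[of r "F i" "\<lambda>i. rep_vec (ps ! i)"])
      (use that Fh assms(1) in \<open>simp_all add: rep_vec_reps F_def f_def cpoly_eval_prod eval_coord_form\<close>)
  have eq: "{ps. length ps = r \<and> mset ps \<in> {M. size M = r} - C} = {ps. length ps = r} - zero_locus r (F ` {..<r})"
    using van by (auto simp: C_def zero_locus_def all_set_conv_all_nth)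
  have "openin (zariski_prod r) ({ps. length ps = r} - zero_locus r (F ` {..<r}))"
    unfolding openin_zariski_prod using Fh by (intro exI[of _ "F ` {..<r}"]) auto
  then have "openin (zariski_sym r) ({M. size M = r} - C)"
    unfolding openin_zariski_sym eq by blast
  then have "closedin (zariski_sym r) C"
    by (auto simp: closedin_def C_def)
  then show thesis
    by (rule that) (use fA fQ in \<open>auto simp: C_def\<close>)
qed

text \<open>The closure of a point, rather than the point, serves as the lower term of a chain of
  irreducible closed sets, so that points need not be shown to be closed.\<close>

lemma irreducible_closure_of_point:
  assumes "x \<in> topspace X"
  shows "irreducible_space (subtopology X (X closure_of {x}))"
  unfolding irreducible_space_def
proof (intro conjI allI impI)
  let ?K = "X closure_of {x}"
  have K: "topspace (subtopology X ?K) = ?K" using closure_of_subset_topspace[of X "{x}"] by auto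
  have xK: "x \<in> ?K" using closure_of_subset[of "{x}" X] assms by auto
  show "topspace (subtopology X ?K) \<noteq> {}" using K xK by blast
  have full: "E = ?K" if "closedin (subtopology X ?K) E" "x \<in> E" for E
  proof -
    have E: "closedin X E" using closedin_trans_full[OF that(1)] by simp
    then have "?K \<subseteq> E" using that(2) by (intro closure_of_minimal) auto
    then show ?thesis using closedin_subset[OF that(1)] K by auto
  qed
  fix C D assume CD: "closedin (subtopology X ?K) C \<and> closedin (subtopology X ?K) D \<and> C \<union> D = topspace (subtopology X ?K)"
  then have "x \<in> C \<or> x \<in> D" using xK K by blast
  then show "C = topspace (subtopology X ?K) \<or> D = topspace (subtopology X ?K)"
    unfolding K using full CD by blast
qed

text \<open>The family is the closure of the holomorphic arc, intersected with the open set of tuples whose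
  \<open>d\<close>-th powers are independent; on that set, failing to span \<open>T\<close> is again an open condition.\<close>

lemma holomorphic_family_positive_dim:
  fixes T :: "'n::finite cpoly" and v :: "nat \<Rightarrow> complex \<Rightarrow> complex ^ 'n"
  assumes T: "is_form d T" and rk: "form_rank d T = r" and \<epsilon>: "\<epsilon> > 0"
    and hol: "\<And>i j. i < r \<Longrightarrow> (\<lambda>t. v i t $ j) holomorphic_on ball 0 \<epsilon>"
    and nz: "\<And>i t. i < r \<Longrightarrow> t \<in> ball 0 \<epsilon> \<Longrightarrow> v i t \<noteq> 0"
    and dec: "\<And>t. t \<in> ball 0 \<epsilon> \<Longrightarrow> \<exists>c. T = (\<Sum>i<r. cscale (c i) (linear_form (v i t) ^ d))"
    and A: "(\<lambda>i. pt_of (v i 0)) ` {..<r} = A"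
    and t1: "t1 \<in> ball 0 \<epsilon>" "(\<lambda>i. pt_of (v i t1)) ` {..<r} \<noteq> A"
  shows "\<exists>W. positive_dim_family d T r A W"
proof -
  let ?X = "zariski_sym r :: 'n proj_space multiset topology"
  define ps where "ps t = map (\<lambda>i. pt_of (v i t)) [0..<r]" for t
  define U where "U = mset ` indep_tuples d r r (coef d T)"
  define O2 where "O2 = mset ` indep_tuples d r (Suc r) (coef d T)"
  define \<Gamma> where "\<Gamma> = (\<lambda>t. mset (ps t)) ` ball 0 \<epsilon>"
  define W where "W = U \<inter> ?X closure_of \<Gamma>"
  have len: "length (ps t) = r" for t by (simp add: ps_def)
  have set_ps: "set (ps t) = (\<lambda>i. pt_of (v i t)) ` {..<r}" for t by (simp add: ps_def atLeast0LessThan)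
  have dps: "decomposition d T (set (ps t))" if t: "t \<in> ball 0 \<epsilon>" for t
  proof -
    obtain c where c: "T = (\<Sum>i<r. cscale (c i) (linear_form (v i t) ^ d))" using dec[OF t] by blast
    show ?thesis unfolding set_ps
      by (rule decomposition_image_pt_of[OF _ _ c]) (use nz t in auto)
  qed
  note tup = decomposition_tuple[OF T rk len dps]
  have openU: "openin ?X U" unfolding U_def by (rule open_mset_indep_tuples) simp
  have openO2: "openin ?X O2" unfolding O2_def by (rule open_mset_indep_tuples) simp
  have \<Gamma>top: "\<Gamma> \<subseteq> topspace ?X" using len by (auto simp: \<Gamma>_def)
  have \<Gamma>U: "\<Gamma> \<subseteq> U" using tup(1) by (auto simp: \<Gamma>_def U_def)
  \<comment> \<open>An open set that misses the arc misses its closure. Hence on \<open>W\<close>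
    the powers and \<open>T\<close> stay dependent, which makes every member a
    decomposition.\<close>
  have "\<Gamma> \<inter> O2 = {}"
  proof (rule ccontr)
    assume "\<Gamma> \<inter> O2 \<noteq> {}"
    then obtain t qs where t: "t \<in> ball 0 \<epsilon>" and qs: "qs \<in> indep_tuples d r (Suc r) (coef d T)" "mset (ps t) = mset qs"
      by (auto simp: \<Gamma>_def O2_def)
    have "ps t \<in> indep_tuples d r (Suc r) (coef d T)" by (rule indep_tuples_perm[OF qs]) simp
    then show False using tup(2)[OF t] by blast
  qed
  then have clO2: "O2 \<inter> ?X closure_of \<Gamma> = {}"
    using openin_Int_closure_of_eq_empty[OF openO2, of \<Gamma>] by blast
  have \<Gamma>W: "\<Gamma> \<subseteq> W" using \<Gamma>U closure_of_subset[OF \<Gamma>top] by (auto simp: W_def)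
  have Wtop: "W \<subseteq> topspace ?X" using closure_of_subset_topspace[of ?X \<Gamma>] by (auto simp: W_def)
  have members: "\<exists>B. M = mset_set B \<and> decomposition d T B \<and> card B = r" if M: "M \<in> W" for M
  proof -
    obtain qs where qs: "qs \<in> indep_tuples d r r (coef d T)" "M = mset qs" using M by (auto simp: W_def U_def)
    have "M \<notin> O2" using M clO2 by (auto simp: W_def)
    then have "qs \<notin> indep_tuples d r (Suc r) (coef d T)" using qs(2) by (auto simp: O2_def)
    note q = tuple_decomposition[OF T rk qs(1) this]
    have "M = mset_set (set qs)" using q(1) qs(2) by (simp add: mset_set_set)
    then show ?thesis using q by blast
  qed
  have A0: "mset (ps 0) = mset_set A"
  proof -
    have "distinct (ps 0)" using tup(3)[of 0] \<epsilon> by simp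
    then have "mset (ps 0) = mset_set (set (ps 0))" by (simp add: mset_set_set)
    then show ?thesis using A set_ps[of 0] by simp
  qed
  have "mset (ps 0) \<in> \<Gamma>" using \<epsilon> by (auto simp: \<Gamma>_def)
  then have AW: "mset_set A \<in> W" using \<Gamma>W A0 by auto
  have cardA: "card A = r" and finA: "finite A"
  proof -
    have "distinct (ps 0)" using tup(3)[of 0] \<epsilon> by simp
    then show "card A = r" using distinct_card[of "ps 0"] len[of 0] set_ps[of 0] A by simp
    show "finite A" using A by blast
  qed
  let ?Y = "subtopology ?X W"
  have topY: "topspace ?Y = W" using Wtop by auto
  have irrW: "irreducible_space ?Y"
    unfolding irreducible_space_def topY
  proof (intro conjI allI impI)
    show "W \<noteq> {}" using AW by blast
    fix C D assume CD: "closedin ?Y C \<and> closedin ?Y D \<and> C \<union> D = W"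
    then obtain C' D' where C': "closedin ?X C'" "C = C' \<inter> W" and D': "closedin ?X D'" "D = D' \<inter> W"
      by (auto simp: closedin_subtopology)
    have full: "E \<inter> W = W" if "closedin ?X E" "\<Gamma> \<subseteq> E" for E
      using closure_of_minimal[OF that(2,1)] by (auto simp: W_def)
    have cover: "mset (ps t) \<in> C' \<union> D'" if "t \<in> ball 0 \<epsilon>" for t
    proof -
      have "mset (ps t) \<in> \<Gamma>" using that by (auto simp: \<Gamma>_def)
      then have "mset (ps t) \<in> W" using \<Gamma>W by blast
      then have "mset (ps t) \<in> C \<union> D" using CD by simp
      then show ?thesis using C'(2) D'(2) by blast
    qed
    show "C = W \<or> D = W"
    proof (cases "\<Gamma> \<subseteq> C'")
      case True
      then show ?thesis using full[OF C'(1)] C'(2) by simp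
    next
      case False
      then obtain s where s: "s \<in> ball 0 \<epsilon>" "mset (ps s) \<notin> C'" unfolding \<Gamma>_def by blast
      have "mset (ps t) \<in> D'" if t: "t \<in> ball 0 \<epsilon>" for t
        unfolding ps_def
        by (rule holomorphic_family_irreducible[OF hol nz C'(1) D'(1) _ s(1) _ t])
          (use cover s(2) in \<open>simp_all add: ps_def\<close>)
      then have "\<Gamma> \<subseteq> D'" by (auto simp: \<Gamma>_def)
      then show ?thesis using full[OF D'(1)] D'(2) by simp
    qed
  qed
  define Z0 where "Z0 = ?Y closure_of {mset_set A}"
  have "mset_set A \<in> topspace ?Y" using AW topY by (simp only:)
  then have "irreducible_space (subtopology ?Y Z0)" unfolding Z0_def by (rule irreducible_closure_of_point)
  moreover have "Z0 \<subseteq> W" using closure_of_subset_topspace[of ?Y "{mset_set A}"] topY unfolding Z0_def by (simp only:)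
  ultimately have Z0: "closedin ?Y Z0" "irreducible_space (subtopology ?Y Z0)" "Z0 \<subseteq> W"
    by (simp_all add: Z0_def)
  \<comment> \<open>The parameter \<open>t1\<close> gives \<open>r\<close> points not forming
    \<open>A\<close>, so one of them is a \<open>Q\<close> outside \<open>A\<close>. A closed set of
    multisets avoiding \<open>Q\<close> contains \<open>mset_set A\<close>, hence \<open>Z0\<close>,
    but not the member at \<open>t1\<close>.\<close>
  have "Z0 \<noteq> W"
  proof -
    have "card (set (ps t1)) = r" using tup(3)[OF t1(1)] len[of t1] by (simp add: distinct_card)
    then have "\<not> set (ps t1) \<subseteq> A"
      using card_subset_eq[OF finA, of "set (ps t1)"] cardA t1(2) set_ps[of t1] by auto
    then obtain Q where Q: "Q \<in> set (ps t1)" "Q \<notin> A" by blast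
    obtain C where C: "closedin ?X C" "\<And>M. size M = r \<Longrightarrow> set_mset M \<subseteq> A \<Longrightarrow> M \<in> C" "\<And>M. Q \<in># M \<Longrightarrow> M \<notin> C"
      using closed_set_avoiding[OF finA Q(2), of r] by blast
    have "closedin ?Y (C \<inter> W)" using C(1) by (auto simp: closedin_subtopology)
    moreover have "mset_set A \<in> C \<inter> W" using AW C(2)[of "mset_set A"] finA cardA by simp
    ultimately have "Z0 \<subseteq> C \<inter> W" unfolding Z0_def by (intro closure_of_minimal) auto
    moreover have "mset (ps t1) \<in> \<Gamma>" using t1(1) by (auto simp: \<Gamma>_def)
    then have "mset (ps t1) \<in> W" using \<Gamma>W by blast
    moreover have "mset (ps t1) \<notin> C" using C(3)[of "mset (ps t1)"] Q(1) by simp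
    ultimately show ?thesis by blast
  qed
  then have Z0W: "Z0 \<subset> W" using Z0(3) by blast
  have "krull_dim ?Y > 0"
  proof -
    let ?Z = "\<lambda>i::nat. if i = 0 then Z0 else W"
    have WW: "closedin ?Y W" "subtopology ?Y W = ?Y"
      using closedin_topspace[of ?Y] topY by (simp_all add: subtopology_subtopology)
    have chain: "(\<forall>i\<le>1. closedin ?Y (?Z i) \<and> irreducible_space (subtopology ?Y (?Z i))) \<and> (\<forall>i<1. ?Z i \<subset> ?Z (Suc i))"
      using Z0 Z0W WW irrW by simp
    have "enat 1 \<in> {enat k | k. \<exists>Z :: nat \<Rightarrow> 'n proj_space multiset set.
        (\<forall>i\<le>k. closedin ?Y (Z i) \<and> irreducible_space (subtopology ?Y (Z i))) \<and> (\<forall>i<k. Z i \<subset> Z (Suc i))}"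
      by (rule CollectI, rule exI[of _ 1], rule conjI[OF refl], rule exI[of _ ?Z], rule chain)
    then have "enat 1 \<le> krull_dim ?Y"
      unfolding krull_dim_def by (rule Sup_upper)
    moreover have "(0::enat) < enat 1" by (simp add: zero_enat_def)
    ultimately show ?thesis by (rule order_less_le_trans[rotated])
  qed
  moreover have "locally_closedin ?X W"
    unfolding locally_closedin_def W_def using openU closedin_closure_of[of ?X \<Gamma>] by blast
  ultimately have "positive_dim_family d T r A W"
    unfolding positive_dim_family_def using irrW AW members by blast
  then show ?thesis by blast
qed

section \<open>Families of points on rational curves\<close>

text \<open>Along the curve, monomials of degree \<open>d\<close> become polynomials of degree at
  most \<open>e * d = 2 * M\<close> in the parameter, so the contribution of \<open>A'\<close> to
  \<open>T\<close> is a functional of the kind that \<open>binary_family\<close> deforms. The other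
  points of \<open>A\<close> stay fixed.\<close>

lemma curve_family:
  fixes T :: "'n::finite cpoly" and \<Phi> :: "'n \<Rightarrow> complex poly"
  assumes T: "is_form d T" and rk: "form_rank d T = r" and A: "card A = r" "decomposition d T A"
    and A': "A' \<subseteq> A" "card A' = Suc M" "M \<ge> 1" and deg: "2 * M = e * d" "\<And>j. degree (\<Phi> j) \<le> e"
    and on: "\<And>P. P \<in> A' \<Longrightarrow> \<exists>s. (\<chi> j. poly (\<Phi> j) s) \<in> reps P"
  shows "\<exists>W. positive_dim_family d T r A W"
proof -
  define \<phi> :: "complex \<Rightarrow> complex ^ 'n" where "\<phi> s = (\<chi> j. poly (\<Phi> j) s)" for s
  have \<phi>j: "\<phi> s $ j = poly (\<Phi> j) s" for s j by (simp add: \<phi>_def)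
  have finA: "finite A" using A(2) by (simp add: decomposition_iff)
  have finA': "finite A'" using A'(1) finA by (rule finite_subset)
  obtain c where cT: "T = (\<Sum>P\<in>A. cscale (c P) (linear_form (rep_vec P) ^ d))" using A(2) by (auto simp: decomposition_iff)
  have cnz: "c P \<noteq> 0" if "P \<in> A" for P
    by (rule minimal_coefficient_nz[OF finA cT _ that]) (simp add: rk A)
  have "\<forall>P\<in>A'. \<exists>s. \<phi> s \<in> reps P" using on by (simp add: \<phi>_def)
  then obtain \<alpha> where \<alpha>: "\<And>P. P \<in> A' \<Longrightarrow> \<phi> (\<alpha> P) \<in> reps P" using bchoice[of A' "\<lambda>P s. \<phi> s \<in> reps P"] by blast
  have "\<forall>P\<in>A'. \<exists>g. g \<noteq> 0 \<and> rep_vec P = g *s \<phi> (\<alpha> P)"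
    using reps_scale_iff[OF \<alpha>] rep_vec_reps by blast
  then obtain \<gamma> where \<gamma>: "\<And>P. P \<in> A' \<Longrightarrow> \<gamma> P \<noteq> 0" "\<And>P. P \<in> A' \<Longrightarrow> rep_vec P = \<gamma> P *s \<phi> (\<alpha> P)"
    using bchoice[of A' "\<lambda>P g. g \<noteq> 0 \<and> rep_vec P = g *s \<phi> (\<alpha> P)"] by blast
  have inj: "inj_on \<alpha> A'"
    by (rule inj_onI) (metis \<alpha> pt_of_eq)
  \<comment> \<open>\<open>rep_vec P\<close> is \<open>\<gamma> P\<close> times the point of the
    curve, which costs the factor \<open>\<gamma> P ^ d\<close> in degree \<open>d\<close>.\<close>
  define a where "a P = c P * \<gamma> P ^ d" for P
  have anz: "a P \<noteq> 0" if "P \<in> A'" for P using that cnz \<gamma>(1) A'(1) by (auto simp: a_def)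
  define Q where "Q \<epsilon> \<beta> \<longleftrightarrow> \<epsilon> > 0 \<and> (\<forall>P\<in>A'. \<beta> P holomorphic_on ball 0 \<epsilon> \<and> \<beta> P 0 = \<alpha> P \<and> inj_on (\<beta> P) (ball 0 \<epsilon>)) \<and>
    (\<forall>t\<in>ball 0 \<epsilon>. \<exists>c. \<forall>p. degree p \<le> 2 * M \<longrightarrow>
      (\<Sum>P\<in>A'. a P * poly p (\<alpha> P)) = (\<Sum>P\<in>A'. c P * poly p (\<beta> P t)))" for \<epsilon> \<beta>
  have "\<exists>\<epsilon> \<beta>. Q \<epsilon> \<beta>"
  proof (rule binary_family[OF finA' A'(2) inj anz])
    fix \<epsilon> :: real and \<beta> :: "'n proj_space \<Rightarrow> complex \<Rightarrow> complex"
    assume h: "\<epsilon> > 0" "\<And>P. P \<in> A' \<Longrightarrow> \<beta> P holomorphic_on ball 0 \<epsilon>" "\<And>P. P \<in> A' \<Longrightarrow> \<beta> P 0 = \<alpha> P"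
      "\<And>P. P \<in> A' \<Longrightarrow> inj_on (\<beta> P) (ball 0 \<epsilon>)"
      "\<And>t. t \<in> ball 0 \<epsilon> \<Longrightarrow> \<exists>c. \<forall>p. degree p \<le> 2 * M \<longrightarrow>
        (\<Sum>P\<in>A'. a P * poly p (\<alpha> P)) = (\<Sum>P\<in>A'. c P * poly p (\<beta> P t))"
    have "Q \<epsilon> \<beta>" unfolding Q_def by (intro conjI ballI h)
    then show ?thesis by blast
  qed
  then obtain \<epsilon>0 \<beta> where Q: "Q \<epsilon>0 \<beta>" by blast
  have \<epsilon>0: "\<epsilon>0 > 0"
    and \<beta>hol: "\<And>P. P \<in> A' \<Longrightarrow> \<beta> P holomorphic_on ball 0 \<epsilon>0"
    and \<beta>0: "\<And>P. P \<in> A' \<Longrightarrow> \<beta> P 0 = \<alpha> P"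
    and \<beta>inj: "\<And>P. P \<in> A' \<Longrightarrow> inj_on (\<beta> P) (ball 0 \<epsilon>0)"
    and \<beta>sum: "\<And>t. t \<in> ball 0 \<epsilon>0 \<Longrightarrow> \<exists>c. \<forall>p. degree p \<le> 2 * M \<longrightarrow>
      (\<Sum>P\<in>A'. a P * poly p (\<alpha> P)) = (\<Sum>P\<in>A'. c P * poly p (\<beta> P t))"
    using Q unfolding Q_def by blast+
  \<comment> \<open>The \<open>\<Phi> j\<close> may have common zeros; near 0 the moving parameters
    avoid them by continuity.\<close>
  have "\<exists>e. 0 < e \<and> e \<le> \<epsilon>0 \<and> (\<forall>t\<in>ball 0 e. \<phi> (\<beta> P t) \<noteq> 0)" if P: "P \<in> A'" for P
  proof -
    have "\<phi> (\<alpha> P) \<noteq> 0" using \<alpha>[OF P] by (simp add: reps_def)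
    then obtain j where j: "poly (\<Phi> j) (\<alpha> P) \<noteq> 0" by (auto simp: cart_eq_iff \<phi>j)
    have "continuous_on (ball 0 \<epsilon>0) (\<lambda>t. poly (\<Phi> j) (\<beta> P t))"
      using holomorphic_on_imp_continuous_on[OF \<beta>hol[OF P]] by (intro continuous_intros)
    then have "open (ball 0 \<epsilon>0 \<inter> (\<lambda>t. poly (\<Phi> j) (\<beta> P t)) -` (- {0}))"
      by (rule continuous_open_preimage) auto
    moreover have "0 \<in> ball 0 \<epsilon>0 \<inter> (\<lambda>t. poly (\<Phi> j) (\<beta> P t)) -` (- {0})"
      using \<epsilon>0 j \<beta>0[OF P] by simp
    ultimately obtain e where e: "e > 0" "ball 0 e \<subseteq> ball 0 \<epsilon>0 \<inter> (\<lambda>t. poly (\<Phi> j) (\<beta> P t)) -` (- {0})"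
      using open_contains_ball by meson
    have "\<phi> (\<beta> P t) \<noteq> 0" if "t \<in> ball 0 (min e \<epsilon>0)" for t
    proof
      assume "\<phi> (\<beta> P t) = 0"
      then have "\<phi> (\<beta> P t) $ j = 0" by simp
      moreover have "t \<in> ball 0 e" using that by simp
      then have "poly (\<Phi> j) (\<beta> P t) \<noteq> 0" using e(2) by blast
      ultimately show False by (simp add: \<phi>j)
    qed
    then show ?thesis using e(1) \<epsilon>0 by (intro exI[of _ "min e \<epsilon>0"]) simp
  qed
  then obtain e' where e': "\<And>P. P \<in> A' \<Longrightarrow> 0 < e' P" "\<And>P. P \<in> A' \<Longrightarrow> e' P \<le> \<epsilon>0"
    "\<And>P t. P \<in> A' \<Longrightarrow> t \<in> ball 0 (e' P) \<Longrightarrow> \<phi> (\<beta> P t) \<noteq> 0"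
    using bchoice[of A' "\<lambda>P e. 0 < e \<and> e \<le> \<epsilon>0 \<and> (\<forall>t\<in>ball 0 e. \<phi> (\<beta> P t) \<noteq> 0)"] by blast
  define \<epsilon> where "\<epsilon> = Min (e' ` A')"
  have A'ne: "A' \<noteq> {}" using A'(2) by auto
  have \<epsilon>: "\<epsilon> > 0" using e'(1) finA' A'ne by (simp add: \<epsilon>_def)
  have \<epsilon>le: "\<epsilon> \<le> e' P" if "P \<in> A'" for P using that finA' by (simp add: \<epsilon>_def)
  have sub: "ball 0 \<epsilon> \<subseteq> ball (0::complex) \<epsilon>0"
  proof -
    obtain P where "P \<in> A'" using A'ne by blast
    then have "\<epsilon> \<le> \<epsilon>0" using \<epsilon>le[of P] e'(2)[of P] by simp
    then show ?thesis by (rule subset_ball)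
  qed
  have nz: "\<phi> (\<beta> P t) \<noteq> 0" if "P \<in> A'" "t \<in> ball 0 \<epsilon>" for P t
    using e'(3)[OF that(1), of t] subset_ball[OF \<epsilon>le[OF that(1)], of 0] that(2) by blast
  define w where "w P t = (if P \<in> A' then \<phi> (\<beta> P t) else rep_vec P)" for P t
  obtain f where f: "bij_betw f {..<r} A"
    using ex_bij_betw_nat_finite[OF finA] A(1) by (auto simp: atLeast0LessThan)
  have fA: "f i \<in> A" if "i < r" for i using f that by (auto simp: bij_betw_def)
  have img: "(\<lambda>i. pt_of (w (f i) t)) ` {..<r} = (\<lambda>P. pt_of (w P t)) ` A" for t
    using f by (auto simp: bij_betw_def)
  have wdec: "\<exists>c'. T = (\<Sum>i<r. cscale (c' i) (linear_form (w (f i) t) ^ d))" if t: "t \<in> ball 0 \<epsilon>" for t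
  proof -
    have t0: "t \<in> ball 0 \<epsilon>0" using t sub by blast
    obtain b where b: "\<And>p. degree p \<le> 2 * M \<Longrightarrow>
      (\<Sum>P\<in>A'. a P * poly p (\<alpha> P)) = (\<Sum>P\<in>A'. b P * poly p (\<beta> P t))" using \<beta>sum[OF t0] by blast
    define c' where "c' P = (if P \<in> A' then b P else c P)" for P
    have "coef d T u = (\<Sum>P\<in>A. c' P * vmon (w P t) u)" if u: "tdeg u = d" for u
    proof -
      define p where "p = (\<Prod>j\<in>UNIV. \<Phi> j ^ Poly_Mapping.lookup u j)"
      have pev: "poly p s = vmon (\<phi> s) u" for s
        by (simp add: p_def poly_prod \<phi>j monom_eval_superset[of UNIV])
      have "degree p \<le> (\<Sum>j\<in>UNIV. degree (\<Phi> j ^ Poly_Mapping.lookup u j))"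
        using degree_prod_sum_le[of UNIV "\<lambda>j. \<Phi> j ^ Poly_Mapping.lookup u j"] by (simp add: p_def o_def)
      also have "\<dots> \<le> (\<Sum>j\<in>UNIV. e * Poly_Mapping.lookup u j)"
      proof (rule sum_mono)
        fix j
        have "degree (\<Phi> j ^ Poly_Mapping.lookup u j) \<le> degree (\<Phi> j) * Poly_Mapping.lookup u j"
          by (rule degree_power_le)
        also have "\<dots> \<le> e * Poly_Mapping.lookup u j" using deg(2) by (rule mult_right_mono) simp
        finally show "degree (\<Phi> j ^ Poly_Mapping.lookup u j) \<le> e * Poly_Mapping.lookup u j" .
      qed
      also have "\<dots> = 2 * M" using u deg(1) by (simp add: tdeg_def sum_distrib_left[symmetric])
      finally have dp: "degree p \<le> 2 * M" .
      have split: "sum g A = sum g A' + sum g (A - A')" for g :: "'n proj_space \<Rightarrow> complex"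
        using sum.subset_diff[OF A'(1) finA, of g] by simp
      have "coef d T u = (\<Sum>P\<in>A. c P * vmon (rep_vec P) u)"
        using iffD1[OF power_sum_eq_iff[OF T] cT] u by blast
      also have "\<dots> = (\<Sum>P\<in>A'. c P * vmon (rep_vec P) u) + (\<Sum>P\<in>A - A'. c P * vmon (rep_vec P) u)"
        by (rule split)
      also have "(\<Sum>P\<in>A'. c P * vmon (rep_vec P) u) = (\<Sum>P\<in>A'. a P * poly p (\<alpha> P))"
      proof (rule sum.cong[OF refl])
        fix P assume "P \<in> A'"
        have "vmon (rep_vec P) u = \<gamma> P ^ d * poly p (\<alpha> P)"
          unfolding \<gamma>(2)[OF \<open>P \<in> A'\<close>] monom_eval_scale pev u ..
        then show "c P * vmon (rep_vec P) u = a P * poly p (\<alpha> P)" by (simp add: a_def)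
      qed
      also have "\<dots> = (\<Sum>P\<in>A'. b P * poly p (\<beta> P t))" by (rule b[OF dp])
      also have "\<dots> = (\<Sum>P\<in>A'. c' P * vmon (w P t) u)"
        by (rule sum.cong[OF refl]) (simp add: c'_def w_def pev)
      also have "(\<Sum>P\<in>A - A'. c P * vmon (rep_vec P) u) = (\<Sum>P\<in>A - A'. c' P * vmon (w P t) u)"
        by (rule sum.cong[OF refl]) (simp add: c'_def w_def)
      finally show ?thesis by (simp add: split)
    qed
    then have "T = (\<Sum>P\<in>A. cscale (c' P) (linear_form (w P t) ^ d))"
      by (subst power_sum_eq_iff[OF T]) blast
    then have "T = (\<Sum>i<r. cscale (c' (f i)) (linear_form (w (f i) t) ^ d))"
      by (simp add: sum.reindex_bij_betw[OF f, of "\<lambda>P. cscale (c' P) (linear_form (w P t) ^ d)"])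
    then show ?thesis by (intro exI[of _ "\<lambda>i. c' (f i)"])
  qed
  have w0: "pt_of (w P 0) = P" for P
    using pt_of_eq[OF \<alpha>, of P] \<beta>0[of P] by (simp add: w_def)
  \<comment> \<open>If the set never left \<open>A\<close>, one point \<open>Q\<close> would be hit
    for infinitely many parameters. Proportionality of the curve to \<open>Q\<close> is polynomial
    in the curve parameter, so it would hold identically, and all of the at least two points of
    \<open>A'\<close> would equal \<open>Q\<close>.\<close>
  have "\<exists>t1\<in>ball 0 \<epsilon>. (\<lambda>i. pt_of (w (f i) t1)) ` {..<r} \<noteq> A"
  proof (rule ccontr)
    assume "\<not> ?thesis"
    then have all: "(\<lambda>P. pt_of (w P t)) ` A = A" if "t \<in> ball 0 \<epsilon>" for t using that unfolding img by blast
    obtain P0 where P0: "P0 \<in> A'" using A'ne by blast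
    let ?g = "\<lambda>t. pt_of (\<phi> (\<beta> P0 t))"
    have gA: "?g t \<in> A" if "t \<in> ball 0 \<epsilon>" for t
    proof -
      have "pt_of (w P0 t) \<in> A" using all[OF that] P0 A'(1) by blast
      then show ?thesis using P0 by (simp add: w_def)
    qed
    have "finite (?g ` ball 0 \<epsilon>)" using gA finA by (meson finite_subset image_subsetI)
    moreover have "infinite (ball (0::complex) \<epsilon>)"
      using uncountable_ball[OF \<epsilon>] by (rule uncountable_infinite)
    ultimately obtain t0 where t0: "t0 \<in> ball 0 \<epsilon>" "infinite {t \<in> ball 0 \<epsilon>. ?g t = ?g t0}"
      using pigeonhole_infinite[of "ball 0 \<epsilon>" ?g] by blast
    define Q where "Q = ?g t0"
    define S where "S = \<beta> P0 ` {t \<in> ball 0 \<epsilon>. ?g t = Q}"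
    have "inj_on (\<beta> P0) {t \<in> ball 0 \<epsilon>. ?g t = Q}"
      by (rule inj_on_subset[OF \<beta>inj[OF P0]]) (use sub in blast)
    then have infS: "infinite S" using t0(2) finite_imageD unfolding S_def Q_def by blast
    have prp: "poly (\<Phi> j) s * rep_vec Q $ k = poly (\<Phi> k) s * rep_vec Q $ j" for j k s
    proof -
      let ?p = "Polynomial.smult (rep_vec Q $ k) (\<Phi> j) - Polynomial.smult (rep_vec Q $ j) (\<Phi> k)"
      have "S \<subseteq> {s. poly ?p s = 0}"
      proof
        fix s assume "s \<in> S"
        then obtain t where t: "t \<in> ball 0 \<epsilon>" "?g t = Q" "s = \<beta> P0 t" by (auto simp: S_def)
        have "\<phi> s \<in> reps Q" using pt_of_reps[OF nz[OF P0 t(1)]] t by simp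
        then obtain x where "\<phi> s = x *s rep_vec Q" using reps_scaling[OF rep_vec_reps] by metis
        then have "poly (\<Phi> i) s = x * rep_vec Q $ i" for i by (metis \<phi>j vector_smult_component)
        then show "s \<in> {s. poly ?p s = 0}" by simp
      qed
      then have "?p = 0" using infS poly_roots_finite[of ?p] finite_subset by blast
      then have "poly ?p s = 0" by simp
      then show ?thesis by (simp add: mult.commute)
    qed
    obtain k where k: "rep_vec Q $ k \<noteq> 0" using rep_vec_nz[of Q] by (auto simp: cart_eq_iff)
    have line: "\<phi> s = (poly (\<Phi> k) s / rep_vec Q $ k) *s rep_vec Q" for s
      using prp[of _ s k] k by (simp add: cart_eq_iff \<phi>j field_simps)
    have "P = Q" if P: "P \<in> A'" for P
    proof -
      have nzP: "\<phi> (\<alpha> P) \<noteq> 0" using \<alpha>[OF P] by (simp add: reps_def)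
      then have "poly (\<Phi> k) (\<alpha> P) / rep_vec Q $ k \<noteq> 0" using line[of "\<alpha> P"] by (metis vector_smult_lzero)
      then have "\<phi> (\<alpha> P) \<in> reps Q" using reps_scale[OF rep_vec_reps] line[of "\<alpha> P"] by metis
      then have "pt_of (\<phi> (\<alpha> P)) = Q" by (rule pt_of_eq)
      then show ?thesis using pt_of_eq[OF \<alpha>[OF P]] by simp
    qed
    then have "A' \<subseteq> {Q}" by blast
    then have "card A' \<le> 1" using card_mono[of "{Q}" A'] by simp
    then show False using A'(2,3) by simp
  qed
  then obtain t1 where t1: "t1 \<in> ball 0 \<epsilon>" "(\<lambda>i. pt_of (w (f i) t1)) ` {..<r} \<noteq> A" by blast
  show ?thesis
  proof (rule holomorphic_family_positive_dim[where v = "\<lambda>i. w (f i)", OF T rk \<epsilon> _ _ wdec _ t1])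
    fix i j assume i: "i < r"
    show "(\<lambda>t. w (f i) t $ j) holomorphic_on ball 0 \<epsilon>"
    proof (cases "f i \<in> A'")
      case True
      have "\<beta> (f i) holomorphic_on ball 0 \<epsilon>" using \<beta>hol[OF True] sub by (rule holomorphic_on_subset)
      then have "(\<lambda>t. poly (\<Phi> j) (\<beta> (f i) t)) holomorphic_on ball 0 \<epsilon>" by (intro holomorphic_intros)
      then show ?thesis using True by (simp add: w_def \<phi>j)
    qed (simp add: w_def)
  next
    fix i and t :: complex assume "i < r" "t \<in> ball 0 \<epsilon>"
    then show "w (f i) t \<noteq> 0" using nz rep_vec_nz by (auto simp: w_def)
  next
    show "(\<lambda>i. pt_of (w (f i) 0)) ` {..<r} = A" unfolding img by (simp add: w0)
  qed
qed

section \<open>Many points on a line or a conic\<close>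

lemma rep_vec_not_in_span:
  assumes "P \<noteq> Q"
  shows "rep_vec Q \<notin> vec.span {rep_vec P}"
proof
  assume "rep_vec Q \<in> vec.span {rep_vec P}"
  then obtain c where c: "rep_vec Q = c *s rep_vec P" by (auto simp: vec.span_singleton)
  then have "c \<noteq> 0" using rep_vec_nz[of Q] by (metis vector_smult_lzero)
  then have "rep_vec Q \<in> reps P" using reps_scale[OF rep_vec_reps] c by metis
  then have "pt_of (rep_vec Q) = P" by (rule pt_of_eq)
  then show False using assms by simp
qed

lemma span_pair: "v \<in> vec.span {p, q} \<longleftrightarrow> (\<exists>x y. v = x *s p + y *s q)"
proof -
  have "v \<in> vec.span {p, q} \<longleftrightarrow> (\<exists>x y. v - x *s p = y *s q)"
    by (auto simp: vec.span_insert vec.span_singleton)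
  then show ?thesis by (simp add: algebra_simps)
qed

text \<open>A proper subspace containing two distinct points is their span, so it gives a line in
  the plane: a curve of degree 1, with M = m.\<close>

lemma plane_family:
  fixes T :: "3 cpoly"
  assumes T: "is_form d T" and rk: "form_rank d T = r" and A: "card A = r" "decomposition d T A"
    and d: "d = 2 * m" "m \<ge> 1"
    and K: "vec.subspace K" "K \<noteq> UNIV" and many: "card {P \<in> A. rep_vec P \<in> K} \<ge> Suc m"
  shows "\<exists>W. positive_dim_family d T r A W"
proof -
  obtain A' where A': "A' \<subseteq> {P \<in> A. rep_vec P \<in> K}" "card A' = Suc m"
    using many by (meson obtain_subset_with_card_n)
  have finA': "finite A'" using A'(2) card.infinite by fastforce
  have "\<not> card A' \<le> Suc 0" using A'(2) d(2) by simp
  then obtain P0 P1 where P01: "P0 \<in> A'" "P1 \<in> A'" "P0 \<noteq> P1" using card_le_Suc0_iff_eq[OF finA'] by blast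
  let ?p = "rep_vec P0" and ?q = "rep_vec P1"
  have ind: "vec.independent {?q, ?p}"
    using rep_vec_not_in_span[OF P01(3)] rep_vec_nz[of P0] by (simp add: vec.independent_insert)
  have ne: "?q \<noteq> ?p" using P01(3) by (metis pt_of_rep_vec)
  have "vec.span K \<subset> vec.span UNIV" using K by (simp add: vec.span_eq_iff[THEN iffD2] psubset_eq)
  then have "vec.dim K < vec.dim (UNIV :: (complex ^ 3) set)" by (rule vec.dim_psubset)
  moreover have "vec.dim (UNIV :: (complex ^ 3) set) = 3" unfolding vec_dim_card by simp
  ultimately have "vec.dim K \<le> card {?q, ?p}" using ne by simp
  moreover have "{?q, ?p} \<subseteq> K" using A'(1) P01 by auto
  ultimately have Ksp: "K \<subseteq> vec.span {?q, ?p}" using ind vec.card_ge_dim_independent by blast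
  have "\<exists>xy. rep_vec P = fst xy *s ?p + snd xy *s ?q" if "P \<in> A'" for P
  proof -
    have "rep_vec P \<in> vec.span {?p, ?q}" using that A'(1) Ksp by (auto simp: insert_commute)
    then show ?thesis unfolding span_pair by auto
  qed
  then have "\<forall>P. \<exists>xy. P \<in> A' \<longrightarrow> rep_vec P = fst xy *s ?p + snd xy *s ?q" by blast
  then obtain xy where xy0: "\<forall>P. P \<in> A' \<longrightarrow> rep_vec P = fst (xy P) *s ?p + snd (xy P) *s ?q" by (rule choice[THEN exE])
  define x y where "x P = fst (xy P)" and "y P = snd (xy P)" for P
  have xy: "rep_vec P = x P *s ?p + y P *s ?q" if "P \<in> A'" for P using xy0 that by (simp add: x_def y_def)
  \<comment> \<open>The parametrisation \<open>q + s (p + \<sigma> q)\<close> of the line misses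
    only the direction of \<open>p + \<sigma> q\<close>; \<open>\<sigma>\<close> is chosen so that
    no point of \<open>A'\<close> has this direction.\<close>
  have "finite ((\<lambda>P. y P / x P) ` A')" using finA' by simp
  then obtain \<sigma> where \<sigma>: "\<sigma> \<notin> (\<lambda>P. y P / x P) ` A'"
    using ex_new_if_finite[OF infinite_UNIV_char_0] by blast
  have nz: "y P - \<sigma> * x P \<noteq> 0" if P: "P \<in> A'" for P
  proof
    assume 0: "y P - \<sigma> * x P = 0"
    show False
    proof (cases "x P = 0")
      case True
      then have "rep_vec P = 0" using 0 xy[OF P] by simp
      then show False using rep_vec_nz by blast
    next
      case False
      then have "\<sigma> = y P / x P" using 0 by (simp add: field_simps)
      then show False using \<sigma> P by blast
    qed
  qed
  define \<Phi> where "\<Phi> j = [: ?q $ j, ?p $ j + \<sigma> * ?q $ j :]" for j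
  show ?thesis
  proof (rule curve_family[OF T rk A, of A' m 1 \<Phi>])
    show "A' \<subseteq> A" using A'(1) by blast
    show "degree (\<Phi> j) \<le> 1" for j by (simp add: \<Phi>_def)
    fix P assume P: "P \<in> A'"
    define k where "k = y P - \<sigma> * x P"
    have k: "k \<noteq> 0" using nz[OF P] by (simp add: k_def)
    have "poly (\<Phi> j) (x P / k) = (1 / k) * rep_vec P $ j" for j
    proof -
      have "poly (\<Phi> j) (x P / k) = (k * ?q $ j + x P * (?p $ j + \<sigma> * ?q $ j)) / k"
        using k by (simp add: \<Phi>_def add_divide_distrib)
      also have "k * ?q $ j + x P * (?p $ j + \<sigma> * ?q $ j) = rep_vec P $ j"
        by (subst xy[OF P]) (simp add: k_def algebra_simps)
      finally show ?thesis by simp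
    qed
    then have "(\<chi> j. poly (\<Phi> j) (x P / k)) = (1 / k) *s rep_vec P"
      by (simp add: cart_eq_iff)
    moreover have "(1 / k) *s rep_vec P \<in> reps P" using k by (intro reps_scale rep_vec_reps) simp
    ultimately show "\<exists>s. (\<chi> j. poly (\<Phi> j) s) \<in> reps P" by (intro exI[of _ "x P / k"]) simp
  qed (use A'(2) d in simp_all)
qed

lemma rep_vec_eq_iff: "rep_vec P = rep_vec Q \<longleftrightarrow> P = Q"
  by (metis pt_of_rep_vec)

lemma independent_triple:
  assumes "p \<noteq> 0" "q \<notin> vec.span {p}" "s \<notin> vec.span {p, q}"
  shows "vec.independent {s, q, p :: complex ^ 'n}"
proof -
  have "vec.independent {p}" using assms(1) by simp
  then have "vec.independent {q, p}" by (rule vec.independent_insertI[OF assms(2)])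
  moreover have "s \<notin> vec.span {q, p}" using assms(3) by (simp only: insert_commute[of q p] not_False_eq_True)
  ultimately show ?thesis by (rule vec.independent_insertI[rotated])
qed

text \<open>A conic without a line in it is parametrised by projection from one of its points \<open>p\<close>: the
  line through \<open>p\<close> and \<open>w\<close> meets it again in \<open>b w w *s p - 2 b p w *s w\<close>.\<close>

lemma conic_family:
  fixes T :: "3 cpoly" and b :: "complex ^ 3 \<Rightarrow> complex ^ 3 \<Rightarrow> complex"
  assumes T: "is_form d T" and rk: "form_rank d T = r" and A: "card A = r" "decomposition d T A"
    and d: "d = 2 * m" "m \<ge> 1"
    and add: "\<And>u v w. b (u + v) w = b u w + b v w" and scale: "\<And>c u w. b (c *s u) w = c * b u w"
    and sym: "\<And>u v. b u v = b v u" and nz: "b z z \<noteq> 0"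
    and many: "card {P \<in> A. b (rep_vec P) (rep_vec P) = 0} \<ge> 2 * m + 1"
  shows "\<exists>W. positive_dim_family d T r A W"
proof -
  have add': "b u (v + w) = b u v + b u w" for u v w using add[of v w u] by (simp add: sym)
  have scale': "b u (c *s w) = c * b u w" for c u w using scale[of c w u] by (simp add: sym)
  note bil = add add' scale scale'
  obtain A' where A'0: "A' \<subseteq> {P \<in> A. b (rep_vec P) (rep_vec P) = 0}" "card A' = 2 * m + 1"
    using many by (meson obtain_subset_with_card_n)
  have A': "A' \<subseteq> A" "\<And>P. P \<in> A' \<Longrightarrow> b (rep_vec P) (rep_vec P) = 0" using A'0(1) by auto
  have finA: "finite A" using A(2) by (simp add: decomposition_iff)
  have finA': "finite A'" using A'(1) finA by (rule finite_subset)
  have dim3: "vec.dim (UNIV :: (complex ^ 3) set) = 3" unfolding vec_dim_card by simp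
  show ?thesis
  proof (cases "\<exists>p w. p \<noteq> 0 \<and> w \<notin> vec.span {p} \<and> b p p = 0 \<and> b p w = 0 \<and> b w w = 0")
    case True
    then obtain p w where pw: "p \<noteq> 0" "w \<notin> vec.span {p}" "b p p = 0" "b p w = 0" "b w w = 0" by blast
    have K1: "vec.span {p, w} \<noteq> UNIV"
    proof
      assume "vec.span {p, w} = UNIV"
      then have "vec.dim (UNIV :: (complex ^ 3) set) \<le> card {p, w}"
        by (intro vec.dim_le_card) auto
      also have "card {p, w} \<le> 2" by (simp add: card_insert_if)
      finally show False using dim3 by simp
    qed
    then obtain u where u: "u \<notin> vec.span {p, w}" by blast
    have ind: "vec.independent {u, w, p}"
      by (rule independent_triple[OF pw(1,2) u])
    have "u \<noteq> w" "u \<noteq> p" "w \<noteq> p" using u pw(2) by (auto simp: vec.span_base)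
    then have "card {u, w, p} = 3" by simp
    then have sp: "UNIV \<subseteq> vec.span {u, w, p}"
      using vec.card_ge_dim_independent[of "{u, w, p}" UNIV] ind dim3 by simp
    have coords: "\<exists>x y z. v = x *s p + y *s w + z *s u" for v
    proof -
      have "v \<in> vec.span (insert u {p, w})" using sp by (auto simp: insert_commute)
      then obtain z where "v - z *s u \<in> vec.span {p, w}" by (auto simp: vec.span_insert)
      then obtain x y where "v - z *s u = x *s p + y *s w" unfolding span_pair by blast
      then have "v = x *s p + y *s w + z *s u" by (simp add: algebra_simps)
      then show ?thesis by blast
    qed
    \<comment> \<open>The span of \<open>p\<close> and \<open>w\<close> is isotropic, so the
      quadratic form is divisible by the coordinate \<open>z\<close>; the other factor cuts out
      \<open>K2\<close>. One of the two planes must receive \<open>m + 1\<close> of the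
      points.\<close>
    have Q: "b (x *s p + y *s w + z *s u) (x *s p + y *s w + z *s u) =
        z * (2 * x * b p u + 2 * y * b w u + z * b u u)" for x y z
      using pw sym[of w p] sym[of u p] sym[of u w] by (simp add: bil algebra_simps)
    define K2 where "K2 = {v. \<exists>x y z. v = x *s p + y *s w + z *s u \<and> 2 * x * b p u + 2 * y * b w u + z * b u u = 0}"
    have subK2: "vec.subspace K2"
    proof (rule vec.subspaceI)
      show "0 \<in> K2" unfolding K2_def by (intro CollectI exI[of _ 0]) simp
    next
      fix v v' assume "v \<in> K2" "v' \<in> K2"
      then obtain x y z x' y' z' where v: "v = x *s p + y *s w + z *s u" "2 * x * b p u + 2 * y * b w u + z * b u u = 0"
        "v' = x' *s p + y' *s w + z' *s u" "2 * x' * b p u + 2 * y' * b w u + z' * b u u = 0"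
        unfolding K2_def by blast
      have "v + v' = (x + x') *s p + (y + y') *s w + (z + z') *s u"
        by (simp add: v vec.scale_left_distrib)
      moreover have "2 * (x + x') * b p u + 2 * (y + y') * b w u + (z + z') * b u u =
          (2 * x * b p u + 2 * y * b w u + z * b u u) + (2 * x' * b p u + 2 * y' * b w u + z' * b u u)"
        by (simp add: algebra_simps)
      ultimately show "v + v' \<in> K2"
        unfolding K2_def using v(2,4)
        by (intro CollectI exI[of _ "x + x'"] exI[of _ "y + y'"] exI[of _ "z + z'"] conjI) (simp_all only: add_0)
    next
      fix c v assume "v \<in> K2"
      then obtain x y z where v: "v = x *s p + y *s w + z *s u" "2 * x * b p u + 2 * y * b w u + z * b u u = 0"
        unfolding K2_def by blast
      have "c *s v = (c * x) *s p + (c * y) *s w + (c * z) *s u"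
        by (simp add: v vec.scale_right_distrib)
      moreover have "2 * (c * x) * b p u + 2 * (c * y) * b w u + (c * z) * b u u = c * (2 * x * b p u + 2 * y * b w u + z * b u u)"
        by (simp add: algebra_simps)
      ultimately show "c *s v \<in> K2"
        unfolding K2_def using v(2)
        by (intro CollectI exI[of _ "c * x"] exI[of _ "c * y"] exI[of _ "c * z"] conjI) (simp_all only: mult_zero_right)
    qed
    have K2: "K2 \<noteq> UNIV"
    proof
      assume "K2 = UNIV"
      then have "z \<in> K2" by blast
      then obtain x y t where v: "z = x *s p + y *s w + t *s u" "2 * x * b p u + 2 * y * b w u + t * b u u = 0"
        unfolding K2_def by blast
      have "b z z = 0" unfolding v(1) Q v(2) by simp
      then show False using nz by simp
    qed
    have cover: "A' \<subseteq> {P \<in> A. rep_vec P \<in> vec.span {p, w}} \<union> {P \<in> A. rep_vec P \<in> K2}"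
    proof
      fix P assume P: "P \<in> A'"
      obtain x y t where v: "rep_vec P = x *s p + y *s w + t *s u" using coords by blast
      have "t * (2 * x * b p u + 2 * y * b w u + t * b u u) = 0" using A'(2)[OF P] unfolding v Q .
      then consider "t = 0" | "2 * x * b p u + 2 * y * b w u + t * b u u = 0" by auto
      then show "P \<in> {P \<in> A. rep_vec P \<in> vec.span {p, w}} \<union> {P \<in> A. rep_vec P \<in> K2}"
      proof cases
        case 1
        then have "rep_vec P \<in> vec.span {p, w}" using v unfolding span_pair by auto
        then show ?thesis using P A'(1) by blast
      next
        case 2
        then have "rep_vec P \<in> K2" unfolding K2_def using v by blast
        then show ?thesis using P A'(1) by blast
      qed
    qed
    have "card A' \<le> card ({P \<in> A. rep_vec P \<in> vec.span {p, w}} \<union> {P \<in> A. rep_vec P \<in> K2})"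
      using finA by (intro card_mono cover) auto
    also have "\<dots> \<le> card {P \<in> A. rep_vec P \<in> vec.span {p, w}} + card {P \<in> A. rep_vec P \<in> K2}" by (rule card_Un_le)
    finally have "card {P \<in> A. rep_vec P \<in> vec.span {p, w}} \<ge> Suc m \<or> card {P \<in> A. rep_vec P \<in> K2} \<ge> Suc m"
      using A'0(2) by linarith
    then show ?thesis
      using plane_family[OF T rk A d vec.subspace_span K1] plane_family[OF T rk A d subK2 K2] by blast
  next
    case False
    then have smooth: "\<not> (b p p = 0 \<and> b p w = 0 \<and> b w w = 0)" if "p \<noteq> 0" "w \<notin> vec.span {p}" for p w
      using that by blast
    have "card A' \<ge> 3" using A'0(2) d(2) by simp
    then obtain U where "U \<subseteq> A'" "card U = 3" by (meson obtain_subset_with_card_n)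
    then obtain P0 P1 P2 where P012: "P0 \<in> A'" "P1 \<in> A'" "P2 \<in> A'" "P0 \<noteq> P1" "P2 \<noteq> P0" "P1 \<noteq> P2"
      by (auto simp: card_3_iff)
    let ?p = "rep_vec P0" and ?q = "rep_vec P1" and ?s = "rep_vec P2"
    \<comment> \<open>Otherwise the whole line through the two points would lie on the conic, which
      this case excludes.\<close>
    have bp: "b ?p (rep_vec P) \<noteq> 0" if "P \<in> A'" "P \<noteq> P0" for P
      using smooth[OF rep_vec_nz rep_vec_not_in_span[of P0 P]] that A'(2) P012(1) by auto
    have snot: "?s \<notin> vec.span {?p, ?q}"
    proof
      assume "?s \<in> vec.span {?p, ?q}"
      then obtain x y where s: "?s = x *s ?p + y *s ?q" unfolding span_pair by blast
      have "b ?s ?s = 2 * x * y * b ?p ?q"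
        unfolding s using A'(2)[OF P012(1)] A'(2)[OF P012(2)] sym[of ?q ?p] by (simp add: bil algebra_simps)
      then have "x = 0 \<or> y = 0" using A'(2)[OF P012(3)] bp[OF P012(2)] P012(4) by auto
      then have "?s \<in> vec.span {?q} \<or> ?s \<in> vec.span {?p}" using s by (auto simp: vec.span_singleton)
      then show False using rep_vec_not_in_span[of P1 P2] rep_vec_not_in_span[of P0 P2] P012(5,6) by simp
    qed
    have ind: "vec.independent {?s, ?q, ?p}"
      by (rule independent_triple[OF rep_vec_nz rep_vec_not_in_span[OF P012(4)] snot])
    have "?s \<noteq> ?q" "?s \<noteq> ?p" "?q \<noteq> ?p" using P012(4-6) by (simp_all add: rep_vec_eq_iff)
    then have "card {?s, ?q, ?p} = 3" by simp
    then have sp: "UNIV \<subseteq> vec.span {?s, ?q, ?p}"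
      using vec.card_ge_dim_independent[of "{?s, ?q, ?p}" UNIV] ind dim3 by simp
    have coords: "\<exists>xyz. v = fst xyz *s ?p + fst (snd xyz) *s ?q + snd (snd xyz) *s ?s" for v
    proof -
      have "v \<in> vec.span (insert ?s {?p, ?q})" using sp by (auto simp: insert_commute)
      then obtain z where "v - z *s ?s \<in> vec.span {?p, ?q}" by (auto simp: vec.span_insert)
      then obtain x y where "v - z *s ?s = x *s ?p + y *s ?q" unfolding span_pair by blast
      then have "v = x *s ?p + y *s ?q + z *s ?s" by (simp add: algebra_simps)
      then show ?thesis by (intro exI[of _ "(x, y, z)"]) simp
    qed
    then obtain xyz where xyz0: "\<forall>P. rep_vec P = fst (xyz P) *s ?p + fst (snd (xyz P)) *s ?q + snd (snd (xyz P)) *s ?s"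
      using choice[of "\<lambda>P xyz. rep_vec P = fst xyz *s ?p + fst (snd xyz) *s ?q + snd (snd xyz) *s ?s"] by blast
    define x y z where "x P = fst (xyz P)" and "y P = fst (snd (xyz P))" and "z P = snd (snd (xyz P))" for P
    have xyz: "rep_vec P = x P *s ?p + y P *s ?q + z P *s ?s" for P
      unfolding x_def y_def z_def by (rule spec[OF xyz0])
    \<comment> \<open>The first excluded value would make \<open>w1\<close> a tangent direction at
      \<open>P0\<close>, leaving \<open>P0\<close> without a parameter; the others would put a point
      of \<open>A'\<close> at the infinite parameter.\<close>
    have "finite (insert (- b ?p ?q / b ?p ?s) ((\<lambda>P. z P / y P) ` A'))" using finA' by simp
    then obtain \<sigma> where \<sigma>: "\<sigma> \<notin> insert (- b ?p ?q / b ?p ?s) ((\<lambda>P. z P / y P) ` A')"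
      using ex_new_if_finite[OF infinite_UNIV_char_0] by blast
    define w1 where "w1 = ?q + \<sigma> *s ?s"
    define w where "w t = ?s + t *s w1" for t
    have bps: "b ?p ?s \<noteq> 0" using bp[OF P012(3,5)] .
    have bpw1: "b ?p w1 \<noteq> 0"
    proof
      assume "b ?p w1 = 0"
      then have "b ?p ?q + \<sigma> * b ?p ?s = 0" by (simp add: w1_def bil)
      then have "\<sigma> = - b ?p ?q / b ?p ?s" using bps by (simp add: field_simps add_eq_0_iff)
      then show False using \<sigma> by blast
    qed
    \<comment> \<open>The second intersection point for the direction \<open>w t\<close>, expanded
      in powers of \<open>t\<close>.\<close>
    define \<Phi> where "\<Phi> j = [: ?p $ j * b ?s ?s - 2 * (b ?p ?s * ?s $ j),
        2 * (?p $ j * b ?s w1) - 2 * (b ?p ?s * w1 $ j + b ?p w1 * ?s $ j),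
        ?p $ j * b w1 w1 - 2 * (b ?p w1 * w1 $ j) :]" for j
    have \<Phi>: "(\<chi> j. poly (\<Phi> j) t) = b (w t) (w t) *s ?p - (2 * b ?p (w t)) *s w t" for t
    proof -
      have "poly (\<Phi> j) t = b (w t) (w t) * ?p $ j - 2 * b ?p (w t) * w t $ j" for j
        using sym[of w1 ?s] by (simp add: \<Phi>_def w_def bil algebra_simps)
      then show ?thesis by (simp add: cart_eq_iff)
    qed
    show ?thesis
    proof (rule curve_family[OF T rk A A'(1), of "2 * m" 2 \<Phi>])
      show "degree (\<Phi> j) \<le> 2" for j by (simp add: \<Phi>_def)
      fix P assume P: "P \<in> A'"
      show "\<exists>t. (\<chi> j. poly (\<Phi> j) t) \<in> reps P"
      proof (cases "P = P0")
        case True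
        \<comment> \<open>For the tangent direction at \<open>P0\<close> the second intersection is
          \<open>P0\<close> itself.\<close>
        define t where "t = - b ?p ?s / b ?p w1"
        have "b ?p (w t) = b ?p ?s + t * b ?p w1" unfolding w_def by (simp only: bil)
        then have bt: "b ?p (w t) = 0" using bpw1 by (simp add: t_def)
        have "w t \<notin> vec.span {?p}"
        proof
          assume "w t \<in> vec.span {?p}"
          then obtain c where c: "w t = c *s ?p" by (auto simp: vec.span_singleton)
          have e: "(1 + t * \<sigma>) *s ?s = c *s ?p + (- t) *s ?q"
          proof -
            have "(1 + t * \<sigma>) *s ?s = w t + (- t) *s ?q"
              by (simp add: w_def w1_def cart_eq_iff algebra_simps)
            then show ?thesis by (simp only: c)
          qed
          show False
          proof (cases "1 + t * \<sigma> = 0")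
            case False
            have "(1 / (1 + t * \<sigma>)) *s ((1 + t * \<sigma>) *s ?s) \<in> vec.span {?p, ?q}"
              unfolding e by (intro vec.span_scale vec.span_add vec.span_base) auto
            moreover have "(1 / K) *s (K *s ?s) = ?s" if "K \<noteq> 0" for K using that by simp
            ultimately show False using snot False by metis
          next
            case True
            then have tn: "t \<noteq> 0" by auto
            have "c *s ?p + (- t) *s ?q = 0" using e unfolding True by simp
            then have "c *s ?p = t *s ?q" by (simp add: cart_eq_iff)
            then have "t *s ?q = c *s ?p" by (rule HOL.sym)
            then have "?q = (c / t) *s ?p" using tn
              by (metis (no_types) divide_inverse_commute vec.scale_scale vec.scale_one left_inverse)
            then show False using rep_vec_not_in_span[OF P012(4)] by (auto simp: vec.span_singleton)
          qed
        qed
        then have Qt: "b (w t) (w t) \<noteq> 0" using smooth[OF rep_vec_nz] bt A'(2)[OF P012(1)] by blast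
        have "(\<chi> j. poly (\<Phi> j) t) = b (w t) (w t) *s ?p" unfolding \<Phi> bt by simp
        then show ?thesis using reps_scale[OF rep_vec_reps[of P0] Qt] True by (intro exI[of _ t]) simp
      next
        case False
        \<comment> \<open>Projection from \<open>P0\<close> sends \<open>P\<close> to y q + z s,
          which is \<open>k\<close> times \<open>w t\<close> for \<open>t = y P / k\<close>.\<close>
        define k where "k = z P - \<sigma> * y P"
        have k: "k \<noteq> 0"
        proof
          assume 0: "k = 0"
          show False
          proof (cases "y P = 0")
            case True
            then have "rep_vec P = x P *s ?p" using 0 xyz[of P] by (simp add: k_def)
            then show False using rep_vec_not_in_span[of P0 P] False by (auto simp: vec.span_singleton)
          next
            case y: False
            then have "\<sigma> = z P / y P" using 0 by (simp add: k_def field_simps)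
            then show False using \<sigma> P by blast
          qed
        qed
        define t where "t = y P / k"
        have kw: "k *s w t = y P *s ?q + z P *s ?s"
        proof -
          have kt: "k * t = y P" using k by (simp add: t_def)
          have "k *s w t = k *s ?s + (k * t) *s w1" by (simp add: w_def vec.scale_right_distrib)
          then show ?thesis
            unfolding kt by (simp add: k_def w1_def cart_eq_iff algebra_simps)
        qed
        have P_eq: "rep_vec P = x P *s ?p + k *s w t" unfolding kw by (subst xyz[of P]) (simp add: algebra_simps)
        have "b ?p (rep_vec P) = k * b ?p (w t)" by (subst P_eq) (simp add: bil A'(2)[OF P012(1)])
        then have bw: "b ?p (w t) \<noteq> 0" using bp[OF P False] by auto
        have "b (rep_vec P) (rep_vec P) = k * (2 * x P * b ?p (w t) + k * b (w t) (w t))"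
          unfolding P_eq using sym[of "w t" ?p] by (simp add: bil A'(2)[OF P012(1)] algebra_simps)
        then have q: "k * b (w t) (w t) = - 2 * x P * b ?p (w t)"
          using A'(2)[OF P] k by (simp add: add_eq_0_iff2)
        have "k *s (\<chi> j. poly (\<Phi> j) t) = (k * b (w t) (w t)) *s ?p - (2 * b ?p (w t)) *s (k *s w t)"
          unfolding \<Phi> by (simp add: cart_eq_iff algebra_simps)
        also have "\<dots> = (- 2 * b ?p (w t)) *s rep_vec P"
          unfolding q by (subst P_eq) (simp add: cart_eq_iff algebra_simps)
        finally have "(1 / k) *s (k *s (\<chi> j. poly (\<Phi> j) t)) = (1 / k) *s ((- 2 * b ?p (w t)) *s rep_vec P)" by simp
        then have "(\<chi> j. poly (\<Phi> j) t) = (- 2 * b ?p (w t) / k) *s rep_vec P" using k by simp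
        moreover have "(- 2 * b ?p (w t) / k) *s rep_vec P \<in> reps P" using k bw by (intro reps_scale rep_vec_reps) simp
        ultimately show ?thesis by (intro exI[of _ t]) simp
      qed
    qed (use A'0(2) d in simp_all)
  qed
qed

section \<open>Two minimal decompositions\<close>

definition forms :: "nat \<Rightarrow> (complex ^ 'n::finite \<Rightarrow> complex) set" where
  "forms d = fs.span ((\<lambda>u v. vmon v u) ` {u. tdeg u = d})"

lemma forms_linear_mult:
  assumes "f \<in> forms d"
  shows "(\<lambda>v. (\<Sum>j\<in>UNIV. l $ j * v $ j) * f v) \<in> forms (Suc d)"
  using assms unfolding forms_def
proof (rule span_mult_closed)
  fix x assume "x \<in> (\<lambda>u v. vmon v u) ` {u :: 'a \<Rightarrow>\<^sub>0 nat. tdeg u = d}"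
  then obtain u :: "'a \<Rightarrow>\<^sub>0 nat" where u: "tdeg u = d" "x = (\<lambda>v. vmon v u)" by blast
  have "(\<lambda>v. (\<Sum>j\<in>UNIV. l $ j * v $ j) * x v) =
      (\<Sum>j\<in>UNIV. fscale (l $ j) (\<lambda>v. vmon v (unit_mon j + u)))"
    unfolding fun_eq_iff sum_fun_apply
    by (simp only: fscale_def u(2) monom_eval_add monom_eval_unit_mon sum_distrib_right mult.assoc) simp
  also have "\<dots> \<in> fs.span ((\<lambda>u v. vmon v u) ` {u. tdeg u = Suc d})"
    by (intro fs.span_sum fs.span_scale fs.span_base image_eqI[OF refl] CollectI)
      (simp only: tdeg_unit_mon_add u(1))
  finally show "(\<lambda>v. (\<Sum>j\<in>UNIV. l $ j * v $ j) * x v) \<in>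
      fs.span ((\<lambda>u v. vmon v u) ` {u. tdeg u = Suc d})" .
qed

lemma forms_linear_power_mult:
  "f \<in> forms d \<Longrightarrow> (\<lambda>v. (\<Sum>j\<in>UNIV. l $ j * v $ j) ^ k * f v) \<in> forms (k + d)"
proof (induction k)
  case (Suc k)
  then show ?case using forms_linear_mult[of "\<lambda>v. (\<Sum>j\<in>UNIV. l $ j * v $ j) ^ k * f v" "k + d" l]
    by (simp add: mult.assoc)
qed simp

lemma forms_relation:
  assumes f: "f \<in> forms d" and c: "\<And>u. tdeg u = d \<Longrightarrow> (\<Sum>P\<in>S. c P * vmon (g P) u) = 0"
  shows "(\<Sum>P\<in>S. c P * f (g P)) = 0"
  using f unfolding forms_def
proof (induction rule: fs.span_induct_alt)
  case (step k x y)
  then obtain u where u: "tdeg u = d" "x = (\<lambda>v. vmon v u)" by blast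
  have "(\<Sum>P\<in>S. c P * (fscale k x + y) (g P)) = k * (\<Sum>P\<in>S. c P * x (g P)) + (\<Sum>P\<in>S. c P * y (g P))"
    by (simp add: fscale_def algebra_simps sum.distrib sum_distrib_left)
  then show ?case using step c[OF u(1)] u(2) by simp
qed simp

text \<open>The functionals with coefficients (s^2, s, 1) lie on a conic, so a nonzero vector is
  killed by at most two values of \<open>s\<close>; finitely many vectors exclude finitely
  many.\<close>

lemma nonvanishing_functional:
  fixes Z :: "(complex ^ 3) set"
  assumes "finite Z" "0 \<notin> Z"
  obtains s where "\<And>v. v \<in> Z \<Longrightarrow> s\<^sup>2 * v $ 1 + s * v $ 2 + v $ 3 \<noteq> 0"
proof -
  let ?R = "\<Union>v\<in>Z. {s. poly [: v $ 3, v $ 2, v $ 1 :] s = 0}"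
  have "finite ?R"
  proof (intro finite_UN_I assms(1) poly_roots_finite)
    fix v assume "v \<in> Z"
    then have "v \<noteq> 0" using assms(2) by blast
    then show "[: v $ 3, v $ 2, v $ 1 :] \<noteq> 0" by (auto simp: cart_eq_iff forall_3)
  qed
  then obtain s where s: "s \<notin> ?R" using ex_new_if_finite[OF infinite_UNIV_char_0] by blast
  show thesis
    by (rule that[of s]) (use s in \<open>auto simp: algebra_simps power2_eq_square\<close>)
qed

text \<open>Where \<open>R\<close> fails, \<open>A\<close> and \<open>B\<close> coincide. As they
  have equal size, they also contain equally many points with \<open>R\<close>, and together these
  cover \<open>S\<close>.\<close>

lemma card_common_part:
  assumes "finite A" "finite B" "card A = card B" "S \<subseteq> A \<union> B" "\<And>P. P \<in> S \<Longrightarrow> R P"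
    "\<And>P. P \<in> A - B \<Longrightarrow> P \<in> S" "\<And>P. P \<in> B - A \<Longrightarrow> P \<in> S"
  shows "card S \<le> 2 * card {P \<in> A. R P}"
proof -
  have eq: "{P \<in> A. \<not> R P} = {P \<in> B. \<not> R P}" using assms(5-7) by blast
  have "card A = card {P \<in> A. R P} + card {P \<in> A. \<not> R P}" if "finite A" for A :: "'a set"
    using card_Un_disjoint[of "{P \<in> A. R P}" "{P \<in> A. \<not> R P}"] that
    by (simp add: Un_def conj_disj_distribL[symmetric] disjoint_iff)
  from this[OF assms(1)] this[OF assms(2)] have "card {P \<in> A. R P} = card {P \<in> B. R P}"
    using eq assms(3) by simp
  moreover have "S \<subseteq> {P \<in> A. R P} \<union> {P \<in> B. R P}" using assms(4,5) by blast
  then have "card S \<le> card ({P \<in> A. R P} \<union> {P \<in> B. R P})" using assms(1,2) by (intro card_mono) auto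
  then have "card S \<le> card {P \<in> A. R P} + card {P \<in> B. R P}" using card_Un_le order_trans by blast
  ultimately show ?thesis by simp
qed

text \<open>In the affine chart where \<open>\<zeta>\<close>, a functional that vanishes at none of the points, equals 1, the
  difference of two minimal power sum expressions becomes a full relation on a finite plane set.\<close>

lemma two_decompositions_on_line_or_conic:
  fixes T :: "3 cpoly"
  assumes T: "is_form d T" and rk: "form_rank d T = r" and A: "card A = r" "decomposition d T A"
    and B: "card B = r" "decomposition d T B" and ne: "A \<noteq> B" and r: "2 * r + 1 \<le> 3 * d"
  obtains (line) K where "vec.subspace K" "K \<noteq> UNIV" "2 * card {P \<in> A. rep_vec P \<in> K} \<ge> d + 2"
  | (conic) b z where "\<And>u v w. b (u + v) w = b u w + b v w" "\<And>c u w. b (c *s u) w = c * b u w"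
      "\<And>u v. b u v = b v u" "b z z \<noteq> 0" "2 * card {P \<in> A. b (rep_vec P) (rep_vec P) = 0} \<ge> 2 * d + 2"
proof -
  have finA: "finite A" and finB: "finite B" using A(2) B(2) by (simp_all add: decomposition_iff)
  obtain a0 where a0: "T = (\<Sum>P\<in>A. cscale (a0 P) (linear_form (rep_vec P) ^ d))" using A(2) by (auto simp: decomposition_iff)
  obtain b0 where b0: "T = (\<Sum>P\<in>B. cscale (b0 P) (linear_form (rep_vec P) ^ d))" using B(2) by (auto simp: decomposition_iff)
  have a0nz: "a0 P \<noteq> 0" if "P \<in> A" for P
    by (rule minimal_coefficient_nz[OF finA a0 _ that]) (simp add: rk A)
  have b0nz: "b0 P \<noteq> 0" if "P \<in> B" for P
    by (rule minimal_coefficient_nz[OF finB b0 _ that]) (simp add: rk B)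
  define c where "c P = (if P \<in> A then a0 P else 0) - (if P \<in> B then b0 P else 0)" for P
  define S where "S = {P \<in> A \<union> B. c P \<noteq> 0}"
  have finS: "finite S" using finA finB by (simp add: S_def)
  have S1: "P \<in> S" if "P \<in> A - B" for P using that a0nz[of P] by (simp add: S_def c_def)
  have S2: "P \<in> S" if "P \<in> B - A" for P using that b0nz[of P] by (simp add: S_def c_def)
  have SAB: "S \<subseteq> A \<union> B" by (auto simp: S_def)
  have "\<not> A \<subseteq> B" using card_subset_eq[OF finB, of A] A(1) B(1) ne by auto
  then have Sne: "S \<noteq> {}" using S1 by blast
  have cardS: "card S \<le> 2 * r"
    using card_mono[OF _ SAB] finA finB card_Un_le[of A B] A(1) B(1) by simp
  have rel: "(\<Sum>P\<in>S. c P * vmon (rep_vec P) u) = 0" if u: "tdeg u = d" for u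
  proof -
    let ?m = "\<lambda>P. vmon (rep_vec P) u"
    have "(\<Sum>P\<in>S. c P * ?m P) = (\<Sum>P\<in>A \<union> B. c P * ?m P)"
      using finA finB by (intro sum.mono_neutral_left) (auto simp: S_def)
    also have "\<dots> = (\<Sum>P\<in>A \<union> B. if P \<in> A then a0 P * ?m P else 0) - (\<Sum>P\<in>A \<union> B. if P \<in> B then b0 P * ?m P else 0)"
      unfolding sum_subtractf[symmetric] by (intro sum.cong) (auto simp: c_def algebra_simps)
    also have "(\<Sum>P\<in>A \<union> B. if P \<in> A then a0 P * ?m P else 0) = (\<Sum>P\<in>A. a0 P * ?m P)"
      using finA finB by (intro sum.mono_neutral_cong_right) auto
    also have "(\<Sum>P\<in>A \<union> B. if P \<in> B then b0 P * ?m P else 0) = (\<Sum>P\<in>B. b0 P * ?m P)"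
      using finA finB by (intro sum.mono_neutral_cong_right) auto
    also have "(\<Sum>P\<in>A. a0 P * ?m P) = coef d T u"
      using iffD1[OF power_sum_eq_iff[OF T] a0] u by simp
    also have "(\<Sum>P\<in>B. b0 P * ?m P) = coef d T u"
      using iffD1[OF power_sum_eq_iff[OF T] b0] u by simp
    finally show ?thesis by simp
  qed
  have Z: "finite (rep_vec ` S)" "0 \<notin> rep_vec ` S" using finS rep_vec_nz by (auto simp: image_iff)
  obtain s where s: "\<And>v. v \<in> rep_vec ` S \<Longrightarrow> s\<^sup>2 * v $ 1 + s * v $ 2 + v $ 3 \<noteq> 0"
    by (rule nonvanishing_functional[OF Z]) blast
  define \<zeta> :: "complex ^ 3 \<Rightarrow> complex" where "\<zeta> v = s\<^sup>2 * v $ 1 + s * v $ 2 + v $ 3" for v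
  have \<zeta>nz: "\<zeta> (rep_vec P) \<noteq> 0" if "P \<in> S" for P using s[of "rep_vec P"] that by (simp add: \<zeta>_def)
  define pt where "pt P = (rep_vec P $ 1 / \<zeta> (rep_vec P), rep_vec P $ 2 / \<zeta> (rep_vec P))" for P
  have inj: "inj_on pt S"
  proof (rule inj_onI)
    fix P Q assume PQ: "P \<in> S" "Q \<in> S" "pt P = pt Q"
    let ?v = "rep_vec P" and ?w = "rep_vec Q"
    have 12: "?v $ 1 = \<zeta> ?v / \<zeta> ?w * ?w $ 1" "?v $ 2 = \<zeta> ?v / \<zeta> ?w * ?w $ 2"
      using PQ \<zeta>nz[OF PQ(1)] \<zeta>nz[OF PQ(2)] by (auto simp: pt_def field_simps)
    have "?v $ 3 = \<zeta> ?v - s\<^sup>2 * ?v $ 1 - s * ?v $ 2" by (simp add: \<zeta>_def)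
    also have "\<dots> = \<zeta> ?v / \<zeta> ?w * (\<zeta> ?w - s\<^sup>2 * ?w $ 1 - s * ?w $ 2)"
      unfolding 12 right_diff_distrib using \<zeta>nz[OF PQ(2)] by (simp add: mult_ac)
    also have "\<zeta> ?w - s\<^sup>2 * ?w $ 1 - s * ?w $ 2 = ?w $ 3" by (simp add: \<zeta>_def)
    finally have "?v = (\<zeta> ?v / \<zeta> ?w) *s ?w"
      using 12 by (simp add: cart_eq_iff forall_3)
    then have "?v \<in> vec.span {?w}" by (auto simp: vec.span_singleton)
    then show "P = Q" using rep_vec_not_in_span[of Q P] by blast
  qed
  \<comment> \<open>Division of the coordinates by \<open>\<zeta>\<close> is compensated in degree
    \<open>d\<close> by the factor \<open>\<zeta> ^ d\<close>.\<close>
  define c' where "c' p = c (the_inv_into S pt p) * \<zeta> (rep_vec (the_inv_into S pt p)) ^ d" for p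
  have c': "c' (pt P) = c P * \<zeta> (rep_vec P) ^ d" if "P \<in> S" for P
    using the_inv_into_f_f[OF inj that] by (simp add: c'_def)
  have full: "full_relation d (pt ` S) c'"
    unfolding full_relation_def
  proof (intro conjI ballI)
    show "finite (pt ` S)" using finS by simp
    show "c' p \<noteq> 0" if "p \<in> pt ` S" for p using that c' \<zeta>nz by (auto simp: S_def)
    fix f assume "f \<in> Pol d"
    then show "(\<Sum>p\<in>pt ` S. c' p * f p) = 0"
    proof (rule span_weighted_sum_zero)
      fix x assume "x \<in> mons UNIV d"
      then obtain i j where ij: "i + j \<le> d" "x = mon_on UNIV i j" by (auto simp: mons_def)
      \<comment> \<open>\<open>?f\<close> is the monomial with exponents \<open>i\<close>,
        \<open>j\<close> homogenised to degree \<open>d\<close> by \<open>\<zeta>\<close>, the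
        linear form with coefficient vector \<open>?l3\<close>.\<close>
      let ?l1 = "axis 1 1 :: complex ^ 3" and ?l2 = "axis 2 1 :: complex ^ 3"
      let ?l3 = "vector [s\<^sup>2, s, 1] :: complex ^ 3"
      let ?f = "\<lambda>v :: complex ^ 3. (\<Sum>j\<in>UNIV. ?l1 $ j * v $ j) ^ i * ((\<Sum>j\<in>UNIV. ?l2 $ j * v $ j) ^ j *
        ((\<Sum>j\<in>UNIV. ?l3 $ j * v $ j) ^ (d - i - j) * vmon v 0))"
      have "(\<lambda>v. vmon v (0 :: 3 \<Rightarrow>\<^sub>0 nat)) \<in> forms 0"
        unfolding forms_def by (rule fs.span_base) (simp add: tdeg_eq_0_iff)
      then have "?f \<in> forms (i + (j + (d - i - j + 0)))"
        by (intro forms_linear_power_mult)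
      then have "?f \<in> forms d" using ij(1) by simp
      then have "(\<Sum>P\<in>S. c P * ?f (rep_vec P)) = 0" by (rule forms_relation) (rule rel)
      moreover have "(\<Sum>p\<in>pt ` S. c' p * x p) = (\<Sum>P\<in>S. c P * ?f (rep_vec P))"
        unfolding sum.reindex[OF inj] o_def
      proof (rule sum.cong[OF refl])
        fix P assume P: "P \<in> S"
        have f: "?f v = v $ 1 ^ i * (v $ 2 ^ j * \<zeta> v ^ (d - i - j))" for v
          by (simp add: sum_3 axis_def \<zeta>_def monom_eval_def)
        have "\<zeta> (rep_vec P) ^ d = \<zeta> (rep_vec P) ^ i * (\<zeta> (rep_vec P) ^ j * \<zeta> (rep_vec P) ^ (d - i - j))"
          using ij(1) by (simp add: power_add[symmetric])
        then show "c' (pt P) * x (pt P) = c P * ?f (rep_vec P)"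
          unfolding f c'[OF P] ij(2) using \<zeta>nz[OF P]
          by (simp add: mon_on_def pt_def power_divide)
      qed
      ultimately show "(\<Sum>p\<in>pt ` S. c' p * x p) = 0" by simp
    qed
  qed
  have cardpt: "card (pt ` S) = card S" by (rule card_image[OF inj])
  have common: "card S \<le> 2 * card {P \<in> A. R P}" if "\<And>P. P \<in> S \<Longrightarrow> R P" for R
    by (rule card_common_part[OF finA finB _ SAB that S1 S2]) (simp add: A(1) B(1))
  show thesis
  proof (cases "card S \<le> 2 * d + 1")
    case True
    then obtain l where l: "l \<noteq> 0" "\<forall>p\<in>pt ` S. lin l p = 0"
      using relation_in_line[OF full] cardpt by auto
    obtain x y z where xyz: "l = (x, y, z)" by (cases l)
    define K where "K = {v :: complex ^ 3. x * v $ 1 + y * v $ 2 + z * \<zeta> v = 0}"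
    have "vec.subspace K"
    proof (rule vec.subspaceI)
      show "0 \<in> K" by (simp add: K_def \<zeta>_def)
    next
      fix u v assume "u \<in> K" "v \<in> K"
      then have "(x * u $ 1 + y * u $ 2 + z * \<zeta> u) + (x * v $ 1 + y * v $ 2 + z * \<zeta> v) = 0" by (simp add: K_def)
      then show "u + v \<in> K" by (simp add: K_def \<zeta>_def algebra_simps)
    next
      fix k v assume "v \<in> K"
      then have "k * (x * v $ 1 + y * v $ 2 + z * \<zeta> v) = 0" by (simp add: K_def)
      then show "k *s v \<in> K" by (simp add: K_def \<zeta>_def algebra_simps)
    qed
    moreover have "K \<noteq> UNIV"
    proof
      assume "K = UNIV"
      then have "vector [u, v, w] \<in> K" for u v w by simp
      then have *: "x * u + y * v + z * (s\<^sup>2 * u + s * v + w) = 0" for u v w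
        by (simp add: K_def \<zeta>_def)
      have "z = 0" using *[of 0 0 1] by simp
      moreover have "x = 0" using *[of 1 0 0] calculation by simp
      moreover have "y = 0" using *[of 0 1 0] calculation by simp
      ultimately show False using l(1) by (simp add: xyz zero_prod_def)
    qed
    moreover have "rep_vec P \<in> K" if "P \<in> S" for P
    proof -
      have "lin l (pt P) = 0" using l(2) that by blast
      then have "\<zeta> (rep_vec P) * (x * (rep_vec P $ 1 / \<zeta> (rep_vec P)) + y * (rep_vec P $ 2 / \<zeta> (rep_vec P)) + z) = 0"
        by (simp add: xyz lin_def pt_def)
      then show ?thesis using \<zeta>nz[OF that] by (simp add: K_def algebra_simps)
    qed
    then have "card S \<le> 2 * card {P \<in> A. rep_vec P \<in> K}" by (rule common)
    moreover have "d + 2 \<le> card S" using card_ge_of_relation[OF full] Sne cardpt by simp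
    ultimately show thesis using line by (meson order_trans)
  next
    case False
    have "card (pt ` S) + 1 \<le> 3 * d" using cardS r cardpt by simp
    then obtain k where k: "quad_nz k" "\<forall>p\<in>pt ` S. quad k p = 0" using relation_in_conic[OF full] by blast
    \<comment> \<open>The polar form of the conic, homogenised with \<open>\<zeta>\<close> in place
      of the constant 1.\<close>
    define b :: "complex ^ 3 \<Rightarrow> complex ^ 3 \<Rightarrow> complex" where "b v w = k 0 * (v $ 1 * w $ 1) + k 1 / 2 * (v $ 1 * w $ 2 + v $ 2 * w $ 1) + k 2 * (v $ 2 * w $ 2)
      + k 3 / 2 * (v $ 1 * \<zeta> w + \<zeta> v * w $ 1) + k 4 / 2 * (v $ 2 * \<zeta> w + \<zeta> v * w $ 2) + k 5 * (\<zeta> v * \<zeta> w)" for v w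
    have \<zeta>lin: "\<zeta> (u + v) = \<zeta> u + \<zeta> v" "\<zeta> (e *s v) = e * \<zeta> v" for u v e
      by (simp_all add: \<zeta>_def algebra_simps)
    have bb: "b v v = k 0 * (v $ 1)\<^sup>2 + k 1 * (v $ 1 * v $ 2) + k 2 * (v $ 2)\<^sup>2 + k 3 * (v $ 1 * \<zeta> v) + k 4 * (v $ 2 * \<zeta> v) + k 5 * (\<zeta> v)\<^sup>2" for v
      by (simp add: b_def power2_eq_square algebra_simps)
    \<comment> \<open>The values at (0,0), (1,0), (-1,0), (0,1), (0,-1) and (1,1) determine all six
      coefficients.\<close>
    have "\<exists>x y. quad k (x, y) \<noteq> 0"
    proof (rule ccontr)
      assume "\<not> ?thesis"
      then have *: "k 0 * x\<^sup>2 + k 1 * (x * y) + k 2 * y\<^sup>2 + k 3 * x + k 4 * y + k 5 = 0" for x y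
        by (simp add: quad_def)
      have k5: "k 5 = 0" using *[of 0 0] by simp
      have "k 0 + k 3 = 0" "k 0 - k 3 = 0" using *[of 1 0] *[of "-1" 0] k5 by simp_all
      then have k03: "k 0 = 0" "k 3 = 0" by (auto simp: algebra_simps add_eq_0_iff)
      have "k 2 + k 4 = 0" "k 2 - k 4 = 0" using *[of 0 1] *[of 0 "-1"] k5 by simp_all
      then have k24: "k 2 = 0" "k 4 = 0" by (auto simp: algebra_simps add_eq_0_iff)
      have k1: "k 1 = 0" using *[of 1 1] k5 k03 k24 by simp
      have "k i = 0" if "i < 6" for i
      proof -
        have "i = 0 \<or> i = 1 \<or> i = 2 \<or> i = 3 \<or> i = 4 \<or> i = 5" using that by linarith
        then show ?thesis using k5 k03 k24 k1 by blast
      qed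
      then show False using k(1) by (auto simp: quad_nz_def)
    qed
    then obtain x y where xy: "quad k (x, y) \<noteq> 0" by blast
    define z where "z = (vector [x, y, 1 - s\<^sup>2 * x - s * y] :: complex ^ 3)"
    have z: "z $ 1 = x" "z $ 2 = y" "\<zeta> z = 1" by (simp_all add: z_def \<zeta>_def)
    have "b (rep_vec P) (rep_vec P) = 0" if "P \<in> S" for P
    proof -
      have "quad k (pt P) = 0" using k(2) that by blast
      then have "(\<zeta> (rep_vec P))\<^sup>2 * quad k (pt P) = 0" by simp
      moreover have "(\<zeta> (rep_vec P))\<^sup>2 * quad k (pt P) = b (rep_vec P) (rep_vec P)"
        unfolding bb quad_def pt_def using \<zeta>nz[OF that] by (simp add: field_simps power2_eq_square)
      ultimately show ?thesis by simp
    qed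
    then have "card S \<le> 2 * card {P \<in> A. b (rep_vec P) (rep_vec P) = 0}" by (rule common)
    then have big: "2 * card {P \<in> A. b (rep_vec P) (rep_vec P) = 0} \<ge> 2 * d + 2" using False by simp
    show thesis
    proof (rule conic[of b z, OF _ _ _ _ big])
      show "b (u + v) w = b u w + b v w" for u v w by (simp add: b_def \<zeta>lin algebra_simps)
      show "b (e *s u) w = e * b u w" for e u w by (simp add: b_def \<zeta>lin algebra_simps)
      show "b u v = b v u" for u v by (simp add: b_def algebra_simps)
      show "b z z \<noteq> 0" unfolding bb z using xy by (simp add: quad_def)
    qed
  qed
qed

theorem theorem3p7:
  fixes n d r :: nat and T :: "3 cpoly" and A :: "3 proj_space set"
  assumes "d = 8 + 2 * n"
    and "is_form d T" and "T \<noteq> 0"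
    and "decomposition d T A" and "nonredundant d T A"
    and "card A = r" and "r \<le> 11 + 3 * n"
    and "form_rank d T = r"
  shows "(\<forall>B. decomposition d T B \<and> card B = r \<longrightarrow> B = A) \<or>
    (\<exists>W. positive_dim_family d T r A W)"
proof (cases "\<forall>B. decomposition d T B \<and> card B = r \<longrightarrow> B = A")
  case False
  then obtain B where B: "card B = r" "decomposition d T B" "A \<noteq> B" by blast
  define m where "m = 4 + n"
  have d: "d = 2 * m" "m \<ge> 1" using assms(1) by (simp_all add: m_def)
  have bound: "2 * r + 1 \<le> 3 * d" using assms(1,7) by simp
  have "\<exists>W. positive_dim_family d T r A W"
  proof (rule two_decompositions_on_line_or_conic[OF assms(2,8,6,4) B bound])
    fix K assume line: "vec.subspace K" "K \<noteq> UNIV" "2 * card {P \<in> A. rep_vec P \<in> K} \<ge> d + 2"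
    have "card {P \<in> A. rep_vec P \<in> K} \<ge> Suc m" using line(3) d(1) by simp
    then show ?thesis by (rule plane_family[OF assms(2,8,6,4) d line(1,2)])
  next
    fix b :: "complex ^ 3 \<Rightarrow> complex ^ 3 \<Rightarrow> complex" and z
    assume conic: "\<And>u v w. b (u + v) w = b u w + b v w" "\<And>c u w. b (c *s u) w = c * b u w"
      "\<And>u v. b u v = b v u" "b z z \<noteq> 0" "2 * card {P \<in> A. b (rep_vec P) (rep_vec P) = 0} \<ge> 2 * d + 2"
    have "card {P \<in> A. b (rep_vec P) (rep_vec P) = 0} \<ge> 2 * m + 1" using conic(5) d(1) by simp
    then show ?thesis by (rule conic_family[OF assms(2,8,6,4) d conic(1-4)])
  qed
  then show ?thesis by blast
qed simp

end
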